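(* Let $N\ge 2$, let $\vec u=(u_1,\dots,u_{N-1})\in\mathbf C^{N-1}$, and let $W$ be any right Whittaker module over $\mathfrak m_N$. Then the Kirillov projector $P_{\mathfrak m_N}(\vec u)$ has a well-defined action on $W$, and it defines the unique linear operator on $W$ (acting on the right) that satisfies $$P_{\mathfrak m_N}(\vec u)^2=P_{\mathfrak m_N}(\vec u),$$ $$P_{\mathfrak m_N}(\vec u)\cdot(E_{ij}-\delta_{i,j+1})=0\quad (1\le j<i\le N),$$ $$(E_{ij}+\delta_{ij}u_j)\cdot P_{\mathfrak m_N}(\vec u)=0\quad (1\le i\le j\le N-1),$$ and acts by the identity on the space of Whittaker vectors of $W$. (Products are products of operators acting on the right: $w\cdot(AB)=(w\cdot A)\cdot B$.)
   Context: $\mathbf C$ is an algebraically closed field of characteristic zero (here $\hbar=1$). $E_{ij}$ are the matrix units of $\mathfrak{gl}_N$. The mirabolic subalgebra is $\mathfrak m_N=\mathrm{span}(E_{ij}: 1\le i\le N,\ 1\le j\le N-1)\subset\mathfrak{gl}_N$ (matrices with zero last column). $\mathfrak n_-=\mathrm{span}(E_{ij}:N\ge i>j\ge1)\subset\mathfrak m_N$, and $\psi:\mathfrak n_-\to\mathbf C$ is the character with $\psi(E_{i+1,i})=1$ and $\psi(E_{ij})=0$ for $i>j+1$. For $x\in\mathfrak n_-$ put $x^\psi=x-\psi(x)\in \mathrm U(\mathfrak m_N)$, and $\mathfrak n_-^\psi=\{x^\psi\mid x\in\mathfrak n_-\}$. A right Whittaker module over $\mathfrak m_N$ is a right $\mathrm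 U(\mathfrak m_N)$-module on which $\mathfrak n_-^\psi$ acts locally nilpotently. A Whittaker vector is $w\in W$ with $w\cdot x^\psi=0$ for all $x\in\mathfrak n_-$. Quantum minors: $L_{ij}(u)=\delta_{ij}u+E_{ij}$ and $$L^{a_1\dots a_m}_{b_1\dots b_m}(u)=\sum_{\sigma\in S_m}\mathrm{sgn}(\sigma)\,L_{a_{\sigma(1)}b_1}(u)L_{a_{\sigma(2)}b_2}(u-1)\cdots L_{a_{\sigma(m)}b_m}(u-m+1).$$ For $i>j$ put $$P^\psi_{ij}(u)=\sum_{k\ge0}(-1)^{(i+j)k}(-E^\psi_{ij})^k\,\frac{L_{j\dots i-1}^{j\dots i-1}(u)\,L_{j\dots i-1}^{j\dots i-1}(u-1)\cdots L_{j\dots i-1}^{j\dots i-1}(u-k+1)}{k!}.$$ On a right Whittaker module, the sum is finite on every vector. The Kirillov projector is the ordered product $$P_{\mathfrak m_N}(\vec u)=\bigl(P^\psi_{N,N-1}(u_{N-1})\bigr)\bigl(P^\psi_{N-1,N-2}(u_{N-2})P^\psi_{N,N-2}(u_{N-2})\bigr)\cdots\bigl(P^\psi_{21}(u_1)P^\psi_{31}(u_1)\cdots P^\psi_{N1}(u_1)\bigr).$$ *)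

theory Defs
  imports
    "HOL-Library.Poly_Mapping"
    "HOL-Combinatorics.Permutations"
    "HOL-Computational_Algebra.Polynomial"
    "HOL-Algebra.QuotRing"
    "HOL-Algebra.Algebraic_Closure_Type"
begin

text \<open>
  The free associative algebra on letters \<open>(i, j)\<close> is the monoid algebra of the free monoid
  of words; \<open>poly_mapping\<close> supplies the convolution product once words form a \<open>monoid_add\<close>.
\<close>

datatype 'a fmonoid = FMon "'a list"

instantiation fmonoid :: (type) monoid_add
begin

definition zero_fmonoid :: "'a fmonoid" where
  "zero_fmonoid = FMon []"

fun plus_fmonoid :: "'a fmonoid \<Rightarrow> 'a fmonoid \<Rightarrow> 'a fmonoid" where
  "plus_fmonoid (FMon xs) (FMon ys) = FMon (xs @ ys)"

instance
proof
  fix a b c :: "'a fmonoid"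
  show "a + b + c = a + (b + c)"
    by (cases a; cases b; cases c) simp
  show "0 + a = a" "a + 0 = a"
    by (cases a; simp add: zero_fmonoid_def)+
qed

end

type_synonym 'k free_alg = "(nat \<times> nat) fmonoid \<Rightarrow>\<^sub>0 'k"

definition scalar :: "'k::zero \<Rightarrow> 'k free_alg" where
  "scalar c = Poly_Mapping.single 0 c"

definition E :: "nat \<Rightarrow> nat \<Rightarrow> 'k::zero_neq_one free_alg" where
  "E i j = Poly_Mapping.single (FMon [(i, j)]) 1"

definition mirabolic_index :: "nat \<Rightarrow> (nat \<times> nat) set" where
  "mirabolic_index N = {1..N} \<times> {1..<N}"

text \<open>
  The universal enveloping algebra of the mirabolic subalgebra, as the free algebra modulo the
  commutation relations of its matrix units. The letters outside the index set, which do not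
  belong to the mirabolic subalgebra, are set to zero.
\<close>

definition mirabolic_relations :: "nat \<Rightarrow> 'k::field free_alg set" where
  "mirabolic_relations N =
     {E i j | i j. (i, j) \<notin> mirabolic_index N} \<union>
     {E i j * E k l - E k l * E i j
        - ((if j = k then E i l else 0) - (if l = i then E k j else 0)) | i j k l.
        (i, j) \<in> mirabolic_index N \<and> (k, l) \<in> mirabolic_index N}"

definition mirabolic_ideal :: "nat \<Rightarrow> 'k::field free_alg set" where
  "mirabolic_ideal N = Idl\<^bsub>ring_of_type_algebra\<^esub> (mirabolic_relations N)"

definition U_mirabolic :: "nat \<Rightarrow> 'k::field free_alg set ring" where
  "U_mirabolic N = ring_of_type_algebra Quot (mirabolic_ideal N)"

definition cls :: "nat \<Rightarrow> 'k::field free_alg \<Rightarrow> 'k free_alg set" where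
  "cls N a = mirabolic_ideal N +>\<^bsub>ring_of_type_algebra\<^esub> a"

lemma ring_ring_of_type_algebra: "ring (ring_of_type_algebra :: 'a::ring_1 ring)"
proof -
  have "\<exists>y. x + y = 0" "\<exists>y. y + x = 0 \<and> x + y = 0" for x :: 'a
    by (rule exI[of _ "- x"], simp)+
  then show ?thesis
    unfolding ring_of_type_algebra_def
    by unfold_locales (auto simp: algebra_simps Units_def)
qed

lemma ideal_mirabolic_ideal: "ideal (mirabolic_ideal N) ring_of_type_algebra"
  unfolding mirabolic_ideal_def
  by (rule ring.genideal_ideal[OF ring_ring_of_type_algebra]) (simp add: ring_of_type_algebra_def)

lemma ring_U_mirabolic: "ring (U_mirabolic N)"
  unfolding U_mirabolic_def by (rule ideal.quotient_is_ring[OF ideal_mirabolic_ideal])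

text \<open>
  Elements of the nilpotent subalgebra are strictly lower triangular matrices, with entries
  indexed from 1; \<open>shifted N x\<close> represents \<open>x - \<psi>(x)\<close> in the enveloping algebra.
\<close>

definition n_minus :: "nat \<Rightarrow> (nat \<Rightarrow> nat \<Rightarrow> 'k::field) set" where
  "n_minus N = {x. \<forall>i j. x i j \<noteq> 0 \<longrightarrow> 1 \<le> j \<and> j < i \<and> i \<le> N}"

definition psi :: "nat \<Rightarrow> (nat \<Rightarrow> nat \<Rightarrow> 'k::field) \<Rightarrow> 'k" where
  "psi N x = (\<Sum>i\<in>{1..<N}. x (Suc i) i)"

definition shifted :: "nat \<Rightarrow> (nat \<Rightarrow> nat \<Rightarrow> 'k::field) \<Rightarrow> 'k free_alg" where
  "shifted N x = (\<Sum>(i, j)\<in>mirabolic_index N. scalar (x i j) * E i j) - scalar (psi N x)"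

definition E_shifted :: "nat \<Rightarrow> nat \<Rightarrow> 'k::field free_alg" where
  "E_shifted i j = E i j - scalar (if i = Suc j then 1 else 0)"

lemma shifted_matrix_unit:
  assumes "1 \<le> j" "j < i" "i \<le> N"
  shows "shifted N (\<lambda>a b. if a = i \<and> b = j then 1 else 0) = (E_shifted i j :: 'k::field free_alg)"
proof -
  have idx: "(i, j) \<in> mirabolic_index N" "finite (mirabolic_index N)"
    using assms by (auto simp: mirabolic_index_def)
  have "(\<Sum>(a, b)\<in>mirabolic_index N. scalar (if a = i \<and> b = j then 1 else 0) * (E a b :: 'k free_alg))
      = (\<Sum>p\<in>mirabolic_index N. if p = (i, j) then E i j else 0)"
    by (rule sum.cong) (auto simp: scalar_def intro: ccontr)
  also have "\<dots> = E i j"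
    using idx by simp
  finally have 1: "(\<Sum>(a, b)\<in>mirabolic_index N.
      scalar (if a = i \<and> b = j then 1 else 0) * (E a b :: 'k free_alg)) = E i j" .
  have "psi N (\<lambda>a b. if a = i \<and> b = j then 1 else 0) =
      (\<Sum>a\<in>{1..<N}. if a = j then (if i = Suc j then 1 else 0) else (0 :: 'k))"
    unfolding psi_def by (rule sum.cong) auto
  also have "\<dots> = (if i = Suc j then 1 else 0)"
    using assms by simp
  finally have 2: "psi N (\<lambda>a b. if a = i \<and> b = j then 1 else 0) =
      (if i = Suc j then 1 else (0 :: 'k))" .
  show ?thesis
    unfolding shifted_def E_shifted_def using 1 2 by simp
qed

locale right_module =
  fixes R (structure)
    and act :: "'w::ab_group_add \<Rightarrow> 'a \<Rightarrow> 'w"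
  assumes act_add_left: "x \<in> carrier R \<Longrightarrow> act (v + w) x = act v x + act w x"
    and act_add_right: "\<lbrakk>x \<in> carrier R; y \<in> carrier R\<rbrakk> \<Longrightarrow> act w (x \<oplus> y) = act w x + act w y"
    and act_mult: "\<lbrakk>x \<in> carrier R; y \<in> carrier R\<rbrakk> \<Longrightarrow> act w (x \<otimes> y) = act (act w x) y"
    and act_one: "act w \<one> = w"

locale whittaker_module = right_module "U_mirabolic N" act + vector_space scale
  for N :: nat
    and scale :: "'k::field \<Rightarrow> 'w::ab_group_add \<Rightarrow> 'w"
    and act :: "'w \<Rightarrow> 'k free_alg set \<Rightarrow> 'w" +
  assumes act_scalar: "act w (cls N (scalar c)) = scale c w"
    and locally_nilpotent:
      "x \<in> n_minus N \<Longrightarrow> \<exists>n. ((\<lambda>v. act v (cls N (shifted N x))) ^^ n) w = 0"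

definition whittaker_vectors ::
    "nat \<Rightarrow> ('w::ab_group_add \<Rightarrow> 'k::field free_alg set \<Rightarrow> 'w) \<Rightarrow> 'w set" where
  "whittaker_vectors N act = {w. \<forall>x\<in>n_minus N. act w (cls N (shifted N x)) = 0}"

definition L :: "nat \<Rightarrow> nat \<Rightarrow> 'k::field \<Rightarrow> 'k free_alg" where
  "L i j u = (if i = j then scalar u else 0) + E i j"

text \<open>
  In \<open>qminor as bs u\<close> the rows are \<open>as\<close> and the columns \<open>bs\<close>, counted from 0, so the
  factor at position \<open>r\<close> has its parameter shifted by \<open>r\<close>.
\<close>

definition qminor :: "nat list \<Rightarrow> nat list \<Rightarrow> 'k::field \<Rightarrow> 'k free_alg" where
  "qminor as bs u =
     (\<Sum>\<sigma>\<in>{\<sigma>. \<sigma> permutes {..<length bs}}.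
        of_int (sign \<sigma>) *
        prod_list (map (\<lambda>r. L (as ! \<sigma> r) (bs ! r) (u - of_nat r)) [0..<length bs]))"

definition P_term :: "nat \<Rightarrow> nat \<Rightarrow> 'k::field_char_0 \<Rightarrow> nat \<Rightarrow> 'k free_alg" where
  "P_term i j u k =
     scalar ((- 1) ^ ((i + j) * k) / fact k) * (- E_shifted i j) ^ k *
     prod_list (map (\<lambda>l. qminor [j..<i] [j..<i] (u - of_nat l)) [0..<k])"

text \<open>
  \<open>Sum_any\<close> sums over the indices with nonzero summand, if these are finite in number.
\<close>

definition P_op ::
    "nat \<Rightarrow> ('w::ab_group_add \<Rightarrow> 'k::field_char_0 free_alg set \<Rightarrow> 'w) \<Rightarrow>
     nat \<Rightarrow> nat \<Rightarrow> 'k \<Rightarrow> 'w \<Rightarrow> 'w" where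
  "P_op N act i j u w = Sum_any (\<lambda>k. act w (cls N (P_term i j u k)))"

text \<open>
  The pairs \<open>(i, j)\<close> run through
  \<open>(N,N-1), (N-1,N-2), (N,N-2), \<dots>, (2,1), (3,1), \<dots>, (N,1)\<close>. Operators act on the right,
  so the leftmost factor of the product is applied first, as \<open>fold\<close> does.
\<close>

definition kirillov_projector ::
    "nat \<Rightarrow> ('w::ab_group_add \<Rightarrow> 'k::field_char_0 free_alg set \<Rightarrow> 'w) \<Rightarrow>
     (nat \<Rightarrow> 'k) \<Rightarrow> 'w \<Rightarrow> 'w" where
  "kirillov_projector N act u =
     fold (\<lambda>(i, j). P_op N act i j (u j))
       (concat (map (\<lambda>j. map (\<lambda>i. (i, j)) [Suc j..<Suc N]) (rev [1..<N])))"

text \<open>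
  For operators acting on the right, \<open>w \<cdot> (P X)\<close> is \<open>act (P w) X\<close> and
  \<open>w \<cdot> (X P)\<close> is \<open>P (act w X)\<close>.
\<close>

definition kirillov_conditions ::
    "nat \<Rightarrow> ('k::field \<Rightarrow> 'w::ab_group_add \<Rightarrow> 'w) \<Rightarrow> ('w \<Rightarrow> 'k free_alg set \<Rightarrow> 'w) \<Rightarrow>
     (nat \<Rightarrow> 'k) \<Rightarrow> ('w \<Rightarrow> 'w) \<Rightarrow> bool" where
  "kirillov_conditions N scale act u P \<longleftrightarrow>
     Vector_Spaces.linear scale scale P \<and>
     (\<forall>w. P (P w) = P w) \<and>
     (\<forall>i j w. 1 \<le> j \<and> j < i \<and> i \<le> N \<longrightarrow>
        act (P w) (cls N (E i j - scalar (if i = j + 1 then 1 else 0))) = 0) \<and>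
     (\<forall>i j w. 1 \<le> i \<and> i \<le> j \<and> j \<le> N - 1 \<longrightarrow>
        P (act w (cls N (E i j + scalar (if i = j then u j else 0)))) = 0) \<and>
     (\<forall>w\<in>whittaker_vectors N act. P w = w)"

end

theory Submission
  imports Defs "HOL-Library.Groups_Big_Fun" "Jordan_Normal_Form.Determinant"
begin

text \<open>
  Order the factors by columns. For a column \<open>p\<close> and \<open>p \<le> m\<close>, consider the space \<open>V s\<close>
  (\<open>wspace p m s\<close>) of vectors that are Whittaker for the indices \<open>p..m\<close> and on which, for every
  row \<open>a > m\<close>, the entries \<open>E a c\<close> are determined by \<open>E a p\<close> through a quantum Hessenberg
  recursion with parameter \<open>s\<close>. On these spaces \<open>E (m+1) p\<close> (shifted by the character) maps
  \<open>V s\<close> to \<open>V (s - 1)\<close>, the principal quantum minor \<open>D (s + 1)\<close> maps \<open>V s\<close> to \<open>V (s + 1)\<close>,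
  and their commutator is \<open>\<plusminus>1\<close>. The factor of the projector is therefore the projector of a
  Weyl algebra: its image in \<open>V s\<close> is annihilated by the shifted \<open>E (m+1) p\<close>, and lies in
  the corresponding space for \<open>m + 1\<close>. Inductively the whole product maps to Whittaker vectors.

  All terms except the identity end in a quantum minor, which on Whittaker vectors lies in the
  span of the \<open>W (E i j + \<delta> i j u j)\<close> with \<open>i \<le> j\<close>. So any additive map that vanishes on this
  span is unchanged by composition with the projector, which gives uniqueness. It also reduces
  the vanishing of the projector on this span to finding one additive map that vanishes there and
  fixes Whittaker vectors; such a map is a product of simpler rank one factors (\<open>borel_proj\<close>).
\<close>

section \<open>Minors over a noncommutative ring\<close>

text \<open>The Weyl relation is not an identity of the algebra. There the commutator of
  \<open>E (m+1) p\<close> with a principal minor is another minor; a scalar remains only on vectors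
  that satisfy the recursion, and only if the parameter of the minor changes by one when the two
  factors change places. This is why spaces of vectors are followed instead of computing with the
  projector itself.

  The recursion says that columns \<open>p..m-1\<close> of \<open>L\<close> annihilate the row
  \<open>(E a p, ..., E a m)\<close>. On Whittaker vectors \<open>L\<close> is a Hessenberg matrix
  with ones below the diagonal, so each column of this equation determines the next entry of the
  row.

  The parameters of the minors are forced. After \<open>k\<close> applications of the shifted
  \<open>E (m+1) p\<close>, a vector of \<open>V s\<close> lies in \<open>V (s - k)\<close>, and the
  factors \<open>D (s - k + 1)\<close>, ..., \<open>D s\<close> bring it back to \<open>V s\<close>.
  At the start of a column \<open>m = p\<close>, and \<open>V s\<close> is the whole space for every
  \<open>s\<close>; this freedom is the parameter \<open>u p\<close>.\<close>

lemma permutation_sum_first_column: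
  fixes f :: "nat \<Rightarrow> 'b \<Rightarrow> 'r::ring_1"
  assumes len: "length xs = Suc n"
  shows "(\<Sum>\<sigma>\<in>{\<sigma>. \<sigma> permutes {..<Suc n}}.
            of_int (sign \<sigma>) * prod_list (map (\<lambda>r. f r (xs ! \<sigma> r)) [0..<Suc n]))
       = (\<Sum>p<Suc n. (- 1) ^ p * f 0 (xs ! p) *
           (\<Sum>\<sigma>\<in>{\<sigma>. \<sigma> permutes {..<n}}. of_int (sign \<sigma>) *
              prod_list (map (\<lambda>r. f (Suc r) ((take p xs @ drop (Suc p) xs) ! \<sigma> r)) [0..<n])))"
proof -
  let ?g = "\<lambda>\<sigma>. of_int (sign \<sigma>) * prod_list (map (\<lambda>r. f r (xs ! \<sigma> r)) [0..<Suc n])"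
  let ?S = "{\<sigma>. \<sigma> permutes {0..<Suc n}}" and ?T = "{\<sigma>. \<sigma> permutes {0..<n}}"
  have "sum ?g ?S = (\<Sum>p<Suc n. sum ?g {\<sigma>\<in>?S. \<sigma> 0 = p})"
  proof (rule sum.group[symmetric])
    show "finite ?S" by (simp add: finite_permutations)
    show "(\<lambda>\<sigma>. \<sigma> 0) ` ?S \<subseteq> {..<Suc n}"
    proof
      fix y assume "y \<in> (\<lambda>\<sigma>. \<sigma> 0) ` ?S"
      then obtain \<sigma> where "\<sigma> permutes {0..<Suc n}" "y = \<sigma> 0" by auto
      then have "y \<in> {0..<Suc n}" using permutes_in_image[of \<sigma> "{0..<Suc n}" 0] by simp
      then show "y \<in> {..<Suc n}" by simp
    qed
  qed simp
  also have "\<dots> = (\<Sum>p<Suc n. (- 1) ^ p * f 0 (xs ! p) *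
           (\<Sum>\<sigma>\<in>?T. of_int (sign \<sigma>) *
              prod_list (map (\<lambda>r. f (Suc r) ((take p xs @ drop (Suc p) xs) ! \<sigma> r)) [0..<n])))"
  proof (rule sum.cong[OF refl])
    fix p assume "p \<in> {..<Suc n}"
    then have p: "p < Suc n" by simp
    \<comment> \<open>\<open>permutation_insert 0 p\<close> extends a permutation of the remaining
      positions by \<open>\<sigma> 0 = p\<close> and contributes the sign \<open>(- 1) ^ p\<close>.
      The factor at position 0 stands leftmost, so no entries are commuted past each other.\<close>
    have img: "{\<sigma>\<in>?S. \<sigma> 0 = p} = permutation_insert 0 p ` ?T"
      using permutation_fix[of 0 n p] p by auto
    have summand: "?g (permutation_insert 0 p \<tau>) = (- 1) ^ p * f 0 (xs ! p) * (of_int (sign \<tau>) *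
              prod_list (map (\<lambda>r. f (Suc r) ((take p xs @ drop (Suc p) xs) ! \<tau> r)) [0..<n]))"
      if t: "\<tau> permutes {0..<n}" for \<tau>
    proof -
      have sgn: "(of_int (sign (permutation_insert 0 p \<tau>)) :: 'r) = (-1) ^ p * of_int (sign \<tau>)"
        using signof_permutation_insert[OF t, of 0 p] p by simp
      have nth: "xs ! permutation_insert 0 p \<tau> (Suc r) = (take p xs @ drop (Suc p) xs) ! \<tau> r"
        if "r < n" for r
      proof -
        have "\<tau> r < n" using permutes_in_image[OF t, of r] that by simp
        then show ?thesis
          using p len by (auto simp: permutation_insert_expand nth_append)
      qed
      have "prod_list (map (\<lambda>r. f r (xs ! permutation_insert 0 p \<tau> r)) [0..<Suc n])
          = f 0 (xs ! p) * prod_list (map (\<lambda>r. f (Suc r) (xs ! permutation_insert 0 p \<tau> (Suc r))) [0..<n])"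
        by (simp add: map_upt_Suc del: upt_Suc)
      also have "map (\<lambda>r. f (Suc r) (xs ! permutation_insert 0 p \<tau> (Suc r))) [0..<n]
          = map (\<lambda>r. f (Suc r) ((take p xs @ drop (Suc p) xs) ! \<tau> r)) [0..<n]"
        using nth by simp
      finally have pl: "prod_list (map (\<lambda>r. f r (xs ! permutation_insert 0 p \<tau> r)) [0..<Suc n])
          = f 0 (xs ! p) * prod_list (map (\<lambda>r. f (Suc r) ((take p xs @ drop (Suc p) xs) ! \<tau> r)) [0..<n])" .
      have "of_int (sign \<tau>) * (f 0 (xs ! p) * x) = f 0 (xs ! p) * (of_int (sign \<tau>) * x)" for x
        using mult_of_int_commute[of "sign \<tau>" "f 0 (xs ! p)"] by (simp add: mult.assoc[symmetric])
      then show ?thesis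
        unfolding pl sgn by (simp add: mult.assoc)
    qed
    have "sum ?g {\<sigma>\<in>?S. \<sigma> 0 = p} = (\<Sum>\<tau>\<in>?T. ?g (permutation_insert 0 p \<tau>))"
      unfolding img using permutation_insert_inj_on[of 0 n p] p by (subst sum.reindex) auto
    also have "\<dots> = (\<Sum>\<tau>\<in>?T. (- 1) ^ p * f 0 (xs ! p) * (of_int (sign \<tau>) *
              prod_list (map (\<lambda>r. f (Suc r) ((take p xs @ drop (Suc p) xs) ! \<tau> r)) [0..<n])))"
      by (rule sum.cong[OF refl]) (rule summand, simp)
    finally show "sum ?g {\<sigma>\<in>?S. \<sigma> 0 = p} = (- 1) ^ p * f 0 (xs ! p) *
           (\<Sum>\<sigma>\<in>?T. of_int (sign \<sigma>) *
              prod_list (map (\<lambda>r. f (Suc r) ((take p xs @ drop (Suc p) xs) ! \<sigma> r)) [0..<n]))"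
      unfolding sum_distrib_left .
  qed
  finally show ?thesis by (simp add: lessThan_atLeast0)
qed

section \<open>Signs of a row within a set of rows\<close>

text \<open>\<open>- 1\<close> to the position of \<open>a\<close> in the increasing list of
  \<open>A\<close>. It is also used for \<open>a\<close> outside \<open>A\<close>, as the sign of
  the position that \<open>a\<close> takes when it is inserted.\<close>

definition pos_sign :: "nat \<Rightarrow> nat set \<Rightarrow> 'r::ring_1" where
  "pos_sign a A = (- 1) ^ card {x \<in> A. x < a}"

lemma pos_sign_commute: "x * pos_sign a A = (pos_sign a A :: 'r::ring_1) * x"
  by (simp add: pos_sign_def minus_one_power_iff)

lemma pos_sign_Diff_less:
  "finite A \<Longrightarrow> x \<in> A \<Longrightarrow> x < a \<Longrightarrow> pos_sign a (A - {x}) = - (pos_sign a A :: 'r::ring_1)"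
proof -
  assume "finite A" "x \<in> A" "x < a"
  then have "card {y \<in> A. y < a} = Suc (card {y \<in> A - {x}. y < a})"
    proof -
    have "{y \<in> A. y < a} = insert x {y \<in> A - {x}. y < a}"
      using \<open>x \<in> A\<close> \<open>x < a\<close> by auto
    then show ?thesis using \<open>finite A\<close> by simp
  qed
  then show ?thesis by (simp add: pos_sign_def)
qed

lemma pos_sign_Diff_ge: "\<not> x < a \<Longrightarrow> pos_sign a (A - {x}) = pos_sign a A"
  unfolding pos_sign_def by (rule arg_cong[of _ _ "\<lambda>B. (- 1) ^ card B"]) auto

lemma pos_sign_insert_less:
  "finite A \<Longrightarrow> x \<notin> A \<Longrightarrow> x < a \<Longrightarrow> pos_sign a (insert x A) = - (pos_sign a A :: 'r::ring_1)"
proof -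
  assume "finite A" "x \<notin> A" "x < a"
  then have "pos_sign a A = - (pos_sign a (insert x A) :: 'r)"
    using pos_sign_Diff_less[of "insert x A" x a] by simp
  then show ?thesis by simp
qed

lemma pos_sign_insert_ge: "\<not> x < a \<Longrightarrow> pos_sign a (insert x A) = pos_sign a A"
  unfolding pos_sign_def by (rule arg_cong[of _ _ "\<lambda>B. (- 1) ^ card B"]) auto

lemma pos_sign_square: "pos_sign a A * (pos_sign a A * x) = (x :: 'r::ring_1)"
  "pos_sign a A * pos_sign a A = (1 :: 'r::ring_1)"
  by (simp_all add: pos_sign_def minus_one_power_iff)

text \<open>In a strictly increasing list the position of an entry is the number of smaller entries,
  so a Laplace expansion over positions can be read as one over the set of rows.\<close>

lemma sum_sorted_list_positions:
  fixes F :: "nat \<Rightarrow> 'r \<Rightarrow> nat set \<Rightarrow> 'r::ring_1"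
  assumes "sorted xs" "distinct xs"
  shows "(\<Sum>p<length xs. F (xs ! p) ((- 1) ^ p) (set (take p xs @ drop (Suc p) xs)))
       = (\<Sum>a\<in>set xs. F a (pos_sign a (set xs)) (set xs - {a}))"
proof -
  have inj: "inj_on ((!) xs) {..<length xs}"
    using assms(2) by (simp add: inj_on_nth)
  have img: "(!) xs ` {..<length xs} = set xs"
    by (auto simp: in_set_conv_nth)
  have "(- 1) ^ p = (pos_sign (xs ! p) (set xs) :: 'r)"
    "set (take p xs @ drop (Suc p) xs) = set xs - {xs ! p}" if p: "p < length xs" for p
  proof -
    have strict: "sorted_wrt (<) xs"
      using assms by (simp add: strict_sorted_iff)
    have "{x \<in> set xs. x < xs ! p} = (!) xs ` {..<p}"
    proof -
      have *: "xs ! i < xs ! p \<longleftrightarrow> i < p" if "i < length xs" for i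
      proof (cases "i < p")
        case True
        with sorted_wrt_nth_less[OF strict True p] show ?thesis by simp
      next
        case False
        with that have "xs ! p \<le> xs ! i"
          using sorted_nth_mono[OF assms(1), of p i] by simp
        with False show ?thesis by simp
      qed
      show ?thesis
      proof (intro Set.set_eqI iffI)
        fix x assume "x \<in> {x \<in> set xs. x < xs ! p}"
        then obtain i where "i < length xs" "x = xs ! i" "xs ! i < xs ! p"
          by (auto simp: in_set_conv_nth)
        then show "x \<in> (!) xs ` {..<p}" using * by blast
      next
        fix x assume "x \<in> (!) xs ` {..<p}"
        then obtain i where "i < p" "x = xs ! i" by auto
        then show "x \<in> {x \<in> set xs. x < xs ! p}" using * p by simp
      qed
    qed
    moreover have "card ((!) xs ` {..<p}) = p"
      using card_image[OF inj_on_subset[OF inj, of "{..<p}"]] p by simp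
    ultimately show "(- 1) ^ p = (pos_sign (xs ! p) (set xs) :: 'r)"
      by (simp add: pos_sign_def)
    have "xs = take p xs @ xs ! p # drop (Suc p) xs"
      using p by (simp add: id_take_nth_drop)
    then have "distinct (take p xs @ xs ! p # drop (Suc p) xs)"
        "set xs = set (take p xs @ xs ! p # drop (Suc p) xs)"
      using assms(2) by metis+
    then show "set (take p xs @ drop (Suc p) xs) = set xs - {xs ! p}"
      by auto
  qed
  then have "(\<Sum>p<length xs. F (xs ! p) ((- 1) ^ p) (set (take p xs @ drop (Suc p) xs)))
     = (\<Sum>p<length xs. F (xs ! p) (pos_sign (xs ! p) (set xs)) (set xs - {xs ! p}))"
    by (intro sum.cong) auto
  also have "\<dots> = (\<Sum>a\<in>set xs. F a (pos_sign a (set xs)) (set xs - {a}))"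
    using sum.reindex[OF inj, of "\<lambda>a. F a (pos_sign a (set xs)) (set xs - {a})"] by (simp add: img)
  finally show ?thesis .
qed


section \<open>Quantum minors alternate in their columns\<close>

text \<open>The mirabolic subalgebra has no last column, so column indices stay below
  \<open>N\<close> while row indices reach \<open>N\<close>. Computing in a ring of class
  \<open>ring_1\<close> separates the algebra of minors from the construction of the
  quotient.\<close>

locale gl_relations =
  fixes sc :: "'k::field_char_0 \<Rightarrow> 'r::ring_1" and e :: "nat \<Rightarrow> nat \<Rightarrow> 'r" and N :: nat
  assumes sc_add: "sc (c + d) = sc c + sc d"
    and sc_mult: "sc (c * d) = sc c * sc d"
    and sc_one: "sc 1 = 1"
    and sc_commute: "x * sc c = sc c * x"
    and e_commute: "\<lbrakk>i \<in> {1..N}; j \<in> {1..<N}; k \<in> {1..N}; l \<in> {1..<N}\<rbrakk> \<Longrightarrow>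
      e i j * e k l = e k l * e i j + (if j = k then e i l else 0) - (if l = i then e k j else 0)"
begin

lemma sc_zero: "sc 0 = 0"
  using sc_add[of 0 0] by simp

lemma sc_minus: "sc (- c) = - sc c"
  using sc_add[of c "- c"] sc_zero by (simp add: eq_neg_iff_add_eq_0 add.commute)

lemma sc_diff: "sc (c - d) = sc c - sc d"
  using sc_add[of c "- d"] sc_minus by simp

text \<open>Division by 2 comes from the scalars: the ring receives \<open>1/2\<close> through
  \<open>sc\<close>.\<close>

lemma double_eq_zero: "x + x = 0 \<Longrightarrow> (x :: 'r) = 0"
proof -
  assume "x + x = 0"
  then have "sc (1/2) * (x + x) = 0" by simp
  then have "sc (1/2 + 1/2) * x = 0" unfolding sc_add by (simp add: algebra_simps)
  then show "x = 0" by (simp add: sc_one)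
qed

definition ell :: "nat \<Rightarrow> nat \<Rightarrow> 'k \<Rightarrow> 'r" where
  "ell i j u = (if i = j then sc u else 0) + e i j"

text \<open>Rows form a set and columns a list: independence of the order of the rows is built in,
  while alternation in the columns is a theorem. Sizes that do not match give 0, through the base
  case or an empty sum.\<close>

fun minor :: "nat set \<Rightarrow> nat list \<Rightarrow> 'k \<Rightarrow> 'r" where
  "minor A [] u = (if A = {} then 1 else 0)"
| "minor A (b # bs) u =
     (\<Sum>a\<in>A. pos_sign a A * ell a b u * minor (A - {a}) bs (u - 1))"

lemma minor_permutation_sum:
  assumes "sorted xs" "distinct xs" "length xs = length bs"
  shows "(\<Sum>\<sigma>\<in>{\<sigma>. \<sigma> permutes {..<length bs}}. of_int (sign \<sigma>) *
      prod_list (map (\<lambda>r. ell (xs ! \<sigma> r) (bs ! r) (u - of_nat r)) [0..<length bs]))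
    = minor (set xs) bs u"
  using assms
proof (induction bs arbitrary: xs u)
  case Nil
  then show ?case by (simp add: lessThan_atLeast0)
next
  case (Cons b bs)
  let ?n = "length bs"
  have len: "length xs = Suc ?n" using Cons.prems by simp
  have "(\<Sum>\<sigma>\<in>{\<sigma>. \<sigma> permutes {..<Suc ?n}}. of_int (sign \<sigma>) *
      prod_list (map (\<lambda>r. ell (xs ! \<sigma> r) ((b # bs) ! r) (u - of_nat r)) [0..<Suc ?n]))
    = (\<Sum>p<Suc ?n. (- 1) ^ p * ell (xs ! p) b u *
           (\<Sum>\<sigma>\<in>{\<sigma>. \<sigma> permutes {..<?n}}. of_int (sign \<sigma>) *
              prod_list (map (\<lambda>r. ell ((take p xs @ drop (Suc p) xs) ! \<sigma> r) (bs ! r) (u - 1 - of_nat r)) [0..<?n])))"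
    using permutation_sum_first_column[OF len, of "\<lambda>r a. ell a ((b # bs) ! r) (u - of_nat r)"]
    by (simp add: algebra_simps del: upt_Suc)
  also have "\<dots> = (\<Sum>p<Suc ?n. (- 1) ^ p * ell (xs ! p) b u *
           minor (set (take p xs @ drop (Suc p) xs)) bs (u - 1))"
  proof (rule sum.cong[OF refl], rule arg_cong[where f = "(*) _"])
    fix p assume "p \<in> {..<Suc ?n}"
    then have p: "p < length xs" using len by simp
    have "xs = take p xs @ xs ! p # drop (Suc p) xs"
      using p by (simp add: id_take_nth_drop)
    then have "sorted (take p xs @ xs ! p # drop (Suc p) xs)"
        "distinct (take p xs @ xs ! p # drop (Suc p) xs)"
      using Cons.prems(1,2) by metis+
    then show "(\<Sum>\<sigma>\<in>{\<sigma>. \<sigma> permutes {..<?n}}. of_int (sign \<sigma>) *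
              prod_list (map (\<lambda>r. ell ((take p xs @ drop (Suc p) xs) ! \<sigma> r) (bs ! r) (u - 1 - of_nat r)) [0..<?n]))
       = minor (set (take p xs @ drop (Suc p) xs)) bs (u - 1)"
      using p len by (intro Cons.IH) (auto simp: sorted_append)
  qed
  also have "\<dots> = minor (set xs) (b # bs) u"
    using sum_sorted_list_positions[of xs "\<lambda>a s A. s * ell a b u * minor A bs (u - 1)"]
      Cons.prems len by simp
  finally show ?case by simp
qed

text \<open>The RTT relation in the form suited to minors: symmetrizing over two columns gives an
  expression symmetric in the two rows. The shift of the parameter by 1 compensates for the
  commutators of the entries.\<close>

lemma ell_swap:
  assumes "a \<in> {1..N}" "a' \<in> {1..N}" "b \<in> {1..<N}" "b' \<in> {1..<N}"
  shows "ell a b u * ell a' b' (u - 1) + ell a b' u * ell a' b (u - 1)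
    = ell a' b u * ell a b' (u - 1) + ell a' b' u * ell a b (u - 1)"
proof -
  define d where "d i j = (if i = j then 1 else 0 :: 'r)" for i j :: nat
  define x1 x2 y1 y2 s where "x1 = e a b" and "x2 = e a' b'" and "y1 = e a b'" and "y2 = e a' b"
    and "s = sc u"
  have x: "x1 * x2 = x2 * x1 + (d a' b * y1 - d a b' * y2)"
    using e_commute[OF assms(1,3,2,4)] by (auto simp: x1_def x2_def y1_def y2_def d_def)
  have y: "y1 * y2 = y2 * y1 + (d a' b' * x1 - d a b * x2)"
    using e_commute[OF assms(1,4,2,3)] by (auto simp: x1_def x2_def y1_def y2_def d_def)
  have c: "x1 * s = s * x1" "x2 * s = s * x2" "y1 * s = s * y1" "y2 * s = s * y2"
    by (simp_all add: s_def sc_commute)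
  have ell: "ell i j u = d i j * s + e i j" "ell i j (u - 1) = d i j * (s - 1) + e i j" for i j
    by (simp_all add: ell_def d_def s_def sc_diff sc_one)
  have d: "d i j = 0 \<or> d i j = 1" for i j
    by (simp add: d_def)
  \<comment> \<open>The Kronecker deltas are generalized to variables with values 0 and 1, which
    leaves sixteen polynomial identities.\<close>
  have "(d1 * s + x1) * (d2 * (s - 1) + x2) + (d3 * s + y1) * (d4 * (s - 1) + y2)
    = (d4 * s + y2) * (d3 * (s - 1) + y1) + (d2 * s + x2) * (d1 * (s - 1) + x1)"
    if "d1 = 0 \<or> d1 = 1" "d2 = 0 \<or> d2 = 1" "d3 = 0 \<or> d3 = 1" "d4 = 0 \<or> d4 = 1"
      "x1 * x2 = x2 * x1 + (d4 * y1 - d3 * y2)" "y1 * y2 = y2 * y1 + (d2 * x1 - d1 * x2)"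
    for d1 d2 d3 d4
    using that(1-4) by (elim disjE) (simp_all add: algebra_simps c that(5,6))
  from this[OF d d d d x y] show ?thesis
    unfolding ell by (simp add: x1_def x2_def y1_def y2_def)
qed

text \<open>Expanding two columns gives a double sum over ordered pairs of rows. The sign
  \<open>t\<close> is antisymmetric in the pair. Once both column orders are added, the other
  factors are symmetric by \<open>ell_swap\<close>, so the sum equals its own negative.\<close>

lemma minor_swap_first:
  assumes "finite A" "A \<subseteq> {1..N}" "b \<in> {1..<N}" "b' \<in> {1..<N}"
  shows "minor A (b # b' # bs) u = - minor A (b' # b # bs) u"
proof -
  define t where "t a a' = (if a = a' then 0 else pos_sign a A * pos_sign a' (A - {a}) :: 'r)" for a a'
  define M where "M a a' = minor (A - {a} - {a'}) bs (u - 1 - 1)" for a a'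
  define G where "G a a' = ell a b u * ell a' b' (u - 1) + ell a b' u * ell a' b (u - 1)" for a a'
  have expand2: "minor A (c # c' # bs) u = (\<Sum>a\<in>A. \<Sum>a'\<in>A. t a a' * (ell a c u * ell a' c' (u - 1)) * M a a')"
    for c c'
  proof -
    have "minor A (c # c' # bs) u = (\<Sum>a\<in>A. \<Sum>a'\<in>A - {a}. t a a' * (ell a c u * ell a' c' (u - 1)) * M a a')"
    proof -
      have "pos_sign a A * ell a c u * (pos_sign a' (A - {a}) * ell a' c' (u - 1) * m)
        = pos_sign a A * pos_sign a' (A - {a}) * (ell a c u * ell a' c' (u - 1)) * m" for a a' m
      proof -
        have "pos_sign a A * ell a c u * (pos_sign a' (A - {a}) * ell a' c' (u - 1) * m)
          = pos_sign a A * (ell a c u * pos_sign a' (A - {a})) * (ell a' c' (u - 1) * m)"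
          by (simp only: mult.assoc)
        also have "\<dots> = pos_sign a A * (pos_sign a' (A - {a}) * ell a c u) * (ell a' c' (u - 1) * m)"
          by (subst pos_sign_commute) (rule refl)
        finally show ?thesis by (simp only: mult.assoc)
      qed
      then show ?thesis
        by (auto simp: t_def M_def sum_distrib_left intro!: sum.cong)
    qed
    also have "\<dots> = (\<Sum>a\<in>A. \<Sum>a'\<in>A. t a a' * (ell a c u * ell a' c' (u - 1)) * M a a')"
      by (intro sum.cong refl sum.mono_neutral_left) (use assms(1) in \<open>auto simp: t_def\<close>)
    finally show ?thesis .
  qed
  have t: "t a' a = - t a a'" if "a \<in> A" "a' \<in> A" for a a'
  proof (cases a a' rule: linorder_cases)
    case less
    then show ?thesis using that assms(1)
      by (simp add: t_def pos_sign_Diff_less pos_sign_Diff_ge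
          pos_sign_commute[of "pos_sign a' A" a A])
  next
    case greater
    then show ?thesis using that assms(1)
      by (simp add: t_def pos_sign_Diff_less pos_sign_Diff_ge
          pos_sign_commute[of "pos_sign a' A" a A])
  qed (simp add: t_def)
  have M: "M a' a = M a a'" for a a'
    unfolding M_def by (rule arg_cong[of _ _ "\<lambda>B. minor B bs (u - 1 - 1)"]) auto
  have G: "G a' a = G a a'" if "a \<in> A" "a' \<in> A" for a a'
    unfolding G_def using ell_swap[of a a' b b' u] that assms(2-4) by (auto simp: subset_eq)
  let ?S = "\<Sum>a\<in>A. \<Sum>a'\<in>A. t a a' * G a a' * M a a'"
  have "?S = (\<Sum>a\<in>A. \<Sum>a'\<in>A. t a' a * G a' a * M a' a)"
    by (rule sum.swap)
  also have "\<dots> = (\<Sum>a\<in>A. \<Sum>a'\<in>A. - (t a a' * G a a' * M a a'))"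
  proof (intro sum.cong refl)
    fix a a' assume "a \<in> A" "a' \<in> A"
    from t[OF this] G[OF this] M[of a' a]
    show "t a' a * G a' a * M a' a = - (t a a' * G a a' * M a a')" by simp
  qed
  also have "\<dots> = - ?S" by (simp add: sum_negf)
  finally have "?S + ?S = 0" by (rule iffD1[OF eq_neg_iff_add_eq_0])
  then have "?S = 0" by (rule double_eq_zero)
  moreover have "?S = minor A (b # b' # bs) u + minor A (b' # b # bs) u"
    unfolding expand2 sum.distrib[symmetric]
    by (intro sum.cong refl) (simp add: G_def distrib_left distrib_right)
  ultimately show ?thesis by (simp add: eq_neg_iff_add_eq_0)
qed

lemma minor_swap:
  assumes "finite A" "A \<subseteq> {1..N}" "b \<in> {1..<N}" "b' \<in> {1..<N}"
  shows "minor A (pre @ b # b' # bs) u = - minor A (pre @ b' # b # bs) u"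
  using assms(1,2)
proof (induction pre arbitrary: A u)
  case Nil
  then show ?case using minor_swap_first[OF Nil assms(3,4)] by simp
next
  case (Cons c pre)
  show ?case
    unfolding append_Cons minor.simps sum_negf[symmetric]
  proof (intro sum.cong refl)
    fix a
    have "minor (A - {a}) (pre @ b # b' # bs) (u - 1) = - minor (A - {a}) (pre @ b' # b # bs) (u - 1)"
      by (rule Cons.IH) (use Cons.prems in auto)
    then show "pos_sign a A * ell a c u * minor (A - {a}) (pre @ b # b' # bs) (u - 1)
      = - (pos_sign a A * ell a c u * minor (A - {a}) (pre @ b' # b # bs) (u - 1))"
      by simp
  qed
qed

lemma minor_repeated_column:
  assumes "finite A" "A \<subseteq> {1..N}" "b \<in> {1..<N}" "set mid \<subseteq> {1..<N}"
  shows "minor A (pre @ b # mid @ b # bs) u = 0"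
  using assms(4)
proof (induction mid arbitrary: pre)
  case Nil
  have "minor A (pre @ b # b # bs) u + minor A (pre @ b # b # bs) u = 0"
    using minor_swap[OF assms(1-3,3), of pre bs u] by (simp add: eq_neg_iff_add_eq_0)
  then show ?case by (simp only: append_Nil) (rule double_eq_zero)
next
  case (Cons c mid)
  have "minor A (pre @ b # c # mid @ b # bs) u = - minor A ((pre @ [c]) @ b # mid @ b # bs) u"
    using minor_swap[OF assms(1-3), of c pre "mid @ b # bs" u] Cons.prems by simp
  also have "\<dots> = 0"
    using Cons.IH[of "pre @ [c]"] Cons.prems by simp
  finally show ?case by simp
qed

lemma minor_not_distinct:
  assumes "finite A" "A \<subseteq> {1..N}" "set bs \<subseteq> {1..<N}" "\<not> distinct bs"
  shows "minor A bs u = 0"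
proof -
  obtain pre mid post b where "bs = pre @ [b] @ mid @ [b] @ post"
    using not_distinct_decomp[OF assms(4)] by blast
  then show ?thesis using minor_repeated_column[of A b mid pre post u] assms by simp
qed

end

section \<open>The adjoint action on minors\<close>

definition pos_sign_above :: "nat \<Rightarrow> nat set \<Rightarrow> 'r::ring_1" where
  "pos_sign_above a A = (- 1) ^ card {x \<in> A. a < x}"

lemma pos_sign_above_commute: "x * pos_sign_above a A = (pos_sign_above a A :: 'r::ring_1) * x"
  by (simp add: pos_sign_above_def minus_one_power_iff)

lemma pos_sign_above_Diff:
  assumes "finite A" "x \<in> A"
  shows "pos_sign_above a (A - {x}) =
    (if a < x then - pos_sign_above a A else (pos_sign_above a A :: 'r::ring_1))"
proof (cases "a < x")
  case True
  then have "{y \<in> A. a < y} = insert x {y \<in> A - {x}. a < y}"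
    using assms by auto
  then have "card {y \<in> A. a < y} = Suc (card {y \<in> A - {x}. a < y})"
    using assms by simp
  with True show ?thesis by (simp add: pos_sign_above_def)
next
  case False
  then have "{y \<in> A - {x}. a < y} = {y \<in> A. a < y}" by auto
  with False show ?thesis by (simp add: pos_sign_above_def)
qed

lemma sum_Diff_singleton_swap:
  assumes "finite A"
  shows "(\<Sum>x\<in>A. \<Sum>a\<in>A - {x}. f x a) = (\<Sum>a\<in>A. \<Sum>x\<in>A - {a}. f x a)"
proof -
  have "{a \<in> A. x \<noteq> a} = A - {x}" "{a \<in> A. a \<noteq> x} = A - {x}" for x by auto
  then show ?thesis
    using sum.swap_restrict[OF assms assms, of f "\<lambda>x a. x \<noteq> a"] by simp
qed

lemma pos_sign_exchange:
  assumes "finite A" "x \<in> A" "a \<in> A" "x \<noteq> a"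
  shows "pos_sign x A * pos_sign_above a (A - {x}) =
    pos_sign_above a A * (pos_sign x (A - {a}) :: 'r::ring_1)"
proof -
  have "pos_sign x A * pos_sign_above a A = pos_sign_above a A * (pos_sign x A :: 'r)"
    by (rule pos_sign_above_commute)
  with assms show ?thesis
    by (cases "a < x") (auto simp: pos_sign_above_Diff pos_sign_Diff_less pos_sign_Diff_ge)
qed

text \<open>The sign identity behind \<open>row_act_replace\<close>: it compares removing row
  \<open>a\<close> before and after row \<open>l\<close> is replaced by \<open>k\<close>.\<close>

lemma pos_sign_replace:
  assumes "finite A" "a \<in> A" "l \<in> A" "a \<noteq> l" "k \<notin> A"
  shows "pos_sign a A * (pos_sign k (A - {a} - {l}) * pos_sign l (A - {a})) =
    pos_sign k (A - {l}) * pos_sign l A * (pos_sign a (insert k (A - {l})) :: 'r::ring_1)"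
proof -
  let ?s = "\<lambda>a. pos_sign a A :: 'r" and ?k = "pos_sign k (A - {l}) :: 'r"
  have k: "pos_sign k (A - {a} - {l}) = (if a < k then - ?k else ?k)"
    using pos_sign_Diff_less[of "A - {l}" a k, where 'r = 'r] pos_sign_Diff_ge[of a k "A - {l}", where 'a = 'r] assms
    by (simp add: Diff_insert2[symmetric] insert_commute[of a l])
  have l: "pos_sign l (A - {a}) = (if a < l then - ?s l else ?s l)"
    using assms by (simp add: pos_sign_Diff_less pos_sign_Diff_ge)
  have a: "pos_sign a (A - {l}) = (if l < a then - ?s a else ?s a)"
    using assms by (simp add: pos_sign_Diff_less pos_sign_Diff_ge)
  have ak: "pos_sign a (insert k (A - {l})) = (if k < a then - pos_sign a (A - {l}) else (pos_sign a (A - {l}) :: 'r))"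
    using assms by (simp add: pos_sign_insert_less pos_sign_insert_ge)
  have c: "?s a * (?k * ?s l) = ?k * ?s l * ?s a"
    by (rule pos_sign_commute[symmetric])
  have "a \<noteq> k" using assms by auto
  then show ?thesis
    unfolding k l a ak using c assms(4) by (cases "a < k"; cases "a < l") auto
qed

context gl_relations
begin

text \<open>Rows for the first and for the last column can be chosen in either order, so this
  follows by induction from the expansion in the first column. The entry of the last column stays
  rightmost.\<close>

lemma minor_last_column:
  assumes "finite A"
  shows "minor A (bs @ [b]) u = (\<Sum>a\<in>A. pos_sign_above a A * minor (A - {a}) bs u *
    ell a b (u - of_nat (length bs)))"
  using assms
proof (induction bs arbitrary: A u)
  case Nil
  have "pos_sign a A = (1 :: 'r)" "pos_sign_above a A = (1 :: 'r)" if "A - {a} = {}" for a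
  proof -
    from that have "{x \<in> A. x < a} = {}" "{x \<in> A. a < x} = {}" by auto
    then show "pos_sign a A = (1 :: 'r)" "pos_sign_above a A = (1 :: 'r)"
      unfolding pos_sign_def pos_sign_above_def by (simp_all only: card.empty power_0)
  qed
  then show ?case by (auto intro!: sum.cong)
next
  case (Cons c bs)
  let ?v = "u - of_nat (length (c # bs))"
  have "minor A ((c # bs) @ [b]) u = (\<Sum>x\<in>A. \<Sum>a\<in>A - {x}. pos_sign x A * ell x c u *
     (pos_sign_above a (A - {x}) * minor (A - {x} - {a}) bs (u - 1) * ell a b ?v))"
    using Cons by (simp add: sum_distrib_left algebra_simps)
  also have "\<dots> = (\<Sum>x\<in>A. \<Sum>a\<in>A - {x}. pos_sign_above a A * (pos_sign x (A - {a}) * ell x c u *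
      minor (A - {a} - {x}) bs (u - 1)) * ell a b ?v)"
  proof (intro sum.cong refl)
    fix x a assume xa: "x \<in> A" "a \<in> A - {x}"
    have "A - {x} - {a} = A - {a} - {x}" by auto
    moreover have "pos_sign x A * ell x c u * (pos_sign_above a (A - {x}) * y)
        = pos_sign_above a A * (pos_sign x (A - {a}) * ell x c u * y)" for y
    proof -
      have "pos_sign x A * ell x c u * (pos_sign_above a (A - {x}) * y)
        = pos_sign x A * (ell x c u * pos_sign_above a (A - {x})) * y" by (simp only: mult.assoc)
      also have "\<dots> = (pos_sign x A * pos_sign_above a (A - {x})) * ell x c u * y"
        by (simp only: pos_sign_above_commute[of "ell x c u"] mult.assoc)
      also have "\<dots> = (pos_sign_above a A * pos_sign x (A - {a})) * ell x c u * y"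
        using pos_sign_exchange[of A x a, where 'r = 'r] xa Cons.prems by auto
      finally show ?thesis by (simp only: mult.assoc)
    qed
    ultimately show "pos_sign x A * ell x c u *
       (pos_sign_above a (A - {x}) * minor (A - {x} - {a}) bs (u - 1) * ell a b ?v)
      = pos_sign_above a A * (pos_sign x (A - {a}) * ell x c u *
      minor (A - {a} - {x}) bs (u - 1)) * ell a b ?v"
      by (simp add: mult.assoc)
  qed
  also have "\<dots> = (\<Sum>a\<in>A. \<Sum>x\<in>A - {a}. pos_sign_above a A * (pos_sign x (A - {a}) * ell x c u *
      minor (A - {a} - {x}) bs (u - 1)) * ell a b ?v)"
    by (rule sum_Diff_singleton_swap[OF Cons.prems])
  finally show ?case
    by (simp add: sum_distrib_left sum_distrib_right)
qed

text \<open>The two halves, acting on row and column indices, of the derivation \<open>[e k l, _]\<close>.\<close>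

fun row_act :: "nat \<Rightarrow> nat \<Rightarrow> nat set \<Rightarrow> nat list \<Rightarrow> 'k \<Rightarrow> 'r" where
  "row_act k l A [] u = 0"
| "row_act k l A (b # bs) u =
     (if l \<in> A then pos_sign l A * ell k b u * minor (A - {l}) bs (u - 1) else 0) +
     (\<Sum>a\<in>A. pos_sign a A * ell a b u * row_act k l (A - {a}) bs (u - 1))"

fun col_act :: "nat \<Rightarrow> nat \<Rightarrow> nat set \<Rightarrow> nat list \<Rightarrow> 'k \<Rightarrow> 'r" where
  "col_act k l A [] u = 0"
| "col_act k l A (b # bs) u = (if b = k then minor A (l # bs) u else 0) +
     (\<Sum>a\<in>A. pos_sign a A * ell a b u * col_act k l (A - {a}) bs (u - 1))"

text \<open>The scalar parts of \<open>ell\<close> on the right appear only when both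
  \<open>a = l\<close> and \<open>b = k\<close>, and then they cancel.\<close>

lemma e_ell_commute:
  assumes "k \<in> {1..N}" "l \<in> {1..<N}" "a \<in> {1..N}" "b \<in> {1..<N}"
  shows "e k l * ell a b u = ell a b u * e k l +
    ((if a = l then ell k b u else 0) - (if b = k then ell a l u else 0))"
  using e_commute[OF assms] by (auto simp: ell_def algebra_simps sc_commute[of "e i j" for i j])

lemma e_minor_commute:
  assumes "k \<in> {1..N}" "l \<in> {1..<N}" "finite A" "A \<subseteq> {1..N}" "set bs \<subseteq> {1..<N}"
  shows "e k l * minor A bs u = minor A bs u * e k l + (row_act k l A bs u - col_act k l A bs u)"
  using assms(3-5)
proof (induction bs arbitrary: A u)
  case Nil
  then show ?case by simp
next
  case (Cons b bs)
  define d where "d a = (if a = l then ell k b u else 0) - (if b = k then ell a l u else 0)" for a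
  have "e k l * (pos_sign a A * ell a b u * minor (A - {a}) bs (u - 1))
     = pos_sign a A * ell a b u * minor (A - {a}) bs (u - 1) * e k l
       + (pos_sign a A * d a * minor (A - {a}) bs (u - 1)
       + (pos_sign a A * ell a b u * row_act k l (A - {a}) bs (u - 1)
       - pos_sign a A * ell a b u * col_act k l (A - {a}) bs (u - 1)))" if "a \<in> A" for a
  proof -
    have IH: "e k l * minor (A - {a}) bs (u - 1) = minor (A - {a}) bs (u - 1) * e k l +
      (row_act k l (A - {a}) bs (u - 1) - col_act k l (A - {a}) bs (u - 1))"
      by (rule Cons.IH) (use Cons.prems in auto)
    have ell: "e k l * ell a b u = ell a b u * e k l + d a"
      unfolding d_def by (rule e_ell_commute) (use assms Cons.prems that in auto)
    have "e k l * (pos_sign a A * ell a b u * minor (A - {a}) bs (u - 1))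
       = pos_sign a A * (e k l * ell a b u) * minor (A - {a}) bs (u - 1)"
      by (simp only: mult.assoc[symmetric] pos_sign_commute[of "e k l"])
    also have "\<dots> = pos_sign a A * ell a b u * (e k l * minor (A - {a}) bs (u - 1))
        + pos_sign a A * d a * minor (A - {a}) bs (u - 1)"
      unfolding ell by (simp add: algebra_simps)
    finally show ?thesis unfolding IH by (simp add: algebra_simps)
  qed
  then have "e k l * minor A (b # bs) u = (\<Sum>a\<in>A. pos_sign a A * ell a b u * minor (A - {a}) bs (u - 1)) * e k l
     + ((\<Sum>a\<in>A. pos_sign a A * d a * minor (A - {a}) bs (u - 1))
       + ((\<Sum>a\<in>A. pos_sign a A * ell a b u * row_act k l (A - {a}) bs (u - 1))
       - (\<Sum>a\<in>A. pos_sign a A * ell a b u * col_act k l (A - {a}) bs (u - 1))))"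
    by (simp add: sum_distrib_left sum_distrib_right sum.distrib sum_subtractf)
  moreover have "(\<Sum>a\<in>A. pos_sign a A * d a * minor (A - {a}) bs (u - 1))
     = (if l \<in> A then pos_sign l A * ell k b u * minor (A - {l}) bs (u - 1) else 0)
      - (if b = k then minor A (l # bs) u else 0)"
  proof -
    have "(\<Sum>a\<in>A. pos_sign a A * d a * minor (A - {a}) bs (u - 1))
      = (\<Sum>a\<in>A. if a = l then pos_sign l A * ell k b u * minor (A - {l}) bs (u - 1) else 0)
      - (\<Sum>a\<in>A. if b = k then pos_sign a A * ell a l u * minor (A - {a}) bs (u - 1) else 0)"
      unfolding sum_subtractf[symmetric]
      by (intro sum.cong refl) (auto simp: d_def algebra_simps)
    then show ?thesis using Cons.prems(1) by simp
  qed
  ultimately show ?case by simp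
qed

lemma row_act_not_mem: "l \<notin> A \<Longrightarrow> row_act k l A bs u = 0"
  by (induction bs arbitrary: A u) auto

lemma row_act_same:
  "finite A \<Longrightarrow> l \<in> A \<Longrightarrow> row_act l l A bs u = minor A bs u"
proof (induction bs arbitrary: A u)
  case (Cons b bs)
  have "(\<Sum>a\<in>A. pos_sign a A * ell a b u * row_act l l (A - {a}) bs (u - 1))
      = (\<Sum>a\<in>A - {l}. pos_sign a A * ell a b u * minor (A - {a}) bs (u - 1))"
    using Cons by (subst sum.remove[of _ l]) (auto simp: row_act_not_mem intro!: sum.cong)
  then show ?case
    using Cons.prems by (simp add: sum.remove[of A l])
qed auto

text \<open>The two signs account for moving the new row \<open>k\<close> from the place of
  \<open>l\<close> to its own place in the increasing order.\<close>

lemma row_act_replace: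
  assumes "finite A" "l \<in> A" "k \<notin> A"
  shows "row_act k l A bs u = pos_sign k (A - {l}) * pos_sign l A * minor (insert k (A - {l})) bs u"
  using assms
proof (induction bs arbitrary: A u)
  case (Cons b bs)
  let ?B = "insert k (A - {l})" and ?s = "pos_sign k (A - {l}) * pos_sign l A :: 'r"
  have "(\<Sum>a\<in>A. pos_sign a A * ell a b u * row_act k l (A - {a}) bs (u - 1))
      = (\<Sum>a\<in>A - {l}. pos_sign a A * ell a b u * row_act k l (A - {a}) bs (u - 1))"
    using Cons by (subst sum.remove[of _ l]) (auto simp: row_act_not_mem)
  also have "\<dots> = (\<Sum>a\<in>A - {l}. ?s * (pos_sign a ?B * ell a b u * minor (?B - {a}) bs (u - 1)))"
  proof (rule sum.cong[OF refl])
    fix a assume a: "a \<in> A - {l}"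
    have "row_act k l (A - {a}) bs (u - 1) =
       pos_sign k (A - {a} - {l}) * pos_sign l (A - {a}) * minor (insert k (A - {a} - {l})) bs (u - 1)"
      by (rule Cons.IH) (use Cons.prems a in auto)
    moreover have "insert k (A - {a} - {l}) = ?B - {a}" using a Cons.prems by auto
    ultimately have "pos_sign a A * ell a b u * row_act k l (A - {a}) bs (u - 1)
      = pos_sign a A * (ell a b u * (pos_sign k (A - {a} - {l}) * pos_sign l (A - {a}))) * minor (?B - {a}) bs (u - 1)"
      by (simp add: mult.assoc)
    also have "ell a b u * (pos_sign k (A - {a} - {l}) * pos_sign l (A - {a}))
       = (pos_sign k (A - {a} - {l}) * pos_sign l (A - {a})) * ell a b u"
      by (simp only: mult.assoc[symmetric] pos_sign_commute[of "ell a b u"])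
        (simp only: mult.assoc pos_sign_commute[of "ell a b u"])
    also have "pos_sign a A * ((pos_sign k (A - {a} - {l}) * pos_sign l (A - {a})) * ell a b u)
        = (pos_sign a A * (pos_sign k (A - {a} - {l}) * pos_sign l (A - {a}))) * ell a b u"
      by (simp only: mult.assoc)
    also have "pos_sign a A * (pos_sign k (A - {a} - {l}) * pos_sign l (A - {a})) = ?s * pos_sign a ?B"
      by (rule pos_sign_replace) (use Cons.prems a in auto)
    finally show "pos_sign a A * ell a b u * row_act k l (A - {a}) bs (u - 1)
       = ?s * (pos_sign a ?B * ell a b u * minor (?B - {a}) bs (u - 1))"
      by (simp only: mult.assoc)
  qed
  finally have 1: "(\<Sum>a\<in>A. pos_sign a A * ell a b u * row_act k l (A - {a}) bs (u - 1))
    = ?s * (\<Sum>a\<in>A - {l}. pos_sign a ?B * ell a b u * minor (?B - {a}) bs (u - 1))"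
    by (simp only: sum_distrib_left)
  have "pos_sign k ?B = (pos_sign k (A - {l}) :: 'r)" "?B - {k} = A - {l}"
    using Cons.prems by (auto simp: pos_sign_insert_ge)
  then have "?s * (pos_sign k ?B * ell k b u * minor (?B - {k}) bs (u - 1))
    = pos_sign k (A - {l}) * (pos_sign l A * pos_sign k (A - {l})) * ell k b u * minor (A - {l}) bs (u - 1)"
    by (simp only: mult.assoc)
  also have "pos_sign l A * pos_sign k (A - {l}) = pos_sign k (A - {l}) * (pos_sign l A :: 'r)"
    by (rule pos_sign_commute)
  finally have 2: "?s * (pos_sign k ?B * ell k b u * minor (?B - {k}) bs (u - 1))
    = pos_sign l A * ell k b u * minor (A - {l}) bs (u - 1)"
    by (simp only: mult.assoc pos_sign_square)
  have "minor ?B (b # bs) u = pos_sign k ?B * ell k b u * minor (?B - {k}) bs (u - 1)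
    + (\<Sum>a\<in>A - {l}. pos_sign a ?B * ell a b u * minor (?B - {a}) bs (u - 1))"
    unfolding minor.simps by (subst sum.insert) (use Cons.prems in auto)
  then have "?s * minor ?B (b # bs) u = pos_sign l A * ell k b u * minor (A - {l}) bs (u - 1)
    + ?s * (\<Sum>a\<in>A - {l}. pos_sign a ?B * ell a b u * minor (?B - {a}) bs (u - 1))"
    by (simp only: distrib_left 2)
  then show ?case
    unfolding row_act.simps 1 using Cons.prems(2) by simp
qed auto

text \<open>A minor with two equal rows, which cannot be written down as such because rows form a
  set. It vanishes because two terms survive, in which one or the other copy of row \<open>k\<close>
  takes the first column, and they have opposite signs.\<close>

lemma row_act_mem:
  assumes "finite A" "l \<in> A" "k \<in> A" "k \<noteq> l"
  shows "row_act k l A bs u = 0"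
  using assms
proof (induction bs arbitrary: A u)
  case (Cons b bs)
  let ?f = "\<lambda>a. pos_sign a A * ell a b u * row_act k l (A - {a}) bs (u - 1)"
  have "sum ?f A = sum ?f {k}"
  proof (intro sum.mono_neutral_right ballI)
    fix a assume "a \<in> A - {k}"
    then show "?f a = 0"
      using Cons by (cases "a = l") (simp_all add: row_act_not_mem)
  qed (use Cons.prems in auto)
  also have "\<dots> = pos_sign k A * (ell k b u * (pos_sign k (A - {k} - {l}) * pos_sign l (A - {k}))) *
      minor (A - {l}) bs (u - 1)"
  proof -
    have "insert k (A - {k} - {l}) = A - {l}" using Cons.prems by auto
    moreover have "row_act k l (A - {k}) bs (u - 1) =
        pos_sign k (A - {k} - {l}) * pos_sign l (A - {k}) * minor (insert k (A - {k} - {l})) bs (u - 1)"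
      by (rule row_act_replace) (use Cons.prems in auto)
    ultimately show ?thesis by (simp add: mult.assoc)
  qed
  also have "\<dots> = - (pos_sign l A * ell k b u * minor (A - {l}) bs (u - 1))"
  proof -
    have k: "pos_sign k (A - {k} - {l}) = (if l < k then - pos_sign k A else (pos_sign k A :: 'r))"
      using Cons.prems by (simp add: pos_sign_Diff_less pos_sign_Diff_ge)
    have l: "pos_sign l (A - {k}) = (if k < l then - pos_sign l A else (pos_sign l A :: 'r))"
      using Cons.prems by (simp add: pos_sign_Diff_less pos_sign_Diff_ge)
    have "pos_sign k A * (ell k b u * (pos_sign k A * pos_sign l A)) = pos_sign l A * ell k b u"
    proof -
      have "ell k b u * (pos_sign k A * pos_sign l A) = pos_sign k A * pos_sign l A * ell k b u"
        by (metis mult.assoc pos_sign_commute)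
      then show ?thesis by (simp only: mult.assoc pos_sign_square)
    qed
    then show ?thesis
      unfolding k l using Cons.prems(4) by (cases "k < l") auto
  qed
  finally show ?case using Cons.prems by simp
qed auto

lemma col_act_not_mem: "k \<notin> set bs \<Longrightarrow> col_act k l A bs u = 0"
  by (induction bs arbitrary: A u) auto

lemma col_act_replace:
  "k \<notin> set pre \<Longrightarrow> k \<notin> set post \<Longrightarrow>
    col_act k l A (pre @ k # post) u = minor A (pre @ l # post) u"
  by (induction pre arbitrary: A u) (auto simp: col_act_not_mem)

end

lemma minus_one_power_square: "(- 1) ^ n * (- 1) ^ n = (1 :: 'r::ring_1)"
  by (simp add: minus_one_power_iff)

lemma pos_sign_least: "(\<And>x. x \<in> A \<Longrightarrow> a \<le> x) \<Longrightarrow> pos_sign a A = 1"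
proof -
  assume "\<And>x. x \<in> A \<Longrightarrow> a \<le> x"
  then have "{x \<in> A. x < a} = {}" by force
  then show ?thesis unfolding pos_sign_def by (simp only: card.empty power_0)
qed

lemma pos_sign_singleton: "pos_sign a {a} = 1"
  by (rule pos_sign_least) simp

lemma pos_sign_above_greatest: "(\<And>x. x \<in> A \<Longrightarrow> x \<le> a) \<Longrightarrow> pos_sign_above a A = 1"
proof -
  assume "\<And>x. x \<in> A \<Longrightarrow> x \<le> a"
  then have "{x \<in> A. a < x} = {}" by force
  then show ?thesis unfolding pos_sign_above_def by (simp only: card.empty power_0)
qed

section \<open>Principal minors and the replacement of a row\<close>

context gl_relations
begin

definition pminor :: "nat \<Rightarrow> nat \<Rightarrow> 'k \<Rightarrow> 'r" where
  "pminor p m u = minor {p..m} [p..<Suc m] u"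

lemma pminor_empty: "m < p \<Longrightarrow> pminor p m u = 1"
  by (simp add: pminor_def)

lemma minor_commute:
  assumes "\<And>i j. i \<in> A \<Longrightarrow> j \<in> set bs \<Longrightarrow> x * e i j = e i j * x"
  shows "x * minor A bs u = minor A bs u * x"
  using assms
proof (induction bs arbitrary: A u)
  case (Cons b bs)
  have "x * (pos_sign a A * ell a b u * minor (A - {a}) bs (u - 1))
      = pos_sign a A * ell a b u * minor (A - {a}) bs (u - 1) * x" if "a \<in> A" for a
  proof -
    have 1: "x * minor (A - {a}) bs (u - 1) = minor (A - {a}) bs (u - 1) * x"
      by (rule Cons.IH) (use Cons.prems in auto)
    have 2: "x * ell a b u = ell a b u * x"
      using Cons.prems[of a b] that by (simp add: ell_def algebra_simps sc_commute[of x])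
    have "x * (pos_sign a A * ell a b u * minor (A - {a}) bs (u - 1))
       = pos_sign a A * (x * ell a b u) * minor (A - {a}) bs (u - 1)"
      by (simp only: mult.assoc[symmetric] pos_sign_commute[of x])
    then show ?thesis by (simp only: 2 mult.assoc 1)
  qed
  then show ?case by (simp add: sum_distrib_left sum_distrib_right)
qed simp

text \<open>For \<open>k = l\<close> the row and the column half of the derivation both return the
  minor. Otherwise they repeat a row and a column respectively, and both vanish.\<close>

lemma e_pminor_commute:
  assumes "1 \<le> p" "m < N" "k \<in> {p..m}" "l \<in> {p..m}"
  shows "e k l * pminor p m u = pminor p m u * e k l"
proof -
  have split: "[p..<Suc m] = [p..<k] @ k # [Suc k..<Suc m]"
    using assms upt_add_eq_append[of p k "Suc m - k"] by (simp add: upt_conv_Cons del: upt_Suc)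
  have "row_act k l {p..m} [p..<Suc m] u = col_act k l {p..m} [p..<Suc m] u"
  proof (cases "k = l")
    case True
    then show ?thesis
      using col_act_replace[of k "[p..<k]" "[Suc k..<Suc m]" l "{p..m}" u] assms split
      by (simp add: row_act_same)
  next
    case False
    have "l \<in> set ([p..<k] @ [Suc k..<Suc m])" using False assms by auto
    then have "\<not> distinct ([p..<k] @ l # [Suc k..<Suc m])" by auto
    then have "minor {p..m} ([p..<k] @ l # [Suc k..<Suc m]) u = 0"
      using assms by (intro minor_not_distinct) auto
    then show ?thesis
      using col_act_replace[of k "[p..<k]" "[Suc k..<Suc m]" l "{p..m}" u] assms split False
      by (simp add: row_act_mem)
  qed
  then show ?thesis
    unfolding pminor_def
    using e_minor_commute[of k l "{p..m}" "[p..<Suc m]" u] assms by (auto simp del: upt_Suc)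
qed

lemma e_pminor_commute_disjoint:
  assumes "1 \<le> p" "m < N" "k \<in> {1..N}" "l \<in> {1..<N}" "k \<notin> {p..m}" "l \<notin> {p..m}"
  shows "e k l * pminor p m u = pminor p m u * e k l"
  unfolding pminor_def
  using e_minor_commute[of k l "{p..m}" "[p..<Suc m]" u] assms
  by (auto simp: row_act_not_mem col_act_not_mem simp del: upt_Suc)

lemma pminor_pminor_commute:
  assumes "1 \<le> p" "m < N" "p \<le> p'"
  shows "pminor p m u * pminor p' m v = pminor p' m v * pminor p m u"
  unfolding pminor_def[of p']
  by (rule minor_commute) (use assms in \<open>auto intro!: e_pminor_commute[symmetric] simp del: upt_Suc\<close>)

text \<open>By \<open>row_minor_eq\<close> this commutator is, for \<open>a\<close> below the block,
  up to sign the minor with row \<open>b\<close> replaced by row \<open>a\<close>.\<close>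

definition row_minor :: "nat \<Rightarrow> nat \<Rightarrow> nat \<Rightarrow> nat \<Rightarrow> 'k \<Rightarrow> 'r" where
  "row_minor p m a b u = e a b * pminor p m u - pminor p m u * e a b"

lemma row_minor_eq:
  assumes "1 \<le> p" "p \<le> b" "b \<le> m" "m < a" "a \<le> N"
  shows "row_minor p m a b u =
    (- 1) ^ (m - b) * minor (insert a ({p..m} - {b})) [p..<Suc m] u"
proof -
  have "{x \<in> {p..m} - {b}. x < a} = {p..m} - {b}" "{x \<in> {p..m}. x < b} = {p..<b}"
    using assms by auto
  then have s: "pos_sign a ({p..m} - {b}) = ((-1) ^ (m - p) :: 'r)"
     "pos_sign b {p..m} = ((-1) ^ (b - p) :: 'r)"
    using assms by (simp_all add: pos_sign_def)
  have "(-1) ^ (m - p) = ((-1) ^ (m - b) * (-1) ^ (b - p) :: 'r)"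
    using assms by (simp add: power_add[symmetric])
  then have s': "(-1) ^ (m - p) * (-1) ^ (b - p) = ((-1) ^ (m - b) :: 'r)"
    by (simp add: mult.assoc minus_one_power_square)
  show ?thesis
    unfolding row_minor_def pminor_def
    using e_minor_commute[of a b "{p..m}" "[p..<Suc m]" u] assms
    by (simp add: row_act_replace col_act_not_mem s s' del: upt_Suc)
qed

text \<open>A quantum form of Cramer's rule. The minor with rows \<open>p..m\<close> and
  \<open>a\<close> whose columns \<open>p..m\<close> are followed by a second copy of
  \<open>c\<close> is zero; it is expanded along that last column, and row \<open>a\<close>
  contributes the right-hand side.\<close>

lemma row_minor_ell_sum:
  assumes "1 \<le> p" "p \<le> c" "c \<le> m" "m < a" "a \<le> N"
  shows "(\<Sum>b\<in>{p..m}. row_minor p m a b u * ell b c (u - of_nat (Suc m - p))) = pminor p m u * e a c"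
proof -
  let ?A = "insert a {p..m}" and ?bs = "[p..<Suc m]" and ?v = "u - of_nat (Suc m - p)"
  have "minor ?A (?bs @ [c]) u = 0"
    by (rule minor_not_distinct) (use assms in auto)
  then have "0 = (\<Sum>x\<in>?A. pos_sign_above x ?A * minor (?A - {x}) ?bs u * ell x c ?v)"
    using minor_last_column[of ?A ?bs c u] by (simp del: upt_Suc)
  also have "\<dots> = pos_sign_above a ?A * minor (?A - {a}) ?bs u * ell a c ?v +
     (\<Sum>b\<in>{p..m}. pos_sign_above b ?A * minor (?A - {b}) ?bs u * ell b c ?v)"
    using assms by (subst sum.insert) auto
  also have "pos_sign_above a ?A * minor (?A - {a}) ?bs u * ell a c ?v = pminor p m u * e a c"
  proof -
    have "pos_sign_above a ?A = (1 :: 'r)" "?A - {a} = {p..m}"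
      using assms by (auto intro!: pos_sign_above_greatest)
    then show ?thesis using assms by (simp add: ell_def pminor_def del: upt_Suc)
  qed
  also have "(\<Sum>b\<in>{p..m}. pos_sign_above b ?A * minor (?A - {b}) ?bs u * ell b c ?v)
     = - (\<Sum>b\<in>{p..m}. row_minor p m a b u * ell b c ?v)"
    unfolding sum_negf[symmetric]
  proof (rule sum.cong[OF refl])
    fix b assume b: "b \<in> {p..m}"
    have "{x \<in> ?A. b < x} = insert a {b<..m}" "?A - {b} = insert a ({p..m} - {b})"
      using b assms by auto
    then show "pos_sign_above b ?A * minor (?A - {b}) ?bs u * ell b c ?v = - (row_minor p m a b u * ell b c ?v)"
      using b assms by (simp add: row_minor_eq pos_sign_above_def del: upt_Suc)
  qed
  finally show ?thesis by (simp add: algebra_simps)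
qed

definition eshift :: "nat \<Rightarrow> nat \<Rightarrow> 'r" where
  "eshift a b = e a b - (if a = Suc b then 1 else 0)"

end

section \<open>Whittaker vectors and minors\<close>

locale gl_module = gl_relations sc e N
  for sc :: "'k::field_char_0 \<Rightarrow> 'r::ring_1" and e N +
  fixes ac :: "'w::ab_group_add \<Rightarrow> 'r \<Rightarrow> 'w" (infixl "\<rhd>" 75)
  assumes ac_add_left: "(v + w) \<rhd> x = v \<rhd> x + w \<rhd> x"
    and ac_add: "v \<rhd> (x + y) = v \<rhd> x + v \<rhd> y"
    and ac_mult: "v \<rhd> (x * y) = v \<rhd> x \<rhd> y"
    and ac_one: "v \<rhd> 1 = v"
begin

lemma ac_zero: "v \<rhd> 0 = 0" "0 \<rhd> x = 0"
  using ac_add[of v 0 0] ac_add_left[of 0 0 x] by simp_all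

lemma ac_minus: "v \<rhd> (- x) = - (v \<rhd> x)" "(- v) \<rhd> x = - (v \<rhd> x)"
  using ac_add[of v x "- x"] ac_add_left[of v "- v" x]
  by (simp_all add: ac_zero eq_neg_iff_add_eq_0 add.commute)

lemma ac_diff: "v \<rhd> (x - y) = v \<rhd> x - v \<rhd> y" "(v - w) \<rhd> x = v \<rhd> x - w \<rhd> x"
  using ac_add[of v x "- y"] ac_add_left[of v "- w" x] by (simp_all add: ac_minus)

lemma ac_sum: "v \<rhd> sum f S = (\<Sum>i\<in>S. v \<rhd> f i)"
  by (induction S rule: infinite_finite_induct) (simp_all add: ac_zero ac_add)

lemma sum_ac: "sum f S \<rhd> x = (\<Sum>i\<in>S. f i \<rhd> x)"
  by (induction S rule: infinite_finite_induct) (simp_all add: ac_zero ac_add_left)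

lemma ac_sc_right: "v \<rhd> sc c \<rhd> x = v \<rhd> x \<rhd> sc c"
  by (simp only: ac_mult[symmetric] sc_commute)

lemmas ac_linear = ac_add_left ac_add ac_one ac_zero ac_minus ac_diff ac_sum sum_ac

definition whit :: "nat \<Rightarrow> nat \<Rightarrow> 'w \<Rightarrow> bool" where
  "whit p m v \<longleftrightarrow> (\<forall>a b. p \<le> b \<and> b < a \<and> a \<le> m \<longrightarrow> v \<rhd> eshift a b = 0)"

lemma whit_e:
  assumes "whit p m v" "p \<le> b" "b < a" "a \<le> m"
  shows "v \<rhd> e a b = (if a = Suc b then v else 0)"
  using assms by (auto simp: whit_def eshift_def ac_linear split: if_splits)

lemma whit_mono: "whit p m v \<Longrightarrow> p \<le> p' \<Longrightarrow> m' \<le> m \<Longrightarrow> whit p' m' v"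
  by (auto simp: whit_def)

text \<open>The leftmost factor of a minor acts first. On a Whittaker vector the entries of column
  \<open>j\<close> in the rows \<open>Suc j..m\<close> act by 0, except that row
  \<open>Suc j\<close> acts by 1. So only the rows \<open>x\<close> and \<open>Suc j\<close>
  survive, and choosing \<open>Suc j\<close> leaves a minor of the same shape, with \<open>x\<close>
  still on top and one column fewer.\<close>

lemma whit_minor_top_row:
  assumes "whit j m y" "x \<le> j" "j \<le> m"
  shows "y \<rhd> minor (insert x {Suc j..m}) [j..<Suc m] u =
    (\<Sum>c\<in>{j..m}. y \<rhd> ((- 1) ^ (c - j) * ell x c (u - of_nat (c - j)) *
      pminor (Suc c) m (u - of_nat (c - j) - 1)))"
  using assms(3,1,2)
proof (induction j arbitrary: u rule: inc_induct)
  case base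
  then show ?case
    by (simp add: pminor_empty pos_sign_singleton)
next
  case (step j)
  let ?A = "insert x {Suc j..m}" and ?bs = "[Suc j..<Suc m]"
  let ?f = "\<lambda>a. y \<rhd> (pos_sign a ?A * ell a j u * minor (?A - {a}) ?bs (u - 1))"
  have "pos_sign x ?A = (1 :: 'r)" "?A - {x} = {Suc j..m}"
    using step by (auto intro!: pos_sign_least)
  then have fx: "?f x = y \<rhd> (ell x j u * pminor (Suc j) m (u - 1))"
    by (simp add: pminor_def del: upt_Suc)
  have "{z \<in> ?A. z < Suc j} = {x}" "?A - {Suc j} = insert x {Suc (Suc j)..m}"
    using step by auto
  moreover have "y \<rhd> ell (Suc j) j u = y"
    using whit_e[of j m y j "Suc j"] step by (simp add: ell_def)
  ultimately have fj: "?f (Suc j) = - (y \<rhd> minor (insert x {Suc (Suc j)..m}) ?bs (u - 1))"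
    by (simp add: pos_sign_def ac_mult ac_minus del: upt_Suc)
  have f0: "?f a = 0" if "a \<in> ?A - {x, Suc j}" for a
  proof -
    have a: "j < a" "a \<noteq> Suc j" "a \<le> m" using that by auto
    have "y \<rhd> ell a j u = 0"
      using whit_e[of j m y j a] a step by (simp add: ell_def)
    moreover have "?f a = y \<rhd> ell a j u \<rhd> pos_sign a ?A \<rhd> minor (?A - {a}) ?bs (u - 1)"
      by (simp only: ac_mult[symmetric] pos_sign_commute[of "ell a j u"])
    ultimately show ?thesis by (simp only: ac_zero)
  qed
  have "y \<rhd> minor ?A [j..<Suc m] u = (\<Sum>a\<in>?A. ?f a)"
    using step.hyps by (simp only: upt_conv_Cons[of j "Suc m"] less_Suc_eq_le minor.simps ac_sum less_imp_le)
  also have "\<dots> = (\<Sum>a\<in>{x, Suc j}. ?f a)"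
    by (intro sum.mono_neutral_right) (use step f0 in auto)
  also have "\<dots> = ?f x + ?f (Suc j)"
    using step by simp
  also have "\<dots> = y \<rhd> (ell x j u * pminor (Suc j) m (u - 1)) -
     (\<Sum>c\<in>{Suc j..m}. y \<rhd> ((- 1) ^ (c - Suc j) * ell x c (u - 1 - of_nat (c - Suc j)) *
      pminor (Suc c) m (u - 1 - of_nat (c - Suc j) - 1)))"
    unfolding fx fj using step.IH[of "u - 1"] step.prems step.hyps whit_mono[of j m y "Suc j" m] by simp
  also have "\<dots> = y \<rhd> (ell x j u * pminor (Suc j) m (u - 1)) +
     (\<Sum>c\<in>{Suc j..m}. y \<rhd> ((- 1) ^ (c - j) * ell x c (u - of_nat (c - j)) *
      pminor (Suc c) m (u - of_nat (c - j) - 1)))"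
  proof -
    have "y \<rhd> ((- 1) ^ (c - j) * ell x c (u - of_nat (c - j)) * pminor (Suc c) m (u - of_nat (c - j) - 1))
      = - (y \<rhd> ((- 1) ^ (c - Suc j) * ell x c (u - 1 - of_nat (c - Suc j)) *
      pminor (Suc c) m (u - 1 - of_nat (c - Suc j) - 1)))" if "c \<in> {Suc j..m}" for c
    proof -
      have "c - j = Suc (c - Suc j)" using that by auto
      then show ?thesis by (simp add: ac_minus algebra_simps)
    qed
    then show ?thesis by (simp add: sum_negf[symmetric])
  qed
  also have "\<dots> = (\<Sum>c\<in>{j..m}. y \<rhd> ((- 1) ^ (c - j) * ell x c (u - of_nat (c - j)) *
      pminor (Suc c) m (u - of_nat (c - j) - 1)))"
    using step.hyps by (simp add: sum.atLeast_Suc_atMost[of j m])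
  finally show ?case .
qed

lemma whit_pminor:
  assumes "whit j m y" "j \<le> m"
  shows "y \<rhd> pminor j m u = (\<Sum>c\<in>{j..m}. y \<rhd> ((- 1) ^ (c - j) * ell j c (u - of_nat (c - j)) *
      pminor (Suc c) m (u - of_nat (c - j) - 1)))"
proof -
  have "insert j {Suc j..m} = {j..m}" using assms by auto
  then show ?thesis
    using whit_minor_top_row[OF assms(1) order.refl assms(2), of u] by (simp add: pminor_def del: upt_Suc)
qed

text \<open>The same Hessenberg expansion with the extra row below the block. Now the extra row
  carries the sign when it is chosen, and row \<open>Suc j\<close> is the least one and carries
  none.\<close>

lemma whit_minor_bottom_row:
  assumes "whit j m v" "m < a" "j \<le> m"
  shows "v \<rhd> minor (insert a {Suc j..m}) [j..<Suc m] u =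
    (\<Sum>c\<in>{j..m}. v \<rhd> ((- 1) ^ (m - c) * e a c * pminor (Suc c) m (u - of_nat (c - j) - 1)))"
  using assms(3,1,2)
proof (induction j arbitrary: u rule: inc_induct)
  case base
  then show ?case
    by (simp add: pminor_empty pos_sign_singleton ell_def)
next
  case (step j)
  let ?A = "insert a {Suc j..m}" and ?bs = "[Suc j..<Suc m]"
  let ?f = "\<lambda>x. v \<rhd> (pos_sign x ?A * ell x j u * minor (?A - {x}) ?bs (u - 1))"
  have "{z \<in> ?A. z < a} = {Suc j..m}" "?A - {a} = {Suc j..m}"
    using step by auto
  then have fa: "?f a = v \<rhd> ((- 1) ^ (m - j) * e a j * pminor (Suc j) m (u - 1))"
    using step by (simp add: pos_sign_def pminor_def ell_def del: upt_Suc)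
  have "pos_sign (Suc j) ?A = (1 :: 'r)" "?A - {Suc j} = insert a {Suc (Suc j)..m}"
    using step by (auto intro!: pos_sign_least)
  moreover have "v \<rhd> ell (Suc j) j u = v"
    using whit_e[of j m v j "Suc j"] step by (simp add: ell_def)
  ultimately have fj: "?f (Suc j) = v \<rhd> minor (insert a {Suc (Suc j)..m}) ?bs (u - 1)"
    by (simp add: ac_mult del: upt_Suc)
  have f0: "?f x = 0" if "x \<in> ?A - {a, Suc j}" for x
  proof -
    have x: "j < x" "x \<noteq> Suc j" "x \<le> m" using that by auto
    have "v \<rhd> ell x j u = 0"
      using whit_e[of j m v j x] x step by (simp add: ell_def)
    moreover have "?f x = v \<rhd> ell x j u \<rhd> pos_sign x ?A \<rhd> minor (?A - {x}) ?bs (u - 1)"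
      by (simp only: ac_mult[symmetric] pos_sign_commute[of "ell x j u"])
    ultimately show ?thesis by (simp only: ac_zero)
  qed
  have "v \<rhd> minor ?A [j..<Suc m] u = (\<Sum>a\<in>?A. ?f a)"
    using step.hyps by (simp only: upt_conv_Cons[of j "Suc m"] less_Suc_eq_le minor.simps ac_sum less_imp_le)
  also have "\<dots> = (\<Sum>x\<in>{a, Suc j}. ?f x)"
    by (intro sum.mono_neutral_right) (use step f0 in auto)
  also have "\<dots> = ?f a + ?f (Suc j)"
    using step by simp
  also have "\<dots> = v \<rhd> ((- 1) ^ (m - j) * e a j * pminor (Suc j) m (u - 1)) +
     (\<Sum>c\<in>{Suc j..m}. v \<rhd> ((- 1) ^ (m - c) * e a c *
      pminor (Suc c) m (u - 1 - of_nat (c - Suc j) - 1)))"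
    unfolding fa fj using step.IH[of "u - 1"] step.prems step.hyps whit_mono[of j m v "Suc j" m] by simp
  also have "(\<Sum>c\<in>{Suc j..m}. v \<rhd> ((- 1) ^ (m - c) * e a c *
      pminor (Suc c) m (u - 1 - of_nat (c - Suc j) - 1)))
    = (\<Sum>c\<in>{Suc j..m}. v \<rhd> ((- 1) ^ (m - c) * e a c * pminor (Suc c) m (u - of_nat (c - j) - 1)))"
  proof (rule sum.cong[OF refl])
    fix c assume "c \<in> {Suc j..m}"
    then have "c - j = Suc (c - Suc j)" by auto
    then show "v \<rhd> ((- 1) ^ (m - c) * e a c * pminor (Suc c) m (u - 1 - of_nat (c - Suc j) - 1))
      = v \<rhd> ((- 1) ^ (m - c) * e a c * pminor (Suc c) m (u - of_nat (c - j) - 1))"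
      by (simp add: algebra_simps)
  qed
  also have "v \<rhd> ((- 1) ^ (m - j) * e a j * pminor (Suc j) m (u - 1)) +
      (\<Sum>c\<in>{Suc j..m}. v \<rhd> ((- 1) ^ (m - c) * e a c * pminor (Suc c) m (u - of_nat (c - j) - 1)))
    = (\<Sum>c\<in>{j..m}. v \<rhd> ((- 1) ^ (m - c) * e a c * pminor (Suc c) m (u - of_nat (c - j) - 1)))"
    using step.hyps by (simp add: sum.atLeast_Suc_atMost[of j m])
  finally show ?case .
qed

end

section \<open>The quantum Hessenberg recursion\<close>

context gl_relations
begin

lemma e_e_commute:
  assumes "i \<in> {1..N}" "j \<in> {1..<N}" "k \<in> {1..N}" "l \<in> {1..<N}" "j \<noteq> k" "l \<noteq> i"
  shows "e i j * e k l = e k l * e i j"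
  using e_commute[of i j k l] assms by simp

lemma eshift_eq_e: "a \<noteq> Suc b \<Longrightarrow> eshift a b = e a b"
  by (simp add: eshift_def)

lemma eshift_mult_commute: "e a b * x = x * e a b \<Longrightarrow> eshift a b * x = x * eshift a b"
  by (simp add: eshift_def algebra_simps)

lemma e_ell_commute_outer:
  assumes "1 \<le> p" "p \<le> b" "b \<le> c" "c < a" "a \<le> N"
  shows "e a p * ell b c u = ell b c u * e a p + (if b = p then e a c else 0)"
  using e_ell_commute[of a p b c u] assms by (simp add: ell_def)

lemma ell_minus_one: "ell b c (u - 1) = ell b c u - (if b = c then 1 else 0)"
  by (simp add: ell_def sc_diff sc_one)

text \<open>Column \<open>c\<close> of the equation \<open>(E a p, ..., E a m) L = 0\<close> as it
  reads on Whittaker vectors. There \<open>L\<close> has ones just below the diagonal and zeros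
  further down; moving these entries to the left changes the parameter from
  \<open>s - (m - p)\<close> to \<open>s - (c - p)\<close>, and \<open>m\<close> disappears. See
  \<open>whit_row_sum\<close>.\<close>

definition hess_rel :: "nat \<Rightarrow> nat \<Rightarrow> nat \<Rightarrow> 'k \<Rightarrow> 'r" where
  "hess_rel p a c s = eshift a (Suc c) + (\<Sum>b\<in>{p..c}. e a b * ell b c (s - of_nat (c - p)))"

text \<open>The change of parameter nearly absorbs the commutators of \<open>e a' p\<close> with the
  entries of \<open>L\<close>. The defect is a 2 by 2 expression in the rows \<open>a\<close> and
  \<open>a'\<close>, which \<open>wspace_exchange\<close> removes.\<close>

lemma e_hess_rel:
  assumes "1 \<le> p" "p \<le> c" "Suc c < a" "a \<le> N" "Suc c < a'" "a' \<le> N"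
  shows "e a' p * hess_rel p a c (s - 1) =
    hess_rel p a c s * e a' p + (e a p * e a' c - e a' p * e a c)"
proof -
  let ?l = "\<lambda>b. ell b c (s - of_nat (c - p))"
  have 0: "e a' p * eshift a (Suc c) = eshift a (Suc c) * e a' p"
    by (rule eshift_mult_commute[symmetric], rule e_e_commute) (use assms in auto)
  have 1: "e a' p * (e a b * ell b c (s - 1 - of_nat (c - p))) = e a b * ?l b * e a' p +
      ((if b = p then e a p * e a' c else 0) - (if b = c then e a' p * e a c else 0))"
    if b: "b \<in> {p..c}" for b
  proof -
    have ee: "e a' p * e a b = e a b * e a' p"
      by (rule e_e_commute) (use assms b in auto)
    have shift: "s - 1 - of_nat (c - p) = s - of_nat (c - p) - 1" by simp
    have "e a' p * (e a b * ell b c (s - 1 - of_nat (c - p)))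
      = e a' p * e a b * ?l b - (if b = c then e a' p * e a c else 0)"
      unfolding shift ell_minus_one by (simp add: right_diff_distrib mult.assoc)
    also have "e a' p * e a b * ?l b = e a b * (e a' p * ?l b)"
      by (simp only: ee mult.assoc)
    also have "e a' p * ?l b = ?l b * e a' p + (if b = p then e a' c else 0)"
      by (rule e_ell_commute_outer) (use assms b in auto)
    finally show ?thesis by (simp add: algebra_simps)
  qed
  have "e a' p * hess_rel p a c (s - 1) = eshift a (Suc c) * e a' p +
     (\<Sum>b\<in>{p..c}. e a b * ?l b * e a' p +
      ((if b = p then e a p * e a' c else 0) - (if b = c then e a' p * e a c else 0)))"
    unfolding hess_rel_def distrib_left sum_distrib_left 0 using 1 by simp
  also have "\<dots> = hess_rel p a c s * e a' p + (e a p * e a' c - e a' p * e a c)"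
    using assms by (simp add: hess_rel_def sum.distrib sum_subtractf sum_distrib_right distrib_right
      sum.delta sum.delta')
  finally show ?thesis .
qed

text \<open>Commuting the minor past row \<open>a\<close> produces row minors, and their sum against
  column \<open>c\<close> is known from \<open>row_minor_ell_sum\<close>. What remains is the same
  row sum with the parameter lowered by 1.\<close>

lemma pminor_row_sum:
  assumes "1 \<le> p" "p \<le> c" "c < m" "m < a" "a \<le> N"
  shows "pminor p m u * (\<Sum>b\<in>{p..m}. eshift a b * ell b c (u - of_nat (m - p))) =
    (\<Sum>b\<in>{p..m}. eshift a b * ell b c (u - 1 - of_nat (m - p))) * pminor p m u"
proof -
  let ?D = "pminor p m u" and ?v = "u - of_nat (m - p)"
  have De: "?D * eshift a b = eshift a b * ?D - row_minor p m a b u" for b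
    by (simp add: row_minor_def eshift_def algebra_simps)
  have Dl: "?D * ell b c ?v = ell b c ?v * ?D" if "b \<in> {p..m}" for b
  proof -
    have "?D * e b c = e b c * ?D"
      by (rule e_pminor_commute[symmetric]) (use assms that in auto)
    then show ?thesis by (simp add: ell_def algebra_simps sc_commute[of ?D])
  qed
  have v: "u - 1 - of_nat (m - p) = ?v - 1" by simp
  have v': "u - of_nat (Suc m - p) = ?v - 1"
    using assms by (simp add: Suc_diff_le)
  have "?D * (eshift a b * ell b c ?v) = eshift a b * ell b c (?v - 1) * ?D
      + (if b = c then eshift a c * ?D - row_minor p m a c u else 0)
      - row_minor p m a b u * ell b c (?v - 1)" if b: "b \<in> {p..m}" for b
  proof -
    have "?D * (eshift a b * ell b c ?v) = (?D * eshift a b) * ell b c ?v"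
      by (simp only: mult.assoc)
    also have "\<dots> = eshift a b * (?D * ell b c ?v) - row_minor p m a b u * ell b c ?v"
      unfolding De by (simp add: algebra_simps)
    also have "?D * ell b c ?v = ell b c ?v * ?D" by (rule Dl[OF b])
    finally show ?thesis
      unfolding ell_minus_one by (simp add: algebra_simps)
  qed
  then have "?D * (\<Sum>b\<in>{p..m}. eshift a b * ell b c ?v) =
     (\<Sum>b\<in>{p..m}. eshift a b * ell b c (?v - 1)) * ?D
     + (eshift a c * ?D - row_minor p m a c u)
     - (\<Sum>b\<in>{p..m}. row_minor p m a b u * ell b c (?v - 1))"
    using assms by (simp add: sum_distrib_left sum_distrib_right sum.distrib sum_subtractf)
  also have "(\<Sum>b\<in>{p..m}. row_minor p m a b u * ell b c (?v - 1)) = ?D * e a c"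
    using row_minor_ell_sum[of p c m a u] assms unfolding v' by simp
  finally show ?thesis
    unfolding v using assms by (simp add: row_minor_def eshift_eq_e)
qed

end

lemma sum_triangle_swap:
  fixes f :: "nat \<Rightarrow> nat \<Rightarrow> 'a::comm_monoid_add"
  shows "(\<Sum>b\<in>{p..m}. \<Sum>c\<in>{b..m}. f b c) = (\<Sum>c\<in>{p..m}. \<Sum>b\<in>{p..c}. f b c)"
proof -
  have "(\<Sum>b\<in>{p..m}. \<Sum>c\<in>{b..m}. f b c) = (\<Sum>b\<in>{p..m}. \<Sum>c\<in>{c \<in> {p..m}. b \<le> c}. f b c)"
    by (intro sum.cong refl) auto
  also have "\<dots> = (\<Sum>c\<in>{p..m}. \<Sum>b\<in>{b \<in> {p..m}. b \<le> c}. f b c)"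
    by (rule sum.swap_restrict) auto
  also have "\<dots> = (\<Sum>c\<in>{p..m}. \<Sum>b\<in>{p..c}. f b c)"
    by (intro sum.cong refl) auto
  finally show ?thesis .
qed

section \<open>The spaces \<open>wspace\<close> and the Weyl relation\<close>

context gl_module
begin

lemma whit_ac:
  assumes "whit p m v" "\<And>a b. p \<le> b \<Longrightarrow> b < a \<Longrightarrow> a \<le> m \<Longrightarrow> x * e a b = e a b * x"
  shows "whit p m (v \<rhd> x)"
  unfolding whit_def
proof (intro allI impI)
  fix a b assume ab: "p \<le> b \<and> b < a \<and> a \<le> m"
  have "v \<rhd> x \<rhd> eshift a b = v \<rhd> (eshift a b * x)"
    using eshift_mult_commute[of a b x] assms(2)[of b a] ab by (simp add: ac_mult[symmetric])
  also have "\<dots> = 0" using assms(1) ab by (simp add: ac_mult whit_def ac_zero)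
  finally show "v \<rhd> x \<rhd> eshift a b = 0" .
qed

definition wspace :: "nat \<Rightarrow> nat \<Rightarrow> 'k \<Rightarrow> 'w \<Rightarrow> bool" where
  "wspace p m s v \<longleftrightarrow> whit p m v \<and>
     (\<forall>a c. p \<le> c \<and> c < m \<and> m < a \<and> a \<le> N \<longrightarrow> v \<rhd> hess_rel p a c s = 0)"

text \<open>Two rows below the block obey the same recursion, so they behave like proportional rows,
  and their 2 by 2 minors with column \<open>p\<close> vanish.\<close>

lemma wspace_exchange:
  assumes "wspace p m s v" "1 \<le> p" "m < a" "a \<le> N" "m < a'" "a' \<le> N" "p \<le> c" "c < m"
  shows "v \<rhd> (e a p * e a' c) = v \<rhd> (e a' p * e a c)"
  using assms(7,8)
proof (induction c rule: less_induct)
  case (less d)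
  have comm: "e x b * e y b' = e y b' * e x b"
    if "x \<in> {a, a'}" "y \<in> {a, a'}" "b \<in> {p..m}" "b' \<in> {p..m}" for x y b b'
    by (rule e_e_commute) (use assms that in auto)
  show ?case
  proof (cases "d = p")
    case True
    then show ?thesis using comm[of a a' p p] less.prems by simp
  next
    case False
    then obtain c where d: "d = Suc c" and c: "p \<le> c" "Suc c < m"
      using less.prems by (cases d) auto
    let ?l = "\<lambda>b. ell b c (s - of_nat (c - p))"
    \<comment> \<open>The recursion replaces \<open>e y d\<close> by earlier columns. Moving
      \<open>e x p\<close> to the front past \<open>?l p\<close> creates
      \<open>e y p * e x c\<close>, so that all terms fall under the exchange for columns up to
      \<open>c\<close>.\<close>
    have key: "v \<rhd> (e x p * e y d) = v \<rhd> (e y p * e x c) - (\<Sum>b\<in>{p..c}. v \<rhd> (e x p * e y b) \<rhd> ?l b)"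
      if x: "x \<in> {a, a'}" and y: "y \<in> {a, a'}" for x y
    proof -
      have "v \<rhd> hess_rel p y c s = 0"
        using assms c y by (auto simp: wspace_def)
      moreover have "eshift y (Suc c) = e y d"
        using y c assms by (auto simp: d intro!: eshift_eq_e)
      ultimately have "v \<rhd> e y d = - (\<Sum>b\<in>{p..c}. v \<rhd> (e y b * ?l b))"
        by (simp add: hess_rel_def ac_linear eq_neg_iff_add_eq_0)
      then have "v \<rhd> (e y d * e x p) = - (\<Sum>b\<in>{p..c}. v \<rhd> (e y b * ?l b * e x p))"
        by (simp add: ac_mult ac_minus sum_ac)
      also have "(\<Sum>b\<in>{p..c}. v \<rhd> (e y b * ?l b * e x p)) =
        (\<Sum>b\<in>{p..c}. v \<rhd> (e x p * e y b) \<rhd> ?l b - (if b = p then v \<rhd> (e y p * e x c) else 0))"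
      proof (rule sum.cong[OF refl])
        fix b assume b: "b \<in> {p..c}"
        have "e x p * ?l b = ?l b * e x p + (if b = p then e x c else 0)"
          by (rule e_ell_commute_outer) (use assms b c x in auto)
        then have "e y b * ?l b * e x p = e y b * (e x p * ?l b) - (if b = p then e y p * e x c else 0)"
          by (simp add: algebra_simps)
        also have "e y b * (e x p * ?l b) = e x p * e y b * ?l b"
          using comm[of x y p b] x y b c by (simp add: mult.assoc[symmetric])
        finally show "v \<rhd> (e y b * ?l b * e x p) =
            v \<rhd> (e x p * e y b) \<rhd> ?l b - (if b = p then v \<rhd> (e y p * e x c) else 0)"
          by (simp add: ac_mult ac_diff ac_zero)
      qed
      finally show ?thesis
        using comm[of x y p d] x y c d less.prems by (simp add: sum_subtractf)
    qed
    have "v \<rhd> (e a p * e a' b) = v \<rhd> (e a' p * e a b)" if "b \<in> {p..c}" for b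
      by (rule less.IH) (use that d c in auto)
    then show ?thesis
      unfolding key[of a a', simplified] key[of a' a, simplified] using c by simp
  qed
qed

lemma wspace_eshift:
  assumes "wspace p m s v" "1 \<le> p" "m < N" "m < a'" "a' \<le> N" "p \<le> m"
  shows "wspace p m (s - 1) (v \<rhd> eshift a' p)"
  unfolding wspace_def
proof (intro conjI allI impI)
  show "whit p m (v \<rhd> eshift a' p)"
  proof (rule whit_ac)
    show "whit p m v" using assms by (simp add: wspace_def)
    show "eshift a' p * e a b = e a b * eshift a' p" if "p \<le> b" "b < a" "a \<le> m" for a b
      by (rule eshift_mult_commute, rule e_e_commute) (use assms that in auto)
  qed
next
  fix a c assume ac: "p \<le> c \<and> c < m \<and> m < a \<and> a \<le> N"
  \<comment> \<open>A column \<open>c\<close> with \<open>p \<le> c < m\<close> excludes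
    \<open>a' = Suc p\<close>, so the character does not enter.\<close>
  have "eshift a' p = e a' p" using ac assms by (intro eshift_eq_e) auto
  then have "v \<rhd> eshift a' p \<rhd> hess_rel p a c (s - 1) = v \<rhd> (e a' p * hess_rel p a c (s - 1))"
    by (simp add: ac_mult)
  also have "\<dots> = v \<rhd> hess_rel p a c s \<rhd> e a' p + (v \<rhd> (e a p * e a' c) - v \<rhd> (e a' p * e a c))"
    using ac assms by (subst e_hess_rel) (auto simp: ac_linear ac_mult)
  also have "v \<rhd> (e a p * e a' c) = v \<rhd> (e a' p * e a c)"
    by (rule wspace_exchange[OF assms(1)]) (use ac assms in auto)
  also have "v \<rhd> hess_rel p a c s = 0"
    using assms(1) ac by (auto simp: wspace_def)
  finally show "v \<rhd> eshift a' p \<rhd> hess_rel p a c (s - 1) = 0" by (simp add: ac_zero)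
qed

text \<open>Each entry \<open>e b c\<close> with \<open>b > c\<close> is moved to the left, where it
  acts on the Whittaker vector by 1 or 0. Every move leaves a commutator \<open>e a c\<close>, and
  these \<open>m - c\<close> copies shift the parameter of the diagonal entry.\<close>

lemma whit_row_sum:
  assumes "whit p m y" "1 \<le> p" "p \<le> c" "c < m" "m < a" "a \<le> N"
  shows "y \<rhd> (\<Sum>b\<in>{p..m}. eshift a b * ell b c (s - of_nat (m - p))) = y \<rhd> hess_rel p a c s"
proof -
  let ?v = "s - of_nat (m - p)"
  have split: "{p..m} = {p..c} \<union> {Suc c..m}" "{p..c} \<inter> {Suc c..m} = {}" using assms by auto
  have low: "y \<rhd> (eshift a b * ell b c ?v) = (if b = Suc c then y \<rhd> eshift a (Suc c) else 0) + y \<rhd> e a c"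
    if b: "b \<in> {Suc c..m}" for b
  proof -
    have "e a b * e b c = e b c * e a b + e a c"
      using e_commute[of a b b c] assms b by auto
    then have "eshift a b * e b c = e b c * eshift a b + e a c"
      by (simp add: eshift_def algebra_simps)
    moreover have "ell b c ?v = e b c" using b by (simp add: ell_def)
    moreover have "y \<rhd> e b c = (if b = Suc c then y else 0)"
      by (rule whit_e) (use assms b in auto)
    ultimately show ?thesis by (auto simp: ac_add ac_mult ac_zero)
  qed
  have "s - of_nat (c - p) = ?v + of_nat (m - c)"
    using assms by (simp add: of_nat_diff)
  moreover have "sc (of_nat n) = of_nat n" for n
    by (induction n) (simp_all add: sc_zero sc_add sc_one)
  ultimately have ell: "ell b c (s - of_nat (c - p)) = ell b c ?v + (if b = c then of_nat (m - c) else 0)" for b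
    by (simp only: ell_def sc_add) simp
  have up: "eshift a b * ell b c ?v = e a b * ell b c (s - of_nat (c - p)) -
      (if b = c then of_nat (m - c) * e a c else 0)" if "b \<in> {p..c}" for b
  proof -
    have "eshift a b = e a b" using that assms by (intro eshift_eq_e) auto
    then show ?thesis
      unfolding ell by (simp add: distrib_left mult_of_nat_commute)
  qed
  have nat: "y \<rhd> (of_nat n * x) = (\<Sum>i\<in>{..<n}. y \<rhd> x)" for n x
    by (induction n) (simp_all add: ac_linear distrib_right add.commute)
  have "y \<rhd> (\<Sum>b\<in>{p..m}. eshift a b * ell b c ?v) =
     (\<Sum>b\<in>{p..c}. y \<rhd> (eshift a b * ell b c ?v)) + (\<Sum>b\<in>{Suc c..m}. y \<rhd> (eshift a b * ell b c ?v))"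
    unfolding ac_sum split(1) by (rule sum.union_disjoint) (use split(2) in auto)
  also have "(\<Sum>b\<in>{Suc c..m}. y \<rhd> (eshift a b * ell b c ?v)) =
      y \<rhd> eshift a (Suc c) + (\<Sum>b\<in>{Suc c..m}. y \<rhd> e a c)"
    using low assms by (simp add: sum.distrib)
  also have "(\<Sum>b\<in>{Suc c..m}. y \<rhd> e a c) = y \<rhd> (of_nat (m - c) * e a c)"
    unfolding nat by (rule sum.reindex_bij_witness[of _ "\<lambda>i. i + Suc c" "\<lambda>i. i - Suc c"]) auto
  also have "(\<Sum>b\<in>{p..c}. y \<rhd> (eshift a b * ell b c ?v)) =
     (\<Sum>b\<in>{p..c}. y \<rhd> (e a b * ell b c (s - of_nat (c - p)))) - y \<rhd> (of_nat (m - c) * e a c)"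
  proof -
    have "y \<rhd> (eshift a b * ell b c ?v) = y \<rhd> (e a b * ell b c (s - of_nat (c - p))) -
        (if b = c then y \<rhd> (of_nat (m - c) * e a c) else 0)" if "b \<in> {p..c}" for b
      unfolding up[OF that] by (simp add: ac_diff ac_zero)
    then have "(\<Sum>b\<in>{p..c}. y \<rhd> (eshift a b * ell b c ?v)) =
      (\<Sum>b\<in>{p..c}. y \<rhd> (e a b * ell b c (s - of_nat (c - p))) -
        (if b = c then y \<rhd> (of_nat (m - c) * e a c) else 0))"
      by (rule sum.cong[OF refl])
    then show ?thesis using assms by (simp add: sum_subtractf del: of_nat_diff)
  qed
  finally show ?thesis by (simp add: hess_rel_def ac_add ac_sum)
qed

text \<open>The recursion is tested through the full row sum, since that is the form which the minor
  intertwines.\<close>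

lemma wspace_pminor:
  assumes "wspace p m s v" "1 \<le> p" "m < N"
  shows "wspace p m (s + 1) (v \<rhd> pminor p m (s + 1))"
  unfolding wspace_def
proof (intro conjI allI impI)
  have wv: "whit p m v" using assms(1) by (simp add: wspace_def)
  show w: "whit p m (v \<rhd> pminor p m (s + 1))"
    by (rule whit_ac[OF wv]) (rule e_pminor_commute[symmetric], use assms in auto)
  fix a c assume ac: "p \<le> c \<and> c < m \<and> m < a \<and> a \<le> N"
  have "v \<rhd> pminor p m (s + 1) \<rhd> hess_rel p a c (s + 1) =
     v \<rhd> (pminor p m (s + 1) * (\<Sum>b\<in>{p..m}. eshift a b * ell b c (s + 1 - of_nat (m - p))))"
    using whit_row_sum[OF w, of c a "s + 1"] assms ac by (simp add: ac_mult)
  also have "\<dots> = v \<rhd> (\<Sum>b\<in>{p..m}. eshift a b * ell b c (s - of_nat (m - p))) \<rhd> pminor p m (s + 1)"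
    using pminor_row_sum[of p c m a "s + 1"] assms ac by (simp add: ac_mult)
  also have "\<dots> = v \<rhd> hess_rel p a c s \<rhd> pminor p m (s + 1)"
    using whit_row_sum[OF wv, of c a s] assms ac by simp
  also have "v \<rhd> hess_rel p a c s = 0"
    using assms(1) ac by (auto simp: wspace_def)
  finally show "v \<rhd> pminor p m (s + 1) \<rhd> hess_rel p a c (s + 1) = 0"
    by (simp add: ac_zero)
qed

text \<open>
  The sequence \<open>r\<close> collects the vectors \<open>v \<rhd> eshift a b\<close>, continued by one entry
  through the recursion that \<open>wspace\<close> imposes; both identities below come from summing the
  expansions of \<open>r b \<rhd> pminor b m\<close> with alternating signs.
\<close>

definition hess_next :: "nat \<Rightarrow> nat \<Rightarrow> nat \<Rightarrow> 'k \<Rightarrow> 'w \<Rightarrow> 'w" where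
  "hess_next p m a s v = - (\<Sum>b\<in>{p..m}. v \<rhd> eshift a b \<rhd> ell b m (s - of_nat (m - p)))"

lemma hess_sequence:
  fixes r :: "nat \<Rightarrow> 'w"
  assumes "p \<le> m"
    and rec: "\<And>c. p \<le> c \<Longrightarrow> c \<le> m \<Longrightarrow>
      r (Suc c) = - (\<Sum>b\<in>{p..c}. r b \<rhd> ell b c (s - of_nat (c - p)))"
    and whit: "\<And>b. p \<le> b \<Longrightarrow> b \<le> m \<Longrightarrow> whit b m (r b)"
  shows "r p \<rhd> pminor p m s = r (Suc m) \<rhd> (- 1) ^ (Suc m - p)"
    and "r p \<rhd> pminor p m (s + 1) = r (Suc m) \<rhd> (- 1) ^ (Suc m - p) +
      (\<Sum>c\<in>{p..m}. r c \<rhd> ((- 1) ^ (c - p) * pminor (Suc c) m (s - of_nat (c - p))))"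
proof -
  define F where "F \<tau> b = r b \<rhd> ((- 1) ^ (b - p) * pminor b m (\<tau> - of_nat (b - p)))" for \<tau> b
  have F_last: "F \<tau> (Suc m) = r (Suc m) \<rhd> (- 1) ^ (Suc m - p)" for \<tau>
    by (simp add: F_def pminor_empty)
  have F_first: "F \<tau> p = r p \<rhd> pminor p m \<tau>" for \<tau>
    by (simp add: F_def)
  have F_sum: "(\<Sum>b\<in>{p..m}. F \<tau> b) = (\<Sum>c\<in>{p..m}. (\<Sum>b\<in>{p..c}. r b \<rhd> ell b c (\<tau> - of_nat (c - p)))
      \<rhd> ((- 1) ^ (c - p) * pminor (Suc c) m (\<tau> - of_nat (c - p) - 1)))" for \<tau>
  proof -
    have "F \<tau> b = (\<Sum>c\<in>{b..m}. r b \<rhd> ell b c (\<tau> - of_nat (c - p)) \<rhd>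
       ((- 1) ^ (c - p) * pminor (Suc c) m (\<tau> - of_nat (c - p) - 1)))" if b: "b \<in> {p..m}" for b
    proof -
      have "F \<tau> b = r b \<rhd> pminor b m (\<tau> - of_nat (b - p)) \<rhd> (- 1) ^ (b - p)"
      proof -
        have "(- 1) ^ (b - p) * x = x * (- 1) ^ (b - p)" for x :: 'r
          by (simp add: minus_one_power_iff)
        then show ?thesis by (simp only: F_def ac_mult[symmetric])
      qed
      also have "\<dots> = (\<Sum>c\<in>{b..m}. r b \<rhd> ((- 1) ^ (c - b) * ell b c (\<tau> - of_nat (b - p) - of_nat (c - b)) *
        pminor (Suc c) m (\<tau> - of_nat (b - p) - of_nat (c - b) - 1)) \<rhd> (- 1) ^ (b - p))"
        using whit_pminor[of b m "r b"] whit[of b] b by (simp add: sum_ac)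
      also have "\<dots> = (\<Sum>c\<in>{b..m}. r b \<rhd> ell b c (\<tau> - of_nat (c - p)) \<rhd>
       ((- 1) ^ (c - p) * pminor (Suc c) m (\<tau> - of_nat (c - p) - 1)))"
      proof (rule sum.cong[OF refl])
        fix c assume c: "c \<in> {b..m}"
        have "of_nat (c - p) = (of_nat (b - p) + of_nat (c - b) :: 'k)"
          using b c by (simp flip: of_nat_add)
        then have 1: "\<tau> - of_nat (b - p) - of_nat (c - b) = \<tau> - of_nat (c - p)" by simp
        have "c - p = (c - b) + (b - p)" using b c by simp
        then have 2: "(- 1) ^ (c - p) = ((- 1) ^ (c - b) * (- 1) ^ (b - p) :: 'r)"
          by (simp only: power_add)
        have "(- 1) ^ (c - b) * x * y * (- 1) ^ (b - p) = x * ((- 1) ^ (c - b) * (- 1) ^ (b - p) * y)"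
          for x y :: 'r by (simp add: minus_one_power_iff mult.assoc)
        then show "r b \<rhd> ((- 1) ^ (c - b) * ell b c (\<tau> - of_nat (b - p) - of_nat (c - b)) *
        pminor (Suc c) m (\<tau> - of_nat (b - p) - of_nat (c - b) - 1)) \<rhd> (- 1) ^ (b - p) =
          r b \<rhd> ell b c (\<tau> - of_nat (c - p)) \<rhd>
         ((- 1) ^ (c - p) * pminor (Suc c) m (\<tau> - of_nat (c - p) - 1))"
          unfolding 1 2 by (simp only: ac_mult[symmetric])
      qed
      finally show ?thesis .
    qed
    then show ?thesis
      by (simp only: sum_ac sum_triangle_swap cong: sum.cong)
  qed
  have tel: "(\<Sum>c\<in>{p..m}. F \<tau> (Suc c)) = (\<Sum>b\<in>{p..m}. F \<tau> b) - F \<tau> p + F \<tau> (Suc m)" for \<tau>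
    using sum_Suc_diff[of p m "F \<tau>"] assms(1) by (simp add: sum_subtractf algebra_simps)
  have step: "- r (Suc c) \<rhd> ((- 1) ^ (c - p) * pminor (Suc c) m (\<tau> - of_nat (c - p) - 1)) = F \<tau> (Suc c)"
    if "c \<in> {p..m}" for c \<tau>
  proof -
    have "Suc c - p = Suc (c - p)" using that by auto
    then show ?thesis by (simp add: F_def ac_minus algebra_simps)
  qed
  \<comment> \<open>For \<open>\<tau> = s\<close> the inner sums are \<open>- r (Suc c)\<close>, so
    the sum of \<open>F\<close> equals the same sum moved by one index, and only the two end terms
    remain.\<close>
  have "(\<Sum>b\<in>{p..m}. F s b) = (\<Sum>c\<in>{p..m}. F s (Suc c))"
    unfolding F_sum
  proof (rule sum.cong[OF refl])
    fix c assume c: "c \<in> {p..m}"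
    have "(\<Sum>b\<in>{p..c}. r b \<rhd> ell b c (s - of_nat (c - p))) = - r (Suc c)"
      using rec[of c] c by simp
    then show "(\<Sum>b\<in>{p..c}. r b \<rhd> ell b c (s - of_nat (c - p))) \<rhd>
       ((- 1) ^ (c - p) * pminor (Suc c) m (s - of_nat (c - p) - 1)) = F s (Suc c)"
      using step[OF c] by simp
  qed
  then show "r p \<rhd> pminor p m s = r (Suc m) \<rhd> (- 1) ^ (Suc m - p)"
    unfolding tel F_last F_first by simp
  have "(\<Sum>b\<in>{p..m}. F (s + 1) b) = (\<Sum>c\<in>{p..m}. F (s + 1) (Suc c) +
      r c \<rhd> ((- 1) ^ (c - p) * pminor (Suc c) m (s - of_nat (c - p))))"
    unfolding F_sum
  proof (rule sum.cong[OF refl])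
    fix c assume c: "c \<in> {p..m}"
    \<comment> \<open>Raising the parameter by 1 adds 1 to the diagonal entry of every column, hence
      the additional terms \<open>r c\<close>.\<close>
    have "ell b c (s + 1 - of_nat (c - p)) = ell b c (s - of_nat (c - p)) + (if b = c then 1 else 0)" for b
      using ell_minus_one[of b c "s + 1 - of_nat (c - p)"] by (simp add: algebra_simps)
    then have "(\<Sum>b\<in>{p..c}. r b \<rhd> ell b c (s + 1 - of_nat (c - p))) =
       (\<Sum>b\<in>{p..c}. r b \<rhd> ell b c (s - of_nat (c - p)) + (if b = c then r c else 0))"
      by (intro sum.cong refl) (simp add: ac_add ac_one ac_zero)
    also have "\<dots> = - r (Suc c) + r c"
      using rec[of c] c by (simp add: sum.distrib)
    finally have "(\<Sum>b\<in>{p..c}. r b \<rhd> ell b c (s + 1 - of_nat (c - p))) = - r (Suc c) + r c" .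
    moreover have "s + 1 - of_nat (c - p) - 1 = s - of_nat (c - p)" by simp
    ultimately show "(\<Sum>b\<in>{p..c}. r b \<rhd> ell b c (s + 1 - of_nat (c - p))) \<rhd>
       ((- 1) ^ (c - p) * pminor (Suc c) m (s + 1 - of_nat (c - p) - 1)) = F (s + 1) (Suc c) +
      r c \<rhd> ((- 1) ^ (c - p) * pminor (Suc c) m (s - of_nat (c - p)))"
      using step[OF c, of "s + 1"] by (simp only: ac_add_left)
  qed
  then show "r p \<rhd> pminor p m (s + 1) = r (Suc m) \<rhd> (- 1) ^ (Suc m - p) +
      (\<Sum>c\<in>{p..m}. r c \<rhd> ((- 1) ^ (c - p) * pminor (Suc c) m (s - of_nat (c - p))))"
    unfolding sum.distrib tel F_last F_first by (simp add: algebra_simps)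
qed

lemma wspace_hess_sequence:
  assumes "wspace p m s v" "1 \<le> p" "p \<le> m" "m < a" "a \<le> N"
  defines "r \<equiv> \<lambda>b. if b = Suc m then hess_next p m a s v else v \<rhd> eshift a b"
  shows "p \<le> c \<Longrightarrow> c \<le> m \<Longrightarrow>
      r (Suc c) = - (\<Sum>b\<in>{p..c}. r b \<rhd> ell b c (s - of_nat (c - p)))"
    and "p \<le> b \<Longrightarrow> b \<le> m \<Longrightarrow> whit b m (r b)"
proof -
  assume c: "p \<le> c" "c \<le> m"
  show "r (Suc c) = - (\<Sum>b\<in>{p..c}. r b \<rhd> ell b c (s - of_nat (c - p)))"
  proof (cases "c = m")
    case True
    have "(\<Sum>b\<in>{p..m}. v \<rhd> eshift a b \<rhd> ell b m (s - of_nat (m - p))) =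
        (\<Sum>b\<in>{p..m}. r b \<rhd> ell b m (s - of_nat (m - p)))"
      by (rule sum.cong) (auto simp: r_def)
    then show ?thesis using True by (simp only: r_def hess_next_def) simp
  next
    case False
    have "v \<rhd> hess_rel p a c s = 0"
      using False assms c by (auto simp: wspace_def)
    moreover have "(\<Sum>b\<in>{p..c}. v \<rhd> (e a b * ell b c (s - of_nat (c - p)))) =
        (\<Sum>b\<in>{p..c}. r b \<rhd> ell b c (s - of_nat (c - p)))"
    proof (rule sum.cong[OF refl])
      fix b assume "b \<in> {p..c}"
      then have "eshift a b = e a b" "b \<noteq> Suc m" using assms c False by (auto intro!: eshift_eq_e)
      then show "v \<rhd> (e a b * ell b c (s - of_nat (c - p))) = r b \<rhd> ell b c (s - of_nat (c - p))"
        by (simp add: r_def ac_mult)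
    qed
    ultimately have "v \<rhd> eshift a (Suc c) + (\<Sum>b\<in>{p..c}. r b \<rhd> ell b c (s - of_nat (c - p))) = 0"
      by (simp only: hess_rel_def ac_add ac_sum)
    then show ?thesis using False by (simp add: r_def eq_neg_iff_add_eq_0)
  qed
next
  assume b: "p \<le> b" "b \<le> m"
  have "whit b m (v \<rhd> eshift a b)"
  proof (rule whit_ac)
    show "whit b m v" using assms b whit_mono[of p m v b m] by (simp add: wspace_def)
    show "eshift a b * e a' b' = e a' b' * eshift a b" if "b \<le> b'" "b' < a'" "a' \<le> m" for a' b'
      by (rule eshift_mult_commute, rule e_e_commute) (use assms b that in auto)
  qed
  then show "whit b m (r b)" using b by (simp add: r_def)
qed

text \<open>The minor with parameter \<open>s\<close> continues the row by one entry, up to sign.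
  This is where the new column of the recursion comes from when \<open>m\<close> grows, see
  \<open>proj_op_next\<close>.\<close>

lemma wspace_eshift_pminor:
  assumes "wspace p m s v" "1 \<le> p" "p \<le> m" "m < a" "a \<le> N"
  shows "v \<rhd> eshift a p \<rhd> pminor p m s = hess_next p m a s v \<rhd> (- 1) ^ (Suc m - p)"
  using hess_sequence(1)[OF assms(3) wspace_hess_sequence[OF assms]] assms(3) by simp

lemma wspace_row_minor:
  assumes "wspace p m s v" "1 \<le> p" "p \<le> m" "m < a" "a \<le> N"
  shows "v \<rhd> row_minor p m a p (s + 1) =
    (\<Sum>c\<in>{p..m}. v \<rhd> eshift a c \<rhd> ((- 1) ^ (c - p) * pminor (Suc c) m (s - of_nat (c - p))))
    + (if a = Suc m then v \<rhd> (- 1) ^ (m - p) else 0)"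
proof -
  have w: "whit p m v" using assms(1) by (simp add: wspace_def)
  have "{p..m} - {p} = {Suc p..m}" by auto
  then have "v \<rhd> row_minor p m a p (s + 1) =
      v \<rhd> ((- 1) ^ (m - p) * minor (insert a {Suc p..m}) [p..<Suc m] (s + 1))"
    using row_minor_eq[of p p m a "s + 1"] assms by simp
  also have "\<dots> = v \<rhd> minor (insert a {Suc p..m}) [p..<Suc m] (s + 1) \<rhd> (- 1) ^ (m - p)"
    by (simp add: minus_one_power_iff ac_mult ac_minus ac_one)
  also have "\<dots> = (\<Sum>c\<in>{p..m}. v \<rhd> ((- 1) ^ (m - c) * e a c * pminor (Suc c) m (s - of_nat (c - p)))
     \<rhd> (- 1) ^ (m - p))"
    using whit_minor_bottom_row[OF w assms(4,3), of "s + 1"] by (simp add: sum_ac algebra_simps del: upt_Suc)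
  also have "\<dots> = (\<Sum>c\<in>{p..m}. v \<rhd> e a c \<rhd> ((- 1) ^ (c - p) * pminor (Suc c) m (s - of_nat (c - p))))"
  proof (rule sum.cong[OF refl])
    fix c assume c: "c \<in> {p..m}"
    have 1: "(- 1) ^ (m - c) * x * y * (- 1) ^ (m - p) = x * ((- 1) ^ (m - c) * (- 1) ^ (m - p) * y)"
      for x y :: 'r by (simp add: minus_one_power_iff mult.assoc)
    have "m - p = (m - c) + (c - p)" using c by simp
    then have "(- 1) ^ (m - p) = ((- 1) ^ (m - c) * (- 1) ^ (c - p) :: 'r)" by (simp only: power_add)
    then have 2: "(- 1) ^ (m - c) * (- 1) ^ (m - p) = ((- 1) ^ (c - p) :: 'r)"
      by (simp add: mult.assoc[symmetric] minus_one_power_square)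
    show "v \<rhd> ((- 1) ^ (m - c) * e a c * pminor (Suc c) m (s - of_nat (c - p))) \<rhd> (- 1) ^ (m - p) =
      v \<rhd> e a c \<rhd> ((- 1) ^ (c - p) * pminor (Suc c) m (s - of_nat (c - p)))"
      by (simp only: ac_mult[symmetric] 1 2)
  qed
  \<comment> \<open>Only column \<open>m\<close> can meet the character, and only for
    \<open>a = Suc m\<close>; there the remaining minor is empty. This is the origin of the constant
    in the Weyl relation.\<close>
  also have "\<dots> = (\<Sum>c\<in>{p..m}. v \<rhd> eshift a c \<rhd> ((- 1) ^ (c - p) * pminor (Suc c) m (s - of_nat (c - p)))
     + (if c = m then (if a = Suc m then v \<rhd> (- 1) ^ (m - p) else 0) else 0))"
  proof (rule sum.cong[OF refl])
    fix c assume "c \<in> {p..m}"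
    then show "v \<rhd> e a c \<rhd> ((- 1) ^ (c - p) * pminor (Suc c) m (s - of_nat (c - p))) =
      v \<rhd> eshift a c \<rhd> ((- 1) ^ (c - p) * pminor (Suc c) m (s - of_nat (c - p)))
     + (if c = m then (if a = Suc m then v \<rhd> (- 1) ^ (m - p) else 0) else 0)"
      using assms(4) by (cases "c = m") (auto simp: eshift_def ac_diff ac_one ac_zero pminor_empty)
  qed
  finally show ?thesis using assms(3) by (simp add: sum.distrib)
qed

text \<open>The Weyl relation on \<open>V s\<close>. Commuting first gives \<open>eshift a p\<close>
  followed by the minor with parameter \<open>s + 1\<close>, minus a row minor. Lowering the
  parameter to \<open>s\<close> by \<open>hess_sequence\<close> costs a sum over columns, and the
  row minor expands into the same sum; only the contribution of the character survives.\<close>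

lemma wspace_pminor_eshift:
  assumes "wspace p m s v" "1 \<le> p" "p \<le> m" "m < a" "a \<le> N"
  shows "v \<rhd> pminor p m (s + 1) \<rhd> eshift a p = v \<rhd> eshift a p \<rhd> pminor p m s +
    (if a = Suc m then v \<rhd> (- 1) ^ (Suc m - p) else 0)"
proof -
  have "pminor p m (s + 1) * eshift a p = eshift a p * pminor p m (s + 1) - row_minor p m a p (s + 1)"
    by (simp add: row_minor_def eshift_def algebra_simps)
  then have 1: "v \<rhd> pminor p m (s + 1) \<rhd> eshift a p =
      v \<rhd> eshift a p \<rhd> pminor p m (s + 1) - v \<rhd> row_minor p m a p (s + 1)"
    by (simp only: ac_mult[symmetric] ac_diff)
  let ?Z = "(\<Sum>c\<in>{p..m}. v \<rhd> eshift a c \<rhd> ((- 1) ^ (c - p) * pminor (Suc c) m (s - of_nat (c - p))))"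
  have 2: "v \<rhd> eshift a p \<rhd> pminor p m (s + 1) = hess_next p m a s v \<rhd> (- 1) ^ (Suc m - p) + ?Z"
    using hess_sequence(2)[OF assms(3) wspace_hess_sequence[OF assms]] assms(3) by simp
  have "Suc m - p = Suc (m - p)" using assms by simp
  then show ?thesis
    unfolding 1 2 wspace_row_minor[OF assms] wspace_eshift_pminor[OF assms]
    by (simp add: ac_minus)
qed

end

section \<open>Falling products of minors and the coefficients of a factor\<close>

context gl_relations
begin

lemma sc_minus_one_power: "sc ((- 1) ^ n) = (- 1) ^ n"
  by (simp add: minus_one_power_iff sc_one sc_minus)

definition pfall :: "nat \<Rightarrow> nat \<Rightarrow> 'k \<Rightarrow> nat \<Rightarrow> 'r" where
  "pfall p m s k = prod_list (map (\<lambda>l. pminor p m (s - of_nat l)) [0..<k])"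

lemma pfall_0: "pfall p m s 0 = 1"
  by (simp add: pfall_def)

lemma pfall_Suc: "pfall p m s (Suc k) = pfall p m s k * pminor p m (s - of_nat k)"
  by (simp add: pfall_def)

lemma pfall_Suc_first: "pfall p m s (Suc k) = pminor p m s * pfall p m (s - 1) k"
proof -
  have "s - 1 - of_nat l = s - of_nat (Suc l)" for l by simp
  then show ?thesis
    unfolding pfall_def map_upt_Suc by (simp only: prod_list.Cons list.map of_nat_0 diff_zero)
qed

lemma pfall_commute:
  assumes "\<And>t. x * pminor p m t = pminor p m t * x"
  shows "x * pfall p m s k = pfall p m s k * x"
proof (induction k)
  case (Suc k)
  have "x * pfall p m s (Suc k) = x * pfall p m s k * pminor p m (s - of_nat k)"
    by (simp only: pfall_Suc mult.assoc)
  also have "\<dots> = pfall p m s k * (x * pminor p m (s - of_nat k))"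
    by (simp only: Suc mult.assoc)
  finally show ?case by (simp only: assms pfall_Suc mult.assoc)
qed (simp add: pfall_0)

lemma pminor_pfall_commute:
  "1 \<le> p \<Longrightarrow> m < N \<Longrightarrow> pminor p m t * pfall p m s k = pfall p m s k * pminor p m t"
  by (rule pfall_commute) (rule pminor_pminor_commute, auto)

definition proj_term :: "nat \<Rightarrow> nat \<Rightarrow> 'k \<Rightarrow> nat \<Rightarrow> 'r" where
  "proj_term p m s k =
     sc ((- 1) ^ ((Suc m + p) * k) / fact k) * (- eshift (Suc m) p) ^ k * pfall p m s k"

text \<open>\<open>(- 1) ^ (Suc m - p)\<close> is the constant of the Weyl relation. For
  \<open>p \<le> m\<close> its exponent has the parity of \<open>Suc m + p\<close>, the
  \<open>i + j\<close> in the factor of the projector.\<close>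

definition proj_coeff :: "nat \<Rightarrow> nat \<Rightarrow> nat \<Rightarrow> 'k" where
  "proj_coeff p m k = (- ((- 1) ^ (Suc m - p))) ^ k / fact k"

lemma proj_coeff_0: "proj_coeff p m 0 = 1"
  by (simp add: proj_coeff_def)

text \<open>Makes the sums over \<open>k\<close> telescope: moving a generator through a
  \<open>k\<close>-fold product yields \<open>k\<close> times the Weyl constant, which turns one
  coefficient into minus the preceding one.\<close>

lemma proj_coeff_Suc:
  "proj_coeff p m (Suc k) * (of_nat (Suc k) * (- 1) ^ (Suc m - p)) = - proj_coeff p m k"
proof -
  have "(fact (Suc k) :: 'k) = of_nat (Suc k) * fact k" by simp
  moreover have "(of_nat (Suc k) :: 'k) \<noteq> 0" "(fact k :: 'k) \<noteq> 0"
    by (simp_all only: of_nat_eq_0_iff fact_nonzero) simp_all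
  ultimately show ?thesis
    unfolding proj_coeff_def by (cases "even (Suc m - p)") (simp_all del: of_nat_Suc fact_Suc)
qed

lemma proj_term_eq:
  assumes "p \<le> m"
  shows "proj_term p m s k = eshift (Suc m) p ^ k * pfall p m s k * sc (proj_coeff p m k)"
proof -
  have 1: "sc (x / fact k) = sc x * sc (1 / fact k)" for x :: 'k
    by (simp flip: sc_mult)
  have "even ((Suc m + p) * k + k) \<longleftrightarrow> even ((Suc m - p) * k + k)"
    using assms by auto
  then have "(- 1) ^ ((Suc m + p) * k + k) = ((- 1) ^ ((Suc m - p) * k + k) :: 'k)"
    by (simp only: minus_one_power_iff)
  then have "(- 1) ^ ((Suc m + p) * k) * (- 1) ^ k = ((- ((- 1) ^ (Suc m - p))) ^ k :: 'k)"
    unfolding power_add power_minus[of "(- 1) ^ (Suc m - p)"] power_mult by (simp add: mult.commute)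
  then have 2: "sc (proj_coeff p m k) = sc ((- 1) ^ ((Suc m + p) * k) / fact k) * (- 1) ^ k"
    unfolding proj_coeff_def sc_minus_one_power[of k, symmetric] by (simp flip: sc_mult)
  define x where "x = (- 1) ^ ((Suc m + p) * k) / (fact k :: 'k)"
  show ?thesis
    unfolding 2 proj_term_def power_minus[of "eshift (Suc m) p"] x_def[symmetric]
    using sc_commute[of "eshift (Suc m) p ^ k * pfall p m s k" x]
    by (cases "even k") (simp_all add: mult.assoc)
qed

end

section \<open>The factors of the projector\<close>

locale whit_module = gl_module sc e N ac
  for sc :: "'k::field_char_0 \<Rightarrow> 'r::ring_1" and e N and ac :: "'w::ab_group_add \<Rightarrow> 'r \<Rightarrow> 'w" (infixl "\<rhd>" 75) +
  assumes eshift_nilpotent: "\<lbrakk>1 \<le> b; b < a; a \<le> N\<rbrakk> \<Longrightarrow> \<exists>n. v \<rhd> eshift a b ^ n = 0"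
begin

lemma ac_power_zero: "v \<rhd> x ^ n = 0 \<Longrightarrow> n \<le> k \<Longrightarrow> v \<rhd> x ^ k = 0"
proof -
  assume "v \<rhd> x ^ n = 0" "n \<le> k"
  have "v \<rhd> x ^ k = v \<rhd> x ^ n \<rhd> x ^ (k - n)"
    using \<open>n \<le> k\<close> by (simp flip: ac_mult power_add)
  with \<open>v \<rhd> x ^ n = 0\<close> show ?thesis by (simp add: ac_zero)
qed

lemma Sum_any_nilpotent:
  fixes n :: nat
  assumes "\<And>k. n \<le> k \<Longrightarrow> f k = 0"
  shows "Sum_any f = (\<Sum>k<n. f k :: 'w)"
proof (rule Sum_any.expand_superset)
  show "{k. f k \<noteq> 0} \<subseteq> {..<n}"
  proof
    fix k assume "k \<in> {k. f k \<noteq> 0}"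
    then show "k \<in> {..<n}" using assms[of k] by (cases "n \<le> k") auto
  qed
qed simp

definition proj_op :: "nat \<Rightarrow> nat \<Rightarrow> 'k \<Rightarrow> 'w \<Rightarrow> 'w" where
  "proj_op p m s v = Sum_any (\<lambda>k. v \<rhd> proj_term p m s k)"

abbreviation proj_summand :: "nat \<Rightarrow> nat \<Rightarrow> 'k \<Rightarrow> 'w \<Rightarrow> nat \<Rightarrow> 'w" where
  "proj_summand p m s v k \<equiv> v \<rhd> eshift (Suc m) p ^ k \<rhd> pfall p m s k \<rhd> sc (proj_coeff p m k)"

lemma ac_proj_term:
  assumes "p \<le> m"
  shows "v \<rhd> proj_term p m s k =
    proj_summand p m s v k"
  by (simp add: proj_term_eq[OF assms] ac_mult)

lemma proj_op_eq_sum: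
  assumes "p \<le> m" "v \<rhd> eshift (Suc m) p ^ n = 0" "n \<le> n'"
  shows "proj_op p m s v =
    (\<Sum>k<n'. proj_summand p m s v k)"
  unfolding proj_op_def ac_proj_term[OF assms(1)]
proof (rule Sum_any_nilpotent)
  fix k assume "n' \<le> k"
  then have "v \<rhd> eshift (Suc m) p ^ k = 0"
    using ac_power_zero[OF assms(2)] assms(3) by simp
  then show "proj_summand p m s v k = 0"
    by (simp add: ac_zero)
qed

text \<open>One bound serves all parameters and all longer sums, so the values at several vectors
  can be written as sums of a common length.\<close>

lemma proj_op_bound:
  assumes "1 \<le> p" "p \<le> m" "m < N"
  shows "\<exists>n. (\<forall>n'\<ge>n. \<forall>s. proj_op p m s v =
    (\<Sum>k<n'. proj_summand p m s v k)) \<and>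
    (\<forall>k\<ge>n. v \<rhd> eshift (Suc m) p ^ k = 0)"
proof -
  obtain n where n: "v \<rhd> eshift (Suc m) p ^ n = 0"
    using eshift_nilpotent[of p "Suc m" v] assms by auto
  show ?thesis
    using proj_op_eq_sum[OF assms(2) n] ac_power_zero[OF n] by blast
qed

lemma proj_op_add:
  assumes "1 \<le> p" "p \<le> m" "m < N"
  shows "proj_op p m s (v + w) = proj_op p m s v + proj_op p m s w"
proof -
  obtain n1 where n1': "\<forall>n'\<ge>n1. \<forall>s. proj_op p m s v =
    (\<Sum>k<n'. proj_summand p m s v k)"
    using proj_op_bound[OF assms, of v] by blast
  note n1 = n1'[rule_format]
  obtain n2 where n2': "\<forall>n'\<ge>n2. \<forall>s. proj_op p m s w =
    (\<Sum>k<n'. proj_summand p m s w k)"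
    using proj_op_bound[OF assms, of w] by blast
  note n2 = n2'[rule_format]
  obtain n3 where n3': "\<forall>n'\<ge>n3. \<forall>s. proj_op p m s (v + w) =
    (\<Sum>k<n'. proj_summand p m s (v + w) k)"
    using proj_op_bound[OF assms, of "v + w"] by blast
  note n3 = n3'[rule_format]
  let ?n = "max n1 (max n2 n3)"
  show ?thesis
    by (simp add: n1[of ?n] n2[of ?n] n3[of ?n] ac_add_left sum.distrib)
qed

text \<open>The parameters on the two sides may differ, as \<open>proj_op_diag_shift\<close>
  requires.\<close>

lemma proj_op_intertwine:
  assumes pm: "1 \<le> p" "p \<le> m" "m < N"
    and add: "\<And>v w. \<phi> (v + w) = \<phi> v + \<phi> w"
    and comm: "\<And>k. \<phi> (proj_summand p m s v k)
      = w \<rhd> eshift (Suc m) p ^ k \<rhd> pfall p m s' k \<rhd> sc (proj_coeff p m k)"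
  shows "\<phi> (proj_op p m s v) = proj_op p m s' w"
proof -
  have zero: "\<phi> 0 = 0" using add[of 0 0] by simp
  have sum: "\<phi> (sum f S) = (\<Sum>i\<in>S. \<phi> (f i))" for f and S :: "nat set"
    by (induction S rule: infinite_finite_induct) (simp_all add: zero add)
  obtain n1 where n1': "\<forall>n'\<ge>n1. \<forall>s. proj_op p m s v =
    (\<Sum>k<n'. proj_summand p m s v k)"
    using proj_op_bound[OF pm, of v] by blast
  note n1 = n1'[rule_format]
  obtain n2 where n2': "\<forall>n'\<ge>n2. \<forall>s. proj_op p m s w =
    (\<Sum>k<n'. proj_summand p m s w k)"
    using proj_op_bound[OF pm, of w] by blast
  note n2 = n2'[rule_format]
  show ?thesis
    by (simp add: n1[of "max n1 n2"] n2[of "max n1 n2"] sum comm)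
qed

lemma proj_op_commute:
  assumes pm: "1 \<le> p" "p \<le> m" "m < N"
    and x: "x * eshift (Suc m) p = eshift (Suc m) p * x" "\<And>t. x * pminor p m t = pminor p m t * x"
  shows "proj_op p m s (v \<rhd> x) = proj_op p m s v \<rhd> x"
proof (rule proj_op_intertwine[OF pm, symmetric])
  fix k
  have 1: "x * eshift (Suc m) p ^ k = eshift (Suc m) p ^ k * x"
    using power_commuting_commutes[OF x(1)[symmetric], of k] by simp
  have 2: "x * pfall p m s k = pfall p m s k * x"
    by (rule pfall_commute[OF x(2)])
  have "v \<rhd> x \<rhd> eshift (Suc m) p ^ k = v \<rhd> eshift (Suc m) p ^ k \<rhd> x"
    by (simp only: ac_mult[symmetric] 1)
  moreover have "y \<rhd> x \<rhd> pfall p m s k = y \<rhd> pfall p m s k \<rhd> x" for y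
    by (simp only: ac_mult[symmetric] 2)
  moreover have "y \<rhd> x \<rhd> sc c = y \<rhd> sc c \<rhd> x" for y c
    by (simp only: ac_mult[symmetric] sc_commute)
  ultimately show "proj_summand p m s v k \<rhd> x =
    v \<rhd> x \<rhd> eshift (Suc m) p ^ k \<rhd> pfall p m s k \<rhd> sc (proj_coeff p m k)" by simp
qed (simp add: ac_add_left)

lemma proj_op_sc:
  assumes "1 \<le> p" "p \<le> m" "m < N"
  shows "proj_op p m s (v \<rhd> sc c) = proj_op p m s v \<rhd> sc c"
  by (rule proj_op_commute[OF assms]) (simp_all only: sc_commute)

lemma proj_op_fixed:
  assumes "p \<le> m" "v \<rhd> eshift (Suc m) p = 0"
  shows "proj_op p m s v = v"
proof -
  have "v \<rhd> eshift (Suc m) p ^ 1 = 0" using assms by simp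
  from proj_op_eq_sum[OF assms(1) this order.refl, of s] show ?thesis
    by (simp add: ac_one pfall_0 proj_coeff_0 sc_one)
qed

lemma wspace_0: "wspace p m s 0"
  by (simp add: wspace_def whit_def ac_zero)

lemma wspace_add: "wspace p m s v \<Longrightarrow> wspace p m s w \<Longrightarrow> wspace p m s (v + w)"
  by (simp add: wspace_def whit_def ac_add_left)

lemma wspace_sum: "(\<And>i. i \<in> S \<Longrightarrow> wspace p m s (f i)) \<Longrightarrow> wspace p m s (sum f S)"
  by (induction S rule: infinite_finite_induct) (auto intro: wspace_0 wspace_add)

lemma wspace_sc:
  assumes "wspace p m s v" shows "wspace p m s (v \<rhd> sc c)"
proof -
  have "v \<rhd> sc c \<rhd> x = v \<rhd> x \<rhd> sc c" for x
    by (simp only: ac_mult[symmetric] sc_commute)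
  then show ?thesis using assms by (simp add: wspace_def whit_def ac_zero)
qed

lemma whit_empty: "whit p p v"
  by (auto simp: whit_def)

lemma wspace_empty: "wspace p p s v"
  by (auto simp: wspace_def whit_empty)

context
  fixes p m :: nat
  assumes pm: "1 \<le> p" "p \<le> m" "m < N"
begin

lemma wspace_power: "wspace p m s v \<Longrightarrow> wspace p m (s - of_nat k) (v \<rhd> eshift (Suc m) p ^ k)"
proof (induction k)
  case (Suc k)
  have "wspace p m (s - of_nat k - 1) (v \<rhd> eshift (Suc m) p ^ k \<rhd> eshift (Suc m) p)"
    by (rule wspace_eshift[OF Suc.IH[OF Suc.prems]]) (use pm in auto)
  moreover have "s - of_nat k - 1 = s - of_nat (Suc k)" by simp
  moreover have "v \<rhd> eshift (Suc m) p ^ k \<rhd> eshift (Suc m) p = v \<rhd> eshift (Suc m) p ^ Suc k"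
    by (simp only: power_Suc2 ac_mult)
  ultimately show ?case by (simp only:)
qed (simp add: ac_one)

lemma pfall_Suc_last: "pfall p m s (Suc k) = pminor p m (s - of_nat k) * pfall p m s k"
  unfolding pfall_Suc by (rule pminor_pfall_commute[symmetric]) (use pm in auto)

lemma wspace_pfall: "wspace p m (s - of_nat k) y \<Longrightarrow> wspace p m s (y \<rhd> pfall p m s k)"
proof (induction k arbitrary: y)
  case (Suc k)
  have "s - of_nat (Suc k) + 1 = s - of_nat k" by simp
  then have "wspace p m (s - of_nat k) (y \<rhd> pminor p m (s - of_nat k))"
    using wspace_pminor[OF Suc.prems] pm by simp
  then show ?case
    unfolding pfall_Suc_last ac_mult by (rule Suc.IH)
qed (simp add: pfall_0 ac_one)

lemma wspace_proj_op:
  assumes "wspace p m s v" shows "wspace p m s (proj_op p m s v)"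
proof -
  obtain n where n': "\<forall>n'\<ge>n. \<forall>s. proj_op p m s v =
    (\<Sum>k<n'. proj_summand p m s v k)"
    using proj_op_bound[OF pm, of v] by blast
  from n'[rule_format, OF order.refl, of s] show ?thesis
    by (simp only:) (intro wspace_sum wspace_sc wspace_pfall wspace_power assms)
qed

text \<open>The Leibniz rule for the Weyl relation. The product is reordered so that its lowest
  parameter acts first, which is why \<open>y\<close> starts in \<open>V (s - k)\<close>. At
  \<open>k = 0\<close> the index \<open>k - 1\<close> is harmless because the scalar is 0.\<close>

lemma pfall_eshift:
  assumes "wspace p m (s - of_nat k) y" "m < a" "a \<le> N"
  shows "y \<rhd> pfall p m s k \<rhd> eshift a p = y \<rhd> eshift a p \<rhd> pfall p m (s - 1) k +
    (if a = Suc m then y \<rhd> pfall p m (s - 1) (k - 1) \<rhd> sc (of_nat k * (- 1) ^ (Suc m - p)) else 0)"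
  using assms(1)
proof (induction k arbitrary: y)
  case 0
  then show ?case by (simp add: pfall_0 ac_one sc_zero ac_zero)
next
  case (Suc k)
  let ?eps = "(- 1) ^ (Suc m - p) :: 'k" and ?t = "s - of_nat k"
  let ?y = "y \<rhd> pminor p m ?t"
  have t: "s - of_nat (Suc k) + 1 = ?t" "s - of_nat (Suc k) = ?t - 1" by simp_all
  have wy: "wspace p m ?t ?y"
    using wspace_pminor[OF Suc.prems] pm t by simp
  have yA: "?y \<rhd> eshift a p = y \<rhd> eshift a p \<rhd> pminor p m (?t - 1) +
      (if a = Suc m then y \<rhd> sc ?eps else 0)"
    using wspace_pminor_eshift[OF Suc.prems pm(1,2) assms(2,3)] unfolding t(1) unfolding t(2)
    by (simp add: sc_minus_one_power)
  have "y \<rhd> pfall p m s (Suc k) \<rhd> eshift a p = ?y \<rhd> pfall p m s k \<rhd> eshift a p"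
    by (simp only: pfall_Suc_last ac_mult)
  also have "\<dots> = ?y \<rhd> eshift a p \<rhd> pfall p m (s - 1) k +
    (if a = Suc m then ?y \<rhd> pfall p m (s - 1) (k - 1) \<rhd> sc (of_nat k * ?eps) else 0)"
    by (rule Suc.IH[OF wy])
  also have "?y \<rhd> eshift a p \<rhd> pfall p m (s - 1) k =
     y \<rhd> eshift a p \<rhd> pminor p m (?t - 1) \<rhd> pfall p m (s - 1) k +
      (if a = Suc m then y \<rhd> pfall p m (s - 1) k \<rhd> sc ?eps else 0)"
  proof -
    have "y \<rhd> sc ?eps \<rhd> pfall p m (s - 1) k = y \<rhd> pfall p m (s - 1) k \<rhd> sc ?eps"
      by (simp only: ac_mult[symmetric] sc_commute)
    then show ?thesis unfolding yA by (simp add: ac_add_left ac_zero)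
  qed
  also have "y \<rhd> eshift a p \<rhd> pminor p m (?t - 1) \<rhd> pfall p m (s - 1) k =
      y \<rhd> eshift a p \<rhd> pfall p m (s - 1) (Suc k)"
  proof -
    have "?t - 1 = s - 1 - of_nat k" by simp
    then show ?thesis by (simp only: pfall_Suc_last ac_mult)
  qed
  also have "?y \<rhd> pfall p m (s - 1) (k - 1) \<rhd> sc (of_nat k * ?eps) =
     y \<rhd> pfall p m (s - 1) k \<rhd> sc (of_nat k * ?eps)"
  proof (cases k)
    case (Suc l)
    have "?t = s - 1 - of_nat l" using Suc by simp
    then show ?thesis using Suc by (simp only: pfall_Suc_last ac_mult) simp
  qed (simp add: sc_zero ac_zero)
  finally show ?case
    by (simp add: sc_add distrib_right ac_add add.assoc add.commute)
qed

text \<open>For rows beyond \<open>Suc m\<close> the Weyl constant is absent, so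
  \<open>eshift a p\<close> slides through every summand and only lowers the parameter of the
  minors.\<close>

lemma proj_op_eshift:
  assumes "wspace p m s v" "Suc m < a" "a \<le> N" "\<And>n'. n \<le> n' \<Longrightarrow> proj_op p m s v =
    (\<Sum>k<n'. proj_summand p m s v k)"
  shows "proj_op p m s v \<rhd> eshift a p =
    (\<Sum>k<n. v \<rhd> eshift (Suc m) p ^ k \<rhd> eshift a p \<rhd> pfall p m (s - 1) k \<rhd> sc (proj_coeff p m k))"
proof -
  have "v \<rhd> eshift (Suc m) p ^ k \<rhd> pfall p m s k \<rhd> sc c \<rhd> eshift a p =
      v \<rhd> eshift (Suc m) p ^ k \<rhd> eshift a p \<rhd> pfall p m (s - 1) k \<rhd> sc c" for k c
    using pfall_eshift[OF wspace_power[OF assms(1), of k], of a] assms(2,3)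
    by (simp add: ac_sc_right)
  then show ?thesis
    unfolding assms(4)[OF order.refl] sum_ac by simp
qed

text \<open>The summands contribute \<open>h k - h (k - 1)\<close>, and the last \<open>h\<close>
  contains a power that already annihilates \<open>v\<close>.\<close>

lemma proj_op_A:
  assumes "wspace p m s v"
  shows "proj_op p m s v \<rhd> eshift (Suc m) p = 0"
proof -
  obtain n where n': "\<forall>n'\<ge>n. \<forall>s. proj_op p m s v =
    (\<Sum>k<n'. proj_summand p m s v k)"
    "\<forall>k\<ge>n. v \<rhd> eshift (Suc m) p ^ k = 0"
    using proj_op_bound[OF pm, of v] by blast
  note n = n'[rule_format]
  define h where "h k = v \<rhd> eshift (Suc m) p ^ Suc k \<rhd> pfall p m (s - 1) k \<rhd> sc (proj_coeff p m k)" for k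
  have step: "proj_summand p m s v k \<rhd> eshift (Suc m) p =
      h k - (if k = 0 then 0 else h (k - 1))" for k
  proof -
    have "proj_summand p m s v k \<rhd> eshift (Suc m) p =
      (v \<rhd> eshift (Suc m) p ^ k \<rhd> eshift (Suc m) p \<rhd> pfall p m (s - 1) k + v \<rhd> eshift (Suc m) p ^ k \<rhd> pfall p m (s - 1) (k - 1) \<rhd>
       sc (of_nat k * (- 1) ^ (Suc m - p))) \<rhd> sc (proj_coeff p m k)"
      using pfall_eshift[OF wspace_power[OF assms, of k], of "Suc m"] pm by (simp add: ac_sc_right)
    also have "\<dots> = h k + v \<rhd> eshift (Suc m) p ^ k \<rhd> pfall p m (s - 1) (k - 1) \<rhd>
       sc (proj_coeff p m k * (of_nat k * (- 1) ^ (Suc m - p)))"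
    proof -
      have "v \<rhd> eshift (Suc m) p ^ k \<rhd> eshift (Suc m) p = v \<rhd> eshift (Suc m) p ^ Suc k" by (simp only: ac_mult[symmetric] power_Suc2)
      then show ?thesis
        by (simp only: h_def ac_add_left mult.commute[of "proj_coeff p m k"] sc_mult ac_mult)
    qed
    also have "\<dots> = h k - (if k = 0 then 0 else h (k - 1))"
    proof (cases k)
      case (Suc l)
      show ?thesis
        unfolding Suc proj_coeff_Suc sc_minus h_def by (simp add: ac_minus)
    qed (simp add: sc_zero ac_zero)
    finally show ?thesis .
  qed
  have tel: "(\<Sum>k<Suc j. h k - (if k = 0 then 0 else h (k - 1))) = h j" for j
    by (induction j) simp_all
  have "proj_op p m s v \<rhd> eshift (Suc m) p = (\<Sum>k<Suc n. h k - (if k = 0 then 0 else h (k - 1)))"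
    using n(1)[of "Suc n" s] by (simp only: sum_ac step le_SucI order.refl)
  also have "\<dots> = 0"
    unfolding tel unfolding h_def using n(2)[of "Suc n"] by (simp only: ac_zero le_SucI order.refl)
  finally show ?thesis .
qed

text \<open>For a row below \<open>Suc m\<close>, this is the one relation that the space for
  \<open>m + 1\<close> adds: column \<open>m\<close> of the recursion. Moving
  \<open>eshift a (Suc m)\<close> to the left through the powers leaves \<open>eshift a p\<close>
  with a factor \<open>k\<close>. Shifting the index then splits off a minor with parameter
  \<open>s\<close>, and \<open>wspace_eshift_pminor\<close> identifies the result.\<close>

lemma proj_op_next:
  assumes w: "wspace p m s v" and a: "Suc m < a" "a \<le> N" and 0: "v \<rhd> eshift a (Suc m) = 0"
  shows "proj_op p m s v \<rhd> eshift a (Suc m) = hess_next p m a s (proj_op p m s v)"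
proof -
  let ?eps = "(- 1) ^ (Suc m - p) :: 'k"
  obtain n where n': "\<forall>n'\<ge>n. \<forall>s. proj_op p m s v =
    (\<Sum>k<n'. proj_summand p m s v k)"
    "\<forall>k\<ge>n. v \<rhd> eshift (Suc m) p ^ k = 0"
    using proj_op_bound[OF pm, of v] by blast
  note n = n'[rule_format]
  have Suc_m: "Suc m < N" using a by simp
  have Ap: "eshift (Suc m) p * eshift a p = eshift a p * eshift (Suc m) p"
    by (rule eshift_mult_commute, rule eshift_mult_commute[symmetric], rule e_e_commute) (use pm a in auto)
  have comm: "eshift (Suc m) p ^ k * eshift a (Suc m) = eshift a (Suc m) * eshift (Suc m) p ^ k - of_nat k * (eshift (Suc m) p ^ (k - 1) * eshift a p)" for k
  proof (induction k)
    case (Suc k)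
    have "e a (Suc m) * e (Suc m) p = e (Suc m) p * e a (Suc m) + e a p"
      using e_commute[of a "Suc m" "Suc m" p] pm a Suc_m by simp
    moreover have "eshift a p = e a p" using pm a by (intro eshift_eq_e) auto
    ultimately have AE: "eshift (Suc m) p * eshift a (Suc m) = eshift a (Suc m) * eshift (Suc m) p - eshift a p"
      by (auto simp: eshift_def algebra_simps)
    have c: "of_nat k * x = x * of_nat k" for x :: 'r by (rule mult_of_nat_commute)
    have "eshift (Suc m) p ^ Suc k * eshift a (Suc m) = eshift (Suc m) p ^ k * (eshift (Suc m) p * eshift a (Suc m))"
      by (simp only: power_Suc2 mult.assoc)
    also have "\<dots> = eshift (Suc m) p ^ k * eshift a (Suc m) * eshift (Suc m) p - eshift (Suc m) p ^ k * eshift a p"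
      by (simp only: AE right_diff_distrib mult.assoc)
    also have "\<dots> = eshift a (Suc m) * eshift (Suc m) p ^ Suc k - of_nat k * (eshift (Suc m) p ^ (k - 1) * eshift a p * eshift (Suc m) p) - eshift (Suc m) p ^ k * eshift a p"
      unfolding Suc by (simp only: left_diff_distrib mult.assoc power_Suc2)
    also have "of_nat k * (eshift (Suc m) p ^ (k - 1) * eshift a p * eshift (Suc m) p) = of_nat k * (eshift (Suc m) p ^ k * eshift a p)"
      by (cases k) (simp_all only: power_Suc2 mult.assoc Ap diff_Suc_1, simp)
    finally show ?case by (simp add: algebra_simps)
  qed simp
  have D: "eshift a (Suc m) * pminor p m t = pminor p m t * eshift a (Suc m)" for t
    by (rule eshift_mult_commute, rule e_pminor_commute_disjoint) (use pm a Suc_m in auto)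
  have summand: "proj_summand p m s v k \<rhd> eshift a (Suc m) =
    - (v \<rhd> eshift (Suc m) p ^ (k - 1) \<rhd> eshift a p \<rhd> pfall p m s k \<rhd> sc (proj_coeff p m k * of_nat k))" for k
  proof -
    have "proj_summand p m s v k \<rhd> eshift a (Suc m) =
       v \<rhd> (eshift (Suc m) p ^ k * eshift a (Suc m)) \<rhd> pfall p m s k \<rhd> sc (proj_coeff p m k)"
    proof -
      have "y \<rhd> pfall p m s k \<rhd> eshift a (Suc m) = y \<rhd> eshift a (Suc m) \<rhd> pfall p m s k" for y
        by (simp only: ac_mult[symmetric] pfall_commute[OF D])
      then show ?thesis
        by (simp only: ac_sc_right[of _ _ "eshift a (Suc m)"] ac_mult)
    qed
    also have "v \<rhd> (eshift (Suc m) p ^ k * eshift a (Suc m)) = - (v \<rhd> eshift (Suc m) p ^ (k - 1) \<rhd> eshift a p \<rhd> sc (of_nat k))"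
    proof -
      have "sc (of_nat k) = of_nat k"
        by (induction k) (simp_all add: sc_zero sc_add sc_one)
      then show ?thesis
        unfolding comm by (simp add: ac_diff ac_mult 0 ac_zero mult_of_nat_commute)
    qed
    finally show ?thesis
      by (simp only: ac_minus mult.commute[of "proj_coeff p m k"] sc_mult ac_mult
          ac_sc_right[of _ "of_nat k" "pfall p m s k"])
  qed
  have "proj_op p m s v \<rhd> eshift a (Suc m) =
     (\<Sum>k<Suc n. - (v \<rhd> eshift (Suc m) p ^ (k - 1) \<rhd> eshift a p \<rhd> pfall p m s k \<rhd> sc (proj_coeff p m k * of_nat k)))"
    using n(1)[of "Suc n" s] by (simp only: sum_ac summand le_SucI order.refl)
  also have "\<dots> = (\<Sum>k<n. - (v \<rhd> eshift (Suc m) p ^ k \<rhd> eshift a p \<rhd> pfall p m s (Suc k) \<rhd>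
      sc (proj_coeff p m (Suc k) * of_nat (Suc k))))"
    by (subst sum.lessThan_Suc_shift) (simp add: sc_zero ac_zero del: of_nat_Suc)
  also have "\<dots> = (\<Sum>k<n. v \<rhd> eshift (Suc m) p ^ k \<rhd> eshift a p \<rhd> pfall p m (s - 1) k \<rhd> sc (proj_coeff p m k)
      \<rhd> pminor p m s \<rhd> sc ?eps)"
  proof (rule sum.cong[OF refl])
    fix k
    have "?eps * ?eps = 1" by (simp add: minus_one_power_iff)
    then have "proj_coeff p m (Suc k) * of_nat (Suc k) =
        (proj_coeff p m (Suc k) * (of_nat (Suc k) * ?eps)) * ?eps"
      by (simp only: mult.assoc mult_1_right)
    also have "\<dots> = - (proj_coeff p m k * ?eps)"
      unfolding proj_coeff_Suc by simp
    finally have c: "proj_coeff p m (Suc k) * of_nat (Suc k) = - (proj_coeff p m k * ?eps)" .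
    have "pfall p m s (Suc k) = pfall p m (s - 1) k * pminor p m s"
      unfolding pfall_Suc_first by (rule pminor_pfall_commute) (use pm in auto)
    then show "- (v \<rhd> eshift (Suc m) p ^ k \<rhd> eshift a p \<rhd> pfall p m s (Suc k) \<rhd> sc (proj_coeff p m (Suc k) * of_nat (Suc k)))
      = v \<rhd> eshift (Suc m) p ^ k \<rhd> eshift a p \<rhd> pfall p m (s - 1) k \<rhd> sc (proj_coeff p m k) \<rhd> pminor p m s \<rhd> sc ?eps"
      unfolding c sc_minus ac_minus minus_minus sc_mult ac_mult
      by (simp only: ac_mult ac_sc_right[of _ _ "pminor p m s"])
  qed
  also have "\<dots> = proj_op p m s v \<rhd> eshift a p \<rhd> pminor p m s \<rhd> sc ?eps"
    using proj_op_eshift[OF w a n(1)[of _ s]] by (simp only: sum_ac)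
  also have "\<dots> = hess_next p m a s (proj_op p m s v)"
  proof -
    have "proj_op p m s v \<rhd> eshift a p \<rhd> pminor p m s =
        hess_next p m a s (proj_op p m s v) \<rhd> (- 1) ^ (Suc m - p)"
      by (rule wspace_eshift_pminor[OF wspace_proj_op[OF w] pm(1,2)]) (use a in auto)
    then show ?thesis
      by (simp only: sc_minus_one_power) (simp only: ac_mult[symmetric] minus_one_power_square ac_one)
  qed
  finally show ?thesis .
qed

lemma wspace_proj_op_Suc:
  assumes w: "wspace p m s v" and 0: "\<And>a. Suc m < a \<Longrightarrow> a \<le> N \<Longrightarrow> v \<rhd> eshift a (Suc m) = 0"
  shows "wspace p (Suc m) s (proj_op p m s v)"
proof -
  let ?v = "proj_op p m s v"
  have wv: "wspace p m s ?v" by (rule wspace_proj_op[OF w])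
  \<comment> \<open>Column \<open>p\<close> is killed by the Weyl projector; the recursion for row
    \<open>Suc m\<close> passes the vanishing on from column to column.\<close>
  have last: "?v \<rhd> eshift (Suc m) b = 0" if "p \<le> b" "b \<le> m" for b
    using that
  proof (induction b rule: less_induct)
    case (less b)
    show ?case
    proof (cases "b = p")
      case True
      then show ?thesis using proj_op_A[OF w] by simp
    next
      case False
      then obtain c where b: "b = Suc c" "p \<le> c" "c < m" using less.prems by (cases b) auto
      have "?v \<rhd> e (Suc m) d = 0" if "d \<in> {p..c}" for d
        using less.IH[of d] that b eshift_eq_e[of "Suc m" d] by simp
      then have "?v \<rhd> hess_rel p (Suc m) c s = ?v \<rhd> eshift (Suc m) b"
        by (simp add: hess_rel_def ac_add ac_sum ac_mult ac_zero b(1))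
      moreover have "?v \<rhd> hess_rel p (Suc m) c s = 0"
        using wv b pm by (auto simp: wspace_def)
      ultimately show ?thesis by simp
    qed
  qed
  show ?thesis
    unfolding wspace_def
  proof (intro conjI allI impI)
    show "whit p (Suc m) ?v"
      unfolding whit_def
    proof (intro allI impI)
      fix a b assume ab: "p \<le> b \<and> b < a \<and> a \<le> Suc m"
      show "?v \<rhd> eshift a b = 0"
        using ab wv last[of b] by (cases "a = Suc m") (auto simp: wspace_def whit_def)
    qed
    fix a c assume ac: "p \<le> c \<and> c < Suc m \<and> Suc m < a \<and> a \<le> N"
    show "?v \<rhd> hess_rel p a c s = 0"
    proof (cases "c = m")
      case True
      have "?v \<rhd> eshift a (Suc m) = - (\<Sum>b\<in>{p..m}. ?v \<rhd> eshift a b \<rhd> ell b m (s - of_nat (m - p)))"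
        using proj_op_next[OF w _ _ 0] ac by (simp add: hess_next_def)
      also have "\<dots> = - (\<Sum>b\<in>{p..m}. ?v \<rhd> (e a b * ell b m (s - of_nat (m - p))))"
        using ac by (intro arg_cong[of _ _ uminus] sum.cong refl) (auto simp: ac_mult eshift_eq_e)
      finally show ?thesis
        unfolding True hess_rel_def ac_add ac_sum by simp
    next
      case False
      then show ?thesis using wv ac by (auto simp: wspace_def)
    qed
  qed
qed

end

section \<open>Additive maps that vanish on Borel generators, and the kernel of a factor\<close>

context
  fixes p m :: nat
  assumes pm: "1 \<le> p" "p \<le> m" "m < N"
begin

lemma whit_power:
  assumes "whit p m v" shows "whit p m (v \<rhd> eshift (Suc m) p ^ k)"
proof (rule whit_ac[OF assms])
  fix a b assume "p \<le> b" "b < a" "a \<le> m"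
  then have "eshift (Suc m) p * e a b = e a b * eshift (Suc m) p"
    by (intro eshift_mult_commute e_e_commute) (use pm in auto)
  then show "eshift (Suc m) p ^ k * e a b = e a b * eshift (Suc m) p ^ k"
    by (rule power_commuting_commutes)
qed

lemma whit_pfall:
  assumes "whit p m v" shows "whit p m (v \<rhd> pfall p m s k)"
proof (rule whit_ac[OF assms])
  fix a b assume "p \<le> b" "b < a" "a \<le> m"
  then have "e a b * pminor p m t = pminor p m t * e a b" for t
    by (intro e_pminor_commute) (use pm in auto)
  then show "pfall p m s k * e a b = e a b * pfall p m s k"
    by (simp add: pfall_commute)
qed

lemma whit_sc: "whit p m v \<Longrightarrow> whit p m (v \<rhd> sc c)"
  by (erule whit_ac) (simp only: sc_commute)

text \<open>Expanding along the top row gives terms \<open>ell p c\<close> times a minor of the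
  block after \<open>c\<close>. The two commute, so each term can end in \<open>ell p c\<close>. For
  \<open>c = p\<close> its parameter is exactly \<open>s\<close>, and for \<open>c > p\<close> it is
  just \<open>e p c\<close>.\<close>

lemma functional_pminor:
  assumes add: "\<And>v w. Q (v + w) = Q v + (Q w :: 'w)"
    and diag: "\<And>y. Q (y \<rhd> ell p p s) = 0"
    and row: "\<And>y c. p < c \<Longrightarrow> c \<le> m \<Longrightarrow> Q (y \<rhd> e p c) = 0"
    and y: "whit p m y"
  shows "Q (y \<rhd> pminor p m s) = 0"
proof -
  have zero: "Q 0 = 0" using add[of 0 0] by simp
  have sum: "Q (sum f S) = (\<Sum>i\<in>S. Q (f i))" for f and S :: "nat set"
    by (induction S rule: infinite_finite_induct) (simp_all add: zero add)
  have "Q (y \<rhd> ((- 1) ^ (c - p) * ell p c (s - of_nat (c - p)) * pminor (Suc c) m t)) = 0"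
    if c: "c \<in> {p..m}" for c t
  proof -
    have "e p c * pminor (Suc c) m t = pminor (Suc c) m t * e p c"
      by (rule e_pminor_commute_disjoint) (use pm c in auto)
    then have "ell p c x * pminor (Suc c) m t = pminor (Suc c) m t * ell p c x" for x
      by (simp add: ell_def distrib_left distrib_right sc_commute[of "pminor (Suc c) m t"])
    then have "y \<rhd> ((- 1) ^ (c - p) * ell p c (s - of_nat (c - p)) * pminor (Suc c) m t)
      = y \<rhd> ((- 1) ^ (c - p) * pminor (Suc c) m t) \<rhd> ell p c (s - of_nat (c - p))"
      by (simp only: ac_mult[symmetric] mult.assoc)
    then show ?thesis
      using diag row[of c] c by (cases "c = p") (auto simp: ell_def)
  qed
  then show ?thesis
    unfolding whit_pminor[OF y pm(2)] sum by simp
qed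

lemma proj_op_functional:
  assumes add: "\<And>v w. Q (v + w) = Q v + (Q w :: 'w)"
    and diag: "\<And>y. Q (y \<rhd> ell p p s) = 0"
    and row: "\<And>y c. p < c \<Longrightarrow> c \<le> m \<Longrightarrow> Q (y \<rhd> e p c) = 0"
    and v: "whit p m v"
  shows "Q (proj_op p m s v) = Q v"
proof -
  have zero: "Q 0 = 0" using add[of 0 0] by simp
  have sum: "Q (sum f S) = (\<Sum>i\<in>S. Q (f i))" for f and S :: "nat set"
    by (induction S rule: infinite_finite_induct) (simp_all add: zero add)
  obtain n where n': "\<forall>n'\<ge>n. \<forall>s. proj_op p m s v =
    (\<Sum>k<n'. proj_summand p m s v k)"
    using proj_op_bound[OF pm, of v] by blast
  have *: "Q (proj_summand p m s v k) = (if k = 0 then Q v else 0)" for k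
  proof (cases k)
    case 0
    then show ?thesis by (simp add: ac_one pfall_0 proj_coeff_0 sc_one)
  next
    case (Suc l)
    \<comment> \<open>The generators are met at parameter \<open>s\<close>, whereas the product ends
      in its lowest parameter. Minors of one block commute, so the one with parameter
      \<open>s\<close> can be put last.\<close>
    have "pfall p m s (Suc l) = pfall p m (s - 1) l * pminor p m s"
      unfolding pfall_Suc_first by (rule pminor_pfall_commute) (use pm in auto)
    then have eq: "v \<rhd> eshift (Suc m) p ^ k \<rhd> pfall p m s k \<rhd> sc c = v \<rhd> eshift (Suc m) p ^ k \<rhd> pfall p m (s - 1) l \<rhd> sc c \<rhd> pminor p m s" for c
      by (simp only: Suc ac_mult ac_sc_right[of _ _ "pminor p m s"])
    have "Q (v \<rhd> eshift (Suc m) p ^ k \<rhd> pfall p m (s - 1) l \<rhd> sc c \<rhd> pminor p m s) = 0" for c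
      by (rule functional_pminor[of Q, OF add diag row whit_sc[OF whit_pfall[OF whit_power[OF v]]]])
    then show ?thesis unfolding eq using Suc by (simp del: power_Suc)
  qed
  have "proj_op p m s v = (\<Sum>k<Suc n. proj_summand p m s v k)"
    by (rule n'[rule_format]) simp
  then have "Q (proj_op p m s v) = (\<Sum>k<Suc n. if k = 0 then Q v else 0)"
    by (simp only: sum *)
  then show ?thesis by (simp del: sum.lessThan_Suc)
qed

lemma pminor_power:
  assumes "wspace p m s y"
  shows "y \<rhd> pminor p m (s + 1) \<rhd> eshift (Suc m) p ^ k = y \<rhd> eshift (Suc m) p ^ k \<rhd> pminor p m (s + 1 - of_nat k) +
    y \<rhd> eshift (Suc m) p ^ (k - 1) \<rhd> sc (of_nat k * (- 1) ^ (Suc m - p))"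
proof (induction k)
  case (Suc k)
  let ?eps = "(- 1) ^ (Suc m - p) :: 'k"
  have t: "s + 1 - of_nat k = s - of_nat k + 1" "s + 1 - of_nat (Suc k) = s - of_nat k" by simp_all
  have "y \<rhd> eshift (Suc m) p ^ k \<rhd> pminor p m (s - of_nat k + 1) \<rhd> eshift (Suc m) p = y \<rhd> eshift (Suc m) p ^ k \<rhd> eshift (Suc m) p \<rhd> pminor p m (s - of_nat k) +
      y \<rhd> eshift (Suc m) p ^ k \<rhd> sc ?eps"
    using wspace_pminor_eshift[OF wspace_power[OF pm assms, of k] pm(1,2), of "Suc m"] pm
    by (simp add: sc_minus_one_power)
  moreover have "y \<rhd> eshift (Suc m) p ^ (k - 1) \<rhd> sc (of_nat k * ?eps) \<rhd> eshift (Suc m) p = y \<rhd> eshift (Suc m) p ^ k \<rhd> sc (of_nat k * ?eps)"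
  proof (cases k)
    case (Suc l)
    then show ?thesis
      by (simp only: ac_sc_right[of _ _ "eshift (Suc m) p"] diff_Suc_1) (simp only: ac_mult[symmetric] power_Suc2)
  qed (simp add: sc_zero ac_zero)
  moreover have "y \<rhd> pminor p m (s + 1) \<rhd> eshift (Suc m) p ^ Suc k = y \<rhd> pminor p m (s + 1) \<rhd> eshift (Suc m) p ^ k \<rhd> eshift (Suc m) p"
    "y \<rhd> eshift (Suc m) p ^ Suc k = y \<rhd> eshift (Suc m) p ^ k \<rhd> eshift (Suc m) p"
    by (simp_all only: power_Suc2 ac_mult)
  ultimately show ?case
    unfolding t using Suc unfolding t
    by (simp add: ac_add_left sc_add ac_add distrib_right add.assoc add.commute)
qed (simp add: ac_one ac_zero sc_zero)

text \<open>The other half of the Weyl projector: the same telescoping with the two generators in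
  exchanged roles.\<close>

lemma proj_op_pminor:
  assumes w: "wspace p m (s - 1) y"
  shows "proj_op p m s (y \<rhd> pminor p m s) = 0"
proof -
  let ?v = "y \<rhd> pminor p m s"
  obtain n1 where n1: "\<forall>n'\<ge>n1. \<forall>s. proj_op p m s ?v =
    (\<Sum>k<n'. proj_summand p m s ?v k)"
    using proj_op_bound[OF pm, of ?v] by blast
  obtain n2 where n2: "\<forall>k\<ge>n2. y \<rhd> eshift (Suc m) p ^ k = 0"
    using proj_op_bound[OF pm, of y] by blast
  define h where "h k = y \<rhd> eshift (Suc m) p ^ k \<rhd> pfall p m s (Suc k) \<rhd> sc (proj_coeff p m k)" for k
  have step: "proj_summand p m s ?v k = h k - (if k = 0 then 0 else h (k - 1))" for k
  proof -
    have "proj_summand p m s ?v k =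
      (y \<rhd> eshift (Suc m) p ^ k \<rhd> pminor p m (s - of_nat k) + y \<rhd> eshift (Suc m) p ^ (k - 1) \<rhd> sc (of_nat k * (- 1) ^ (Suc m - p)))
       \<rhd> pfall p m s k \<rhd> sc (proj_coeff p m k)"
      using pminor_power[OF w, of k] by simp
    also have "\<dots> = h k + y \<rhd> eshift (Suc m) p ^ (k - 1) \<rhd> pfall p m s k \<rhd>
        sc (proj_coeff p m k * (of_nat k * (- 1) ^ (Suc m - p)))"
      by (simp only: h_def ac_add_left mult.commute[of "proj_coeff p m k"] sc_mult[of _ "proj_coeff p m k"]
        ac_mult pfall_Suc_last[OF pm] ac_sc_right[of _ _ "pfall p m s k"])
    also have "\<dots> = h k - (if k = 0 then 0 else h (k - 1))"
    proof (cases k)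
      case (Suc l)
      show ?thesis
        unfolding Suc proj_coeff_Suc sc_minus h_def by (simp add: ac_minus)
    qed (simp add: sc_zero ac_zero)
    finally show ?thesis .
  qed
  have tel: "(\<Sum>k<Suc j. h k - (if k = 0 then 0 else h (k - 1))) = h j" for j
    by (induction j) simp_all
  let ?n = "max n1 n2"
  have "proj_op p m s ?v = (\<Sum>k<Suc ?n. proj_summand p m s ?v k)"
    using n1 by (meson le_SucI max.cobounded1)
  also have "\<dots> = h ?n"
    unfolding step tel ..
  also have "\<dots> = 0"
    unfolding h_def using n2 by (simp add: ac_zero)
  finally show ?thesis .
qed

end

lemma proj_op_ell:
  assumes "1 \<le> n" "n < N"
  shows "proj_op n n s (y \<rhd> ell n n s) = 0"
proof -
  have "pminor n n s = ell n n s"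
    by (simp add: pminor_def pos_sign_singleton)
  then show ?thesis
    using proj_op_pminor[of n n s y] assms wspace_empty by simp
qed

text \<open>\<open>e a n\<close> has weight 1 under \<open>e n n\<close>, so moving it to the right
  past minors of size one changes their parameter by 1.\<close>

lemma proj_op_diag_shift:
  assumes "1 \<le> a" "a < n" "n < N"
  shows "proj_op n n s (y \<rhd> e a n) = proj_op n n (s + 1) y \<rhd> e a n"
proof (rule proj_op_intertwine[symmetric])
  fix k
  have "eshift (Suc n) n * e a n = e a n * eshift (Suc n) n"
    by (rule eshift_mult_commute, rule e_e_commute) (use assms in auto)
  then have 1: "e a n * eshift (Suc n) n ^ k = eshift (Suc n) n ^ k * e a n"
    by (simp add: power_commuting_commutes)
  have D: "e a n * pminor n n t = pminor n n (t + 1) * e a n" for t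
  proof -
    have "e a n * e n n = e n n * e a n + e a n"
      using e_commute[of a n n n] assms by simp
    then show ?thesis
      by (simp add: pminor_def pos_sign_singleton ell_def distrib_left distrib_right sc_add sc_one
        sc_commute[of "e a n"])
  qed
  have 2: "e a n * pfall n n s k = pfall n n (s + 1) k * e a n"
  proof (induction k)
    case (Suc k)
    have "s - of_nat k + 1 = s + 1 - of_nat k" by simp
    then have "pminor n n (s - of_nat k + 1) = pminor n n (s + 1 - of_nat k)" by (simp only:)
    then have "e a n * pminor n n (s - of_nat k) = pminor n n (s + 1 - of_nat k) * e a n"
      using D[of "s - of_nat k"] by simp
    then show ?case
      unfolding pfall_Suc using Suc by (metis mult.assoc)
  qed (simp add: pfall_0)
  have "v \<rhd> sc c \<rhd> e a n = v \<rhd> e a n \<rhd> sc c" for v c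
    by (simp only: ac_mult[symmetric] sc_commute)
  moreover have "v \<rhd> pfall n n (s + 1) k \<rhd> e a n = v \<rhd> e a n \<rhd> pfall n n s k" for v
    by (simp only: ac_mult[symmetric] 2)
  moreover have "v \<rhd> eshift (Suc n) n ^ k \<rhd> e a n = v \<rhd> e a n \<rhd> eshift (Suc n) n ^ k" for v
    by (simp only: ac_mult[symmetric] 1)
  ultimately show "y \<rhd> eshift (Suc n) n ^ k \<rhd> pfall n n (s + 1) k \<rhd> sc (proj_coeff n n k) \<rhd> e a n =
      y \<rhd> e a n \<rhd> eshift (Suc n) n ^ k \<rhd> pfall n n s k \<rhd> sc (proj_coeff n n k)"
    by simp
qed (use assms in \<open>auto simp: ac_add_left\<close>)

lemma proj_op_0: "1 \<le> p \<Longrightarrow> p \<le> m \<Longrightarrow> m < N \<Longrightarrow> proj_op p m s 0 = 0"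
  using proj_op_add[of p m s 0 0] by simp

subsection \<open>The ordered product\<close>

definition col_proj :: "nat \<Rightarrow> nat \<Rightarrow> 'k \<Rightarrow> 'w \<Rightarrow> 'w" where
  "col_proj p m s = fold (\<lambda>i. proj_op p i s) [p..<m]"

lemma col_proj_base: "col_proj p p s v = v"
  by (simp add: col_proj_def)

lemma col_proj_Suc: "p \<le> m \<Longrightarrow> col_proj p (Suc m) s v = proj_op p m s (col_proj p m s v)"
  by (simp add: col_proj_def)

text \<open>The second invariant keeps the Whittaker conditions beyond \<open>m\<close>, which the
  following factor takes as input in \<open>proj_op_next\<close>. For \<open>m = N\<close> no rows
  remain below, and the first invariant reduces to being Whittaker for \<open>p..N\<close>.\<close>

lemma col_proj_wspace:
  assumes "p \<le> m" "1 \<le> p" "m \<le> N" "whit (Suc p) N v"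
  shows "wspace p m s (col_proj p m s v) \<and>
    (\<forall>a b. m < b \<and> b < a \<and> a \<le> N \<longrightarrow> col_proj p m s v \<rhd> eshift a b = 0)"
  using assms(1,3)
proof (induction m rule: dec_induct)
  case base
  then show ?case using assms(4) by (auto simp: col_proj_base wspace_empty whit_def)
next
  case (step m)
  let ?v = "col_proj p m s v"
  have IH: "wspace p m s ?v" "\<And>a b. m < b \<Longrightarrow> b < a \<Longrightarrow> a \<le> N \<Longrightarrow> ?v \<rhd> eshift a b = 0"
    using step by auto
  have m: "m < N" using step by simp
  show ?case
    unfolding col_proj_Suc[OF step.hyps(1)]
  proof (intro conjI allI impI)
    show "wspace p (Suc m) s (proj_op p m s ?v)"
      by (rule wspace_proj_op_Suc) (use IH assms step m in auto)
    fix a b assume ab: "Suc m < b \<and> b < a \<and> a \<le> N"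
    have "proj_op p m s (?v \<rhd> eshift a b) = proj_op p m s ?v \<rhd> eshift a b"
    proof (rule proj_op_commute)
      show "eshift a b * eshift (Suc m) p = eshift (Suc m) p * eshift a b"
        by (rule eshift_mult_commute, rule eshift_mult_commute[symmetric], rule e_e_commute)
          (use assms step ab in auto)
      show "eshift a b * pminor p m t = pminor p m t * eshift a b" for t
        by (rule eshift_mult_commute, rule e_pminor_commute_disjoint) (use assms step ab in auto)
    qed (use assms step m in auto)
    moreover have "?v \<rhd> eshift a b = 0" using IH(2) ab by simp
    ultimately show "proj_op p m s ?v \<rhd> eshift a b = 0"
      using proj_op_0[of p m s] assms step m by simp
  qed
qed

lemma col_proj_add:
  assumes "p \<le> m" "1 \<le> p" "m \<le> N"
  shows "col_proj p m s (v + w) = col_proj p m s v + col_proj p m s w"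
  using assms(1,3)
  by (induction m rule: dec_induct) (use assms in \<open>auto simp: col_proj_base col_proj_Suc proj_op_add\<close>)

lemma col_proj_sc:
  assumes "p \<le> m" "1 \<le> p" "m \<le> N"
  shows "col_proj p m s (v \<rhd> sc c) = col_proj p m s v \<rhd> sc c"
  using assms(1,3)
  by (induction m rule: dec_induct) (use assms in \<open>auto simp: col_proj_base col_proj_Suc proj_op_sc\<close>)

lemma col_proj_fixed:
  assumes "p \<le> m" "m \<le> N" "whit p N v"
  shows "col_proj p m s v = v"
  using assms(1,2)
  by (induction m rule: dec_induct)
    (use assms in \<open>auto simp: col_proj_base col_proj_Suc whit_def intro!: proj_op_fixed\<close>)

lemma col_proj_functional:
  assumes "p \<le> m" "1 \<le> p" "m \<le> N" "whit (Suc p) N v"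
    and add: "\<And>v w. Q (v + w) = Q v + (Q w :: 'w)"
    and diag: "\<And>y. Q (y \<rhd> ell p p s) = 0"
    and row: "\<And>y c. p < c \<Longrightarrow> c < N \<Longrightarrow> Q (y \<rhd> e p c) = 0"
  shows "Q (col_proj p m s v) = Q v"
  using assms(1,3)
proof (induction m rule: dec_induct)
  case base
  then show ?case by (simp add: col_proj_base)
next
  case (step m)
  have "whit p m (col_proj p m s v)"
    using col_proj_wspace[of p m v s] step assms by (auto simp: wspace_def)
  then have "Q (proj_op p m s (col_proj p m s v)) = Q (col_proj p m s v)"
    by (intro proj_op_functional) (use assms step in auto)
  then show ?case using step by (simp add: col_proj_Suc)
qed

text \<open>Columns run from \<open>N - 1\<close> down to \<open>p\<close>, so the input of column
  \<open>p\<close> is already Whittaker for the indices after \<open>p\<close>. The whole projector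
  is \<open>kproj 1\<close>.\<close>

definition kproj :: "nat \<Rightarrow> (nat \<Rightarrow> 'k) \<Rightarrow> 'w \<Rightarrow> 'w" where
  "kproj p u = fold (\<lambda>j. col_proj j N (u j)) (rev [p..<N])"

lemma kproj_base: "kproj N u v = v"
  by (simp add: kproj_def)

lemma kproj_step: "p < N \<Longrightarrow> kproj p u v = col_proj p N (u p) (kproj (Suc p) u v)"
  by (simp add: kproj_def upt_conv_Cons)

lemma kproj_add:
  assumes "p \<le> N" "1 \<le> p" shows "kproj p u (v + w) = kproj p u v + kproj p u w"
  using assms
  by (induction p rule: inc_induct) (simp_all add: kproj_base kproj_step col_proj_add)

lemma kproj_sc:
  assumes "p \<le> N" "1 \<le> p" shows "kproj p u (v \<rhd> sc c) = kproj p u v \<rhd> sc c"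
  using assms
  by (induction p rule: inc_induct) (simp_all add: kproj_base kproj_step col_proj_sc)

lemma kproj_whit:
  assumes "p \<le> N" "1 \<le> p" shows "whit p N (kproj p u v)"
  using assms
proof (induction p rule: inc_induct)
  case base
  show ?case by (rule whit_empty)
next
  case (step p)
  have "whit (Suc p) N (kproj (Suc p) u v)"
    by (rule step.IH) simp
  then have "wspace p N (u p) (col_proj p N (u p) (kproj (Suc p) u v))"
    using col_proj_wspace[of p N "kproj (Suc p) u v" "u p"] step by auto
  then show ?case
    unfolding kproj_step[OF step.hyps(2)] wspace_def by blast
qed

lemma kproj_fixed:
  assumes "p \<le> N" "whit p N v" shows "kproj p u v = v"
  using assms
proof (induction p rule: inc_induct)
  case (step p)
  then show ?case
    using whit_mono[of p N v "Suc p" N] by (simp add: kproj_step col_proj_fixed)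
qed (simp add: kproj_base)

text \<open>Column \<open>p\<close> calls only on generators in row \<open>p\<close>, because its
  minors are expanded along their top row; the later columns call on the lower rows.\<close>

lemma kproj_functional:
  assumes "p \<le> N" "1 \<le> p"
    and add: "\<And>v w. Q (v + w) = Q v + (Q w :: 'w)"
    and gens: "\<And>a b y. p \<le> a \<Longrightarrow> a \<le> b \<Longrightarrow> b < N \<Longrightarrow> Q (y \<rhd> ell a b (u b)) = 0"
  shows "Q (kproj p u v) = Q v"
  using assms(1,2,4)
proof (induction p rule: inc_induct)
  case (step p)
  have "Q (col_proj p N (u p) (kproj (Suc p) u v)) = Q (kproj (Suc p) u v)"
  proof (rule col_proj_functional)
    show "whit (Suc p) N (kproj (Suc p) u v)"
      by (rule kproj_whit) (use step in auto)
    show "Q (y \<rhd> ell p p (u p)) = 0" for y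
      using step.prems(2)[of p p y] step.hyps by simp
    show "Q (y \<rhd> e p c) = 0" if "p < c" "c < N" for y c
      using step.prems(2)[of p c y] that by (simp add: ell_def)
  qed (use step add in auto)
  also have "Q (kproj (Suc p) u v) = Q v"
    by (rule step.IH) (use step.prems in auto)
  finally show ?case using step.hyps by (simp add: kproj_step)
qed (simp add: kproj_base)

end

section \<open>Vanishing on the Borel generators\<close>

lemma power_commute_derivation:
  fixes x y g :: "'r::ring_1"
  assumes "x * y = y * x + g" "g * y = y * g"
  shows "x * y ^ k = y ^ k * x + of_nat k * (g * y ^ (k - 1))"
proof (induction k)
  case (Suc k)
  have "x * y ^ Suc k = x * y ^ k * y" by (simp only: power_Suc2 mult.assoc)
  also have "\<dots> = y ^ k * (x * y) + of_nat k * (g * (y ^ (k - 1) * y))"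
    unfolding Suc by (simp only: distrib_right mult.assoc)
  also have "of_nat k * (g * (y ^ (k - 1) * y)) = of_nat k * (g * y ^ k)"
    by (cases k) (simp_all only: power_Suc2 diff_Suc_1, simp)
  also have "y ^ k * (x * y) = y ^ Suc k * x + y ^ k * g"
    unfolding assms(1) by (simp only: distrib_left power_Suc2 mult.assoc)
  also have "y ^ k * g = g * y ^ k"
    by (rule power_commuting_commutes) (simp only: assms(2))
  finally show ?case by (simp add: algebra_simps)
qed simp

context whit_module
begin

text \<open>
  For \<open>i < n\<close> the pair \<open>e (Suc n) i\<close>, \<open>e i n\<close> satisfies the Heisenberg
  relation up to the factor \<open>e (Suc n) n\<close>, which acts by 1 on Whittaker vectors; \<open>heis_op n i\<close>
  is the corresponding projector.
\<close>

abbreviation heis_summand :: "nat \<Rightarrow> nat \<Rightarrow> 'w \<Rightarrow> nat \<Rightarrow> 'w" where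
  "heis_summand n i v k \<equiv> v \<rhd> e (Suc n) i ^ k \<rhd> e i n ^ k \<rhd> sc (1 / fact k)"

definition heis_op :: "nat \<Rightarrow> nat \<Rightarrow> 'w \<Rightarrow> 'w" where
  "heis_op n i v = Sum_any (heis_summand n i v)"

lemma sc_inverse_fact_Suc: "sc (1 / fact (Suc k)) * of_nat (Suc k) = sc (1 / fact k)"
proof -
  have "sc (of_nat n) = of_nat n" for n
    by (induction n) (simp_all add: sc_zero sc_add sc_one)
  then have "sc (1 / fact (Suc k)) * of_nat (Suc k) = sc (1 / fact (Suc k) * of_nat (Suc k))"
    by (simp only: sc_mult)
  also have "1 / fact (Suc k) * of_nat (Suc k) = (1 / fact k :: 'k)"
  proof -
    have "(of_nat (Suc k) :: 'k) \<noteq> 0" by (simp del: of_nat_Suc)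
    then show ?thesis by (simp add: field_simps del: of_nat_Suc)
  qed
  finally show ?thesis .
qed

context
  fixes n i :: nat
  assumes ni: "1 \<le> i" "i < n" "n < N"
begin

lemma heis_op_bound:
  "\<exists>K. (\<forall>K'\<ge>K. heis_op n i v = (\<Sum>k<K'. heis_summand n i v k)) \<and>
    (\<forall>k\<ge>K. v \<rhd> e (Suc n) i ^ k = 0)"
proof -
  have "eshift (Suc n) i = e (Suc n) i" using ni by (intro eshift_eq_e) auto
  then obtain K where "v \<rhd> e (Suc n) i ^ K = 0"
    using eshift_nilpotent[of i "Suc n" v] ni by auto
  then have K: "v \<rhd> e (Suc n) i ^ k = 0" if "K \<le> k" for k
    using ac_power_zero that by blast
  have "heis_op n i v = (\<Sum>k<K'. heis_summand n i v k)" if "K \<le> K'" for K'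
    unfolding heis_op_def by (rule Sum_any_nilpotent) (use K that in \<open>simp add: ac_zero\<close>)
  then show ?thesis using K by blast
qed

lemma heis_op_add: "heis_op n i (v + w) = heis_op n i v + heis_op n i w"
proof -
  obtain K1 where 1: "\<forall>K'\<ge>K1. heis_op n i v = (\<Sum>k<K'. heis_summand n i v k)"
    using heis_op_bound by blast
  obtain K2 where 2: "\<forall>K'\<ge>K2. heis_op n i w = (\<Sum>k<K'. w \<rhd> e (Suc n) i ^ k \<rhd> e i n ^ k \<rhd> sc (1 / fact k))"
    using heis_op_bound by blast
  obtain K3 where 3: "\<forall>K'\<ge>K3. heis_op n i (v + w) = (\<Sum>k<K'. heis_summand n i (v + w) k)"
    using heis_op_bound by blast
  let ?K = "max K1 (max K2 K3)"
  show ?thesis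
    using 1[rule_format, of ?K] 2[rule_format, of ?K] 3[rule_format, of ?K]
    by (simp add: ac_add_left sum.distrib)
qed

lemma heis_op_0: "heis_op n i 0 = 0"
  using heis_op_add[of 0 0] by simp

lemma heis_op_fixed:
  assumes "v \<rhd> e (Suc n) i = 0" shows "heis_op n i v = v"
proof -
  have "heis_op n i v = (\<Sum>k<1. heis_summand n i v k)"
    unfolding heis_op_def
  proof (rule Sum_any_nilpotent)
    fix k :: nat assume "1 \<le> k"
    moreover have "v \<rhd> e (Suc n) i ^ 1 = 0" using assms by simp
    ultimately have "v \<rhd> e (Suc n) i ^ k = 0" by (rule ac_power_zero[rotated])
    then show "heis_summand n i v k = 0" by (simp add: ac_zero)
  qed
  then show ?thesis by (simp add: ac_one sc_one)
qed

lemma heis_op_commute: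
  assumes "\<And>k. x * (e (Suc n) i ^ k * e i n ^ k) = e (Suc n) i ^ k * e i n ^ k * x"
  shows "heis_op n i (v \<rhd> x) = heis_op n i v \<rhd> x"
proof -
  obtain K1 where 1: "\<forall>K'\<ge>K1. heis_op n i v = (\<Sum>k<K'. heis_summand n i v k)"
    using heis_op_bound by blast
  obtain K2 where 2: "\<forall>K'\<ge>K2. heis_op n i (v \<rhd> x) = (\<Sum>k<K'. v \<rhd> x \<rhd> e (Suc n) i ^ k \<rhd> e i n ^ k \<rhd> sc (1 / fact k))"
    using heis_op_bound by blast
  have "v \<rhd> x \<rhd> e (Suc n) i ^ k \<rhd> e i n ^ k \<rhd> sc c = v \<rhd> e (Suc n) i ^ k \<rhd> e i n ^ k \<rhd> sc c \<rhd> x" for k c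
  proof -
    have "v \<rhd> x \<rhd> e (Suc n) i ^ k \<rhd> e i n ^ k = v \<rhd> (x * (e (Suc n) i ^ k * e i n ^ k))"
      by (simp only: ac_mult)
    also have "\<dots> = v \<rhd> e (Suc n) i ^ k \<rhd> e i n ^ k \<rhd> x"
      unfolding assms by (simp only: ac_mult)
    finally show ?thesis by (simp only: ac_sc_right[of _ _ x])
  qed
  then show ?thesis
    using 1[rule_format, of "max K1 K2"] 2[rule_format, of "max K1 K2"] by (simp add: sum_ac)
qed

lemma heis_op_commute':
  assumes "x * e (Suc n) i = e (Suc n) i * x" "x * e i n = e i n * x"
  shows "heis_op n i (v \<rhd> x) = heis_op n i v \<rhd> x"
proof (rule heis_op_commute)
  fix k
  have 1: "x * e (Suc n) i ^ k = e (Suc n) i ^ k * x" "x * e i n ^ k = e i n ^ k * x"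
    using power_commuting_commutes[OF assms(1)[symmetric], of k]
      power_commuting_commutes[OF assms(2)[symmetric], of k] by simp_all
  have "x * (e (Suc n) i ^ k * e i n ^ k) = x * e (Suc n) i ^ k * e i n ^ k" by (simp only: mult.assoc)
  also have "\<dots> = e (Suc n) i ^ k * (x * e i n ^ k)" by (simp only: 1 mult.assoc)
  finally show "x * (e (Suc n) i ^ k * e i n ^ k) = e (Suc n) i ^ k * e i n ^ k * x"
    by (simp only: 1 mult.assoc)
qed

text \<open>The weights of \<open>e (Suc n) i\<close> and \<open>e i n\<close> under
  \<open>e i i\<close> are opposite, so each product of equal powers has weight 0.\<close>

lemma heis_op_diag: "heis_op n i (v \<rhd> e i i) = heis_op n i v \<rhd> e i i"
proof (rule heis_op_commute)
  fix k
  let ?E = "e (Suc n) i" and ?F = "e i n"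
  have "e i i * ?E = ?E * e i i + - ?E"
    using e_commute[of i i "Suc n" i] ni by simp
  from power_commute_derivation[OF this, of k]
  have E: "e i i * ?E ^ k = ?E ^ k * e i i - of_nat k * ?E ^ k"
    by (cases k) simp_all
  have "e i i * ?F = ?F * e i i + ?F"
    using e_commute[of i i i n] ni by simp
  from power_commute_derivation[OF this, of k]
  have F: "e i i * ?F ^ k = ?F ^ k * e i i + of_nat k * ?F ^ k"
    by (cases k) simp_all
  have "e i i * (?E ^ k * ?F ^ k) = (e i i * ?E ^ k) * ?F ^ k" by (simp only: mult.assoc)
  also have "\<dots> = ?E ^ k * (e i i * ?F ^ k) - of_nat k * ?E ^ k * ?F ^ k"
    unfolding E by (simp only: left_diff_distrib mult.assoc)
  also have "\<dots> = ?E ^ k * ?F ^ k * e i i"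
    unfolding F by (simp add: distrib_left mult.assoc mult_of_nat_commute[of k "?E ^ k"])
  finally show "e i i * (?E ^ k * ?F ^ k) = ?E ^ k * ?F ^ k * e i i" .
qed

text \<open>\<open>e (Suc n) n\<close> commutes with \<open>e (Suc n) i\<close>, so it can be
  brought to the left, where it acts on \<open>v\<close> by 1. Then the Heisenberg relation holds
  and the sum telescopes.\<close>

lemma heis_op_kill:
  assumes v: "v \<rhd> eshift (Suc n) n = 0"
  shows "heis_op n i (v \<rhd> e i n) = 0"
proof -
  let ?E = "e (Suc n) i" and ?F = "e i n" and ?g = "e (Suc n) n"
  have vg: "v \<rhd> ?g = v" using v by (simp add: eshift_def ac_diff ac_one)
  have "?F * ?E = ?E * ?F + - ?g"
    using e_commute[of i n "Suc n" i] ni by simp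
  moreover have "- ?g * ?E = ?E * - ?g"
    using e_e_commute[of "Suc n" n "Suc n" i] ni by simp
  ultimately have "?F * ?E ^ k = ?E ^ k * ?F + of_nat k * (- ?g * ?E ^ (k - 1))" for k
    by (rule power_commute_derivation)
  then have FE: "v \<rhd> ?F \<rhd> ?E ^ k = v \<rhd> ?E ^ k \<rhd> ?F - v \<rhd> ?E ^ (k - 1) \<rhd> of_nat k" for k
  proof -
    assume *: "\<And>k. ?F * ?E ^ k = ?E ^ k * ?F + of_nat k * (- ?g * ?E ^ (k - 1))"
    have "v \<rhd> ?F \<rhd> ?E ^ k = v \<rhd> (?E ^ k * ?F - ?g * ?E ^ (k - 1) * of_nat k)"
      using *[of k] mult_of_nat_commute[of k "?g * ?E ^ (k - 1)"] by (simp add: ac_mult[symmetric])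
    then show ?thesis by (simp add: ac_diff ac_mult vg)
  qed
  obtain K1 where 1: "\<forall>K'\<ge>K1. heis_op n i (v \<rhd> ?F) = (\<Sum>k<K'. v \<rhd> ?F \<rhd> ?E ^ k \<rhd> ?F ^ k \<rhd> sc (1 / fact k))"
    using heis_op_bound by blast
  obtain K2 where 2: "\<forall>k\<ge>K2. v \<rhd> ?E ^ k = 0"
    using heis_op_bound by blast
  define h where "h k = v \<rhd> ?E ^ k \<rhd> ?F ^ Suc k \<rhd> sc (1 / fact k)" for k
  have step: "v \<rhd> ?F \<rhd> ?E ^ k \<rhd> ?F ^ k \<rhd> sc (1 / fact k) = h k - (if k = 0 then 0 else h (k - 1))" for k
  proof (cases k)
    case 0
    then show ?thesis by (simp add: h_def ac_one)
  next
    case (Suc l)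
    have "v \<rhd> ?E ^ l \<rhd> of_nat k \<rhd> ?F ^ k \<rhd> sc (1 / fact k) = v \<rhd> ?E ^ l \<rhd> ?F ^ k \<rhd> (sc (1 / fact k) * of_nat k)"
      by (simp only: ac_mult[symmetric] mult.assoc)
        (simp only: mult_of_nat_commute mult.assoc)
    also have "\<dots> = h l"
      unfolding Suc sc_inverse_fact_Suc h_def ..
    finally show ?thesis
      unfolding FE ac_diff using Suc
      by (simp add: h_def del: power_Suc of_nat_Suc fact_Suc) (simp add: ac_mult)
  qed
  have tel: "(\<Sum>k<Suc j. h k - (if k = 0 then 0 else h (k - 1))) = h j" for j
    by (induction j) simp_all
  let ?K = "max K1 K2"
  have "heis_op n i (v \<rhd> ?F) = (\<Sum>k<Suc ?K. v \<rhd> ?F \<rhd> ?E ^ k \<rhd> ?F ^ k \<rhd> sc (1 / fact k))"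
    by (rule 1[rule_format]) simp
  also have "\<dots> = h ?K" unfolding step tel ..
  also have "\<dots> = 0" unfolding h_def using 2 by (simp add: ac_zero)
  finally show ?thesis .
qed

text \<open>The correction comes from the commutator of \<open>e i j\<close> with
  \<open>e (Suc n) i\<close>. In the product of all factors it is cancelled by the one of
  \<open>heis_op_col\<close>.\<close>

lemma heis_op_row:
  assumes j: "i < j" "j < n"
  shows "heis_op n i (v \<rhd> e i j) = heis_op n i v \<rhd> e i j - heis_op n i (v \<rhd> e (Suc n) j) \<rhd> e i n"
proof -
  let ?E = "e (Suc n) i" and ?F = "e i n" and ?g = "e (Suc n) j" and ?x = "e i j"
  have "?x * ?E = ?E * ?x + - ?g"
    using e_commute[of i j "Suc n" i] ni j by simp
  moreover have "- ?g * ?E = ?E * - ?g"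
    using e_e_commute[of "Suc n" j "Suc n" i] ni j by simp
  ultimately have xE: "?x * ?E ^ k = ?E ^ k * ?x + of_nat k * (- ?g * ?E ^ (k - 1))" for k
    by (rule power_commute_derivation)
  have "?x * ?F = ?F * ?x" by (rule e_e_commute) (use ni j in auto)
  then have xF: "?x * ?F ^ k = ?F ^ k * ?x" for k
    using power_commuting_commutes[of ?F ?x k] by simp
  have xEF: "v \<rhd> ?x \<rhd> ?E ^ k \<rhd> ?F ^ k \<rhd> sc c = v \<rhd> ?E ^ k \<rhd> ?F ^ k \<rhd> sc c \<rhd> ?x
     - v \<rhd> ?g \<rhd> ?E ^ (k - 1) \<rhd> ?F ^ k \<rhd> (sc c * of_nat k)" for k c
  proof -
    have "?x * ?E ^ k * ?F ^ k = ?E ^ k * (?x * ?F ^ k) - ?g * ?E ^ (k - 1) * of_nat k * ?F ^ k"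
      using xE[of k] mult_of_nat_commute[of k "?g * ?E ^ (k - 1)"] by (simp add: left_diff_distrib mult.assoc)
    also have "\<dots> = ?E ^ k * ?F ^ k * ?x - ?g * ?E ^ (k - 1) * ?F ^ k * of_nat k"
      by (simp only: xF mult.assoc mult_of_nat_commute)
    finally have "v \<rhd> ?x \<rhd> ?E ^ k \<rhd> ?F ^ k = v \<rhd> ?E ^ k \<rhd> ?F ^ k \<rhd> ?x - v \<rhd> ?g \<rhd> ?E ^ (k - 1) \<rhd> ?F ^ k \<rhd> of_nat k"
      by (simp only: ac_mult[symmetric] ac_diff[symmetric])
    moreover have "y \<rhd> of_nat k \<rhd> sc c = y \<rhd> (sc c * of_nat k)" for y
      by (simp only: ac_mult[symmetric] sc_commute)
    ultimately show ?thesis by (simp add: ac_diff ac_sc_right[of _ _ ?x])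
  qed
  obtain K1 where 1: "\<forall>K'\<ge>K1. heis_op n i v = (\<Sum>k<K'. v \<rhd> ?E ^ k \<rhd> ?F ^ k \<rhd> sc (1 / fact k))"
    using heis_op_bound by blast
  obtain K2 where 2: "\<forall>K'\<ge>K2. heis_op n i (v \<rhd> ?x) = (\<Sum>k<K'. v \<rhd> ?x \<rhd> ?E ^ k \<rhd> ?F ^ k \<rhd> sc (1 / fact k))"
    using heis_op_bound by blast
  obtain K3 where 3: "\<forall>K'\<ge>K3. heis_op n i (v \<rhd> ?g) = (\<Sum>k<K'. v \<rhd> ?g \<rhd> ?E ^ k \<rhd> ?F ^ k \<rhd> sc (1 / fact k))"
    using heis_op_bound by blast
  let ?K = "max K1 (max K2 K3)"
  have "(\<Sum>k<Suc ?K. v \<rhd> ?g \<rhd> ?E ^ (k - 1) \<rhd> ?F ^ k \<rhd> (sc (1 / fact k) * of_nat k)) =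
     (\<Sum>k<?K. v \<rhd> ?g \<rhd> ?E ^ k \<rhd> ?F ^ Suc k \<rhd> (sc (1 / fact (Suc k)) * of_nat (Suc k)))"
    by (subst sum.lessThan_Suc_shift) (simp add: ac_zero del: of_nat_Suc power_Suc fact_Suc)
  also have "\<dots> = (\<Sum>k<?K. v \<rhd> ?g \<rhd> ?E ^ k \<rhd> ?F ^ k \<rhd> sc (1 / fact k)) \<rhd> ?F"
    unfolding sc_inverse_fact_Suc sum_ac power_Suc2 ac_mult by (simp only: ac_sc_right[of _ _ ?F])
  also have "\<dots> = heis_op n i (v \<rhd> ?g) \<rhd> ?F"
    using 3[rule_format, of ?K] by simp
  finally have g: "(\<Sum>k<Suc ?K. v \<rhd> ?g \<rhd> ?E ^ (k - 1) \<rhd> ?F ^ k \<rhd> (sc (1 / fact k) * of_nat k))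
     = heis_op n i (v \<rhd> ?g) \<rhd> ?F" .
  have "heis_op n i (v \<rhd> ?x) = (\<Sum>k<Suc ?K. v \<rhd> ?x \<rhd> ?E ^ k \<rhd> ?F ^ k \<rhd> sc (1 / fact k))"
    by (rule 2[rule_format]) simp
  also have "\<dots> = (\<Sum>k<Suc ?K. v \<rhd> ?E ^ k \<rhd> ?F ^ k \<rhd> sc (1 / fact k)) \<rhd> ?x
      - heis_op n i (v \<rhd> ?g) \<rhd> ?F"
    unfolding xEF sum_subtractf g sum_ac ..
  also have "(\<Sum>k<Suc ?K. v \<rhd> ?E ^ k \<rhd> ?F ^ k \<rhd> sc (1 / fact k)) = heis_op n i v"
    by (rule 1[rule_format, symmetric]) simp
  finally show ?thesis .
qed

text \<open>Here it is the commutator of \<open>e a i\<close> with \<open>e i n\<close> that leaves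
  a correction, of opposite sign to that of \<open>heis_op_row\<close>.\<close>

lemma heis_op_col:
  assumes a: "1 \<le> a" "a < i"
  shows "heis_op n i (v \<rhd> e a i) = heis_op n i v \<rhd> e a i + heis_op n i (v \<rhd> e (Suc n) i) \<rhd> e a n"
proof -
  let ?E = "e (Suc n) i" and ?F = "e i n" and ?g = "e a n" and ?x = "e a i"
  have "?x * ?E = ?E * ?x" by (rule e_e_commute) (use ni a in auto)
  then have xE: "?x * ?E ^ k = ?E ^ k * ?x" for k
    using power_commuting_commutes[of ?E ?x k] by simp
  have "?x * ?F = ?F * ?x + ?g"
    using e_commute[of a i i n] ni a by simp
  moreover have gF: "?g * ?F = ?F * ?g" by (rule e_e_commute) (use ni a in auto)
  ultimately have xF: "?x * ?F ^ k = ?F ^ k * ?x + of_nat k * (?g * ?F ^ (k - 1))" for k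
    by (rule power_commute_derivation)
  have gF': "?g * ?F ^ k = ?F ^ k * ?g" for k
    using power_commuting_commutes[of ?F ?g k] gF by simp
  have xEF: "v \<rhd> ?x \<rhd> ?E ^ k \<rhd> ?F ^ k \<rhd> sc c = v \<rhd> ?E ^ k \<rhd> ?F ^ k \<rhd> sc c \<rhd> ?x
     + v \<rhd> ?E ^ k \<rhd> ?F ^ (k - 1) \<rhd> (sc c * of_nat k) \<rhd> ?g" for k c
  proof -
    have "?x * ?E ^ k * ?F ^ k = ?E ^ k * (?x * ?F ^ k)"
      by (simp only: xE mult.assoc)
    also have "\<dots> = ?E ^ k * ?F ^ k * ?x + ?E ^ k * ?F ^ (k - 1) * of_nat k * ?g"
      unfolding xF gF' by (simp only: distrib_left mult.assoc mult_of_nat_commute)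
    finally have "v \<rhd> ?x \<rhd> ?E ^ k \<rhd> ?F ^ k = v \<rhd> ?E ^ k \<rhd> ?F ^ k \<rhd> ?x + v \<rhd> ?E ^ k \<rhd> ?F ^ (k - 1) \<rhd> of_nat k \<rhd> ?g"
      by (simp only: ac_mult[symmetric] ac_add[symmetric])
    moreover have "y \<rhd> of_nat k \<rhd> ?g \<rhd> sc c = y \<rhd> (sc c * of_nat k) \<rhd> ?g" for y
      by (simp only: ac_mult[symmetric] sc_commute mult.assoc)
    ultimately show ?thesis by (simp add: ac_add_left ac_sc_right[of _ _ ?x])
  qed
  obtain K1 where 1: "\<forall>K'\<ge>K1. heis_op n i v = (\<Sum>k<K'. v \<rhd> ?E ^ k \<rhd> ?F ^ k \<rhd> sc (1 / fact k))"
    using heis_op_bound by blast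
  obtain K2 where 2: "\<forall>K'\<ge>K2. heis_op n i (v \<rhd> ?x) = (\<Sum>k<K'. v \<rhd> ?x \<rhd> ?E ^ k \<rhd> ?F ^ k \<rhd> sc (1 / fact k))"
    using heis_op_bound by blast
  obtain K3 where 3: "\<forall>K'\<ge>K3. heis_op n i (v \<rhd> ?E) = (\<Sum>k<K'. v \<rhd> ?E \<rhd> ?E ^ k \<rhd> ?F ^ k \<rhd> sc (1 / fact k))"
    using heis_op_bound by blast
  let ?K = "max K1 (max K2 K3)"
  have "(\<Sum>k<Suc ?K. v \<rhd> ?E ^ k \<rhd> ?F ^ (k - 1) \<rhd> (sc (1 / fact k) * of_nat k)) =
     (\<Sum>k<?K. v \<rhd> ?E ^ Suc k \<rhd> ?F ^ k \<rhd> (sc (1 / fact (Suc k)) * of_nat (Suc k)))"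
    by (subst sum.lessThan_Suc_shift) (simp add: ac_zero del: of_nat_Suc power_Suc fact_Suc)
  also have "\<dots> = (\<Sum>k<?K. v \<rhd> ?E \<rhd> ?E ^ k \<rhd> ?F ^ k \<rhd> sc (1 / fact k))"
    unfolding sc_inverse_fact_Suc power_Suc ac_mult ..
  also have "\<dots> = heis_op n i (v \<rhd> ?E)"
    using 3[rule_format, of ?K] by simp
  finally have g: "(\<Sum>k<Suc ?K. v \<rhd> ?E ^ k \<rhd> ?F ^ (k - 1) \<rhd> (sc (1 / fact k) * of_nat k))
     = heis_op n i (v \<rhd> ?E)" .
  have "heis_op n i (v \<rhd> ?x) = (\<Sum>k<Suc ?K. v \<rhd> ?x \<rhd> ?E ^ k \<rhd> ?F ^ k \<rhd> sc (1 / fact k))"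
    by (rule 2[rule_format]) simp
  also have "\<dots> = (\<Sum>k<Suc ?K. v \<rhd> ?E ^ k \<rhd> ?F ^ k \<rhd> sc (1 / fact k)) \<rhd> ?x
      + heis_op n i (v \<rhd> ?E) \<rhd> ?g"
    unfolding xEF sum.distrib g[symmetric] sum_ac ..
  also have "(\<Sum>k<Suc ?K. v \<rhd> ?E ^ k \<rhd> ?F ^ k \<rhd> sc (1 / fact k)) = heis_op n i v"
    by (rule 1[rule_format, symmetric]) simp
  finally show ?thesis .
qed

end

lemma heis_op_e_commute:
  assumes "1 \<le> i" "i < n" "n < N" "1 \<le> a" "a \<le> Suc n" "1 \<le> b" "b \<le> n" "a \<noteq> n" "a \<noteq> i" "b \<noteq> i"
  shows "heis_op n i (v \<rhd> e a b) = heis_op n i v \<rhd> e a b"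
proof (rule heis_op_commute')
  show "e a b * e (Suc n) i = e (Suc n) i * e a b"
    by (rule e_e_commute) (use assms in auto)
  show "e a b * e i n = e i n * e a b"
    by (rule e_e_commute) (use assms in auto)
qed (use assms in auto)

definition heis_fold :: "nat \<Rightarrow> nat \<Rightarrow> 'w \<Rightarrow> 'w" where
  "heis_fold n l = fold (heis_op n) [1..<l]"

lemma heis_fold_base: "heis_fold n 1 v = v"
  by (simp add: heis_fold_def)

lemma heis_fold_Suc: "1 \<le> l \<Longrightarrow> heis_fold n (Suc l) v = heis_op n l (heis_fold n l v)"
  by (simp add: heis_fold_def)

lemma heis_fold_add:
  assumes "1 \<le> l" "l \<le> n" "n < N"
  shows "heis_fold n l (v + w) = heis_fold n l v + heis_fold n l w"
  using assms
  by (induction l rule: dec_induct) (auto simp: heis_fold_base[unfolded One_nat_def] heis_fold_Suc heis_op_add)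

lemma heis_fold_0:
  assumes "1 \<le> l" "l \<le> n" "n < N" shows "heis_fold n l 0 = 0"
  using heis_fold_add[OF assms, of 0 0] by simp

lemma heis_fold_fixed:
  assumes "1 \<le> l" "l \<le> n" "n < N" "\<And>i. 1 \<le> i \<Longrightarrow> i < n \<Longrightarrow> v \<rhd> e (Suc n) i = 0"
  shows "heis_fold n l v = v"
  using assms
  by (induction l rule: dec_induct) (auto simp: heis_fold_base[unfolded One_nat_def] heis_fold_Suc heis_op_fixed)

lemma heis_fold_e_commute:
  assumes "1 \<le> l" "l \<le> n" "n < N" "1 \<le> a" "a \<le> Suc n" "1 \<le> b" "b \<le> n" "a \<noteq> n" "l \<le> a" "l \<le> b"
  shows "heis_fold n l (v \<rhd> e a b) = heis_fold n l v \<rhd> e a b"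
  using assms(1,2,9,10)
proof (induction l rule: dec_induct)
  case (step l)
  have "heis_op n l (heis_fold n l v \<rhd> e a b) = heis_op n l (heis_fold n l v) \<rhd> e a b"
    by (rule heis_op_e_commute) (use step assms in auto)
  then show ?case using step by (simp add: heis_fold_Suc)
qed (simp add: heis_fold_def)

lemma heis_fold_diag:
  assumes "1 \<le> l" "l \<le> n" "n < N" "1 \<le> a" "a < n"
  shows "heis_fold n l (v \<rhd> e a a) = heis_fold n l v \<rhd> e a a"
  using assms(1,2)
proof (induction l rule: dec_induct)
  case (step l)
  have "heis_op n l (heis_fold n l v \<rhd> e a a) = heis_op n l (heis_fold n l v) \<rhd> e a a"
  proof (cases "l = a")
    case True
    then show ?thesis using heis_op_diag[of a n] assms by simp
  next
    case False
    then show ?thesis by (intro heis_op_e_commute) (use step assms in auto)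
  qed
  then show ?case using step by (simp add: heis_fold_Suc)
qed (simp add: heis_fold_def)

text \<open>Factor \<open>i\<close> creates the correction of \<open>heis_op_row\<close>, the
  factors strictly between \<open>i\<close> and \<open>j\<close> carry it along, and factor
  \<open>j\<close> removes it by \<open>heis_op_col\<close>. The condition in the statement marks
  the stretch where it is present; at \<open>l = n\<close> it is gone.\<close>

lemma heis_fold_upper:
  assumes "1 \<le> i" "i < j" "j < n" "n < N" "1 \<le> l" "l \<le> n"
  shows "heis_fold n l (v \<rhd> e i j) = heis_fold n l v \<rhd> e i j -
    (if i < l \<and> l \<le> j then heis_fold n l (v \<rhd> e (Suc n) j) \<rhd> e i n else 0)"
  using assms(5,6)
proof (induction l rule: dec_induct)
  case (step l)
  let ?K = "heis_fold n l" and ?Q = "heis_op n l"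
  have l: "1 \<le> l" "l < n" using step by auto
  have Q_diff: "?Q (x - y) = ?Q x - ?Q y" for x y
    using heis_op_add[of l n "x - y" y] l assms by simp
  have IH: "heis_fold n (Suc l) (v \<rhd> e i j) = ?Q (?K v \<rhd> e i j) -
      (if i < l \<and> l \<le> j then ?Q (?K (v \<rhd> e (Suc n) j) \<rhd> e i n) else 0)"
    using step heis_op_0[of l n] l assms by (simp add: heis_fold_Suc Q_diff)
  have Kg: "?K (v \<rhd> e (Suc n) j) = ?K v \<rhd> e (Suc n) j" if "l \<le> j"
    by (rule heis_fold_e_commute) (use that l assms in auto)
  have Qin: "?Q (x \<rhd> e i n) = ?Q x \<rhd> e i n" if "l \<noteq> i" for x
    by (rule heis_op_e_commute) (use that l assms in auto)
  consider "l < i" | "l = i" | "i < l" "l < j" | "l = j" | "j < l" using assms by linarith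
  then show ?case
  proof cases
    case 1
    then have "?Q (?K v \<rhd> e i j) = ?Q (?K v) \<rhd> e i j"
      by (intro heis_op_e_commute) (use l assms in auto)
    then show ?thesis unfolding IH using 1 l by (simp add: heis_fold_Suc)
  next
    case 2
    then show ?thesis
      unfolding IH using heis_op_row[of i n j "?K v"] Kg l assms by (simp add: heis_fold_Suc)
  next
    case 3
    then have "?Q (?K v \<rhd> e i j) = ?Q (?K v) \<rhd> e i j"
      by (intro heis_op_e_commute) (use l assms in auto)
    then show ?thesis unfolding IH using 3 l Qin by (simp add: heis_fold_Suc)
  next
    case 4
    then show ?thesis
      unfolding IH using heis_op_col[of j n i "?K v"] Kg Qin l assms by (simp add: heis_fold_Suc)
  next
    case 5
    then have "?Q (?K v \<rhd> e i j) = ?Q (?K v) \<rhd> e i j"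
      by (intro heis_op_e_commute) (use l assms in auto)
    then show ?thesis unfolding IH using 5 l by (simp add: heis_fold_Suc)
  qed
qed (use assms in \<open>simp add: heis_fold_def\<close>)

text \<open>The factors before \<open>i\<close> preserve the hypothesis of
  \<open>heis_op_kill\<close>, and those after \<open>i\<close> only see 0.\<close>

lemma heis_fold_kill:
  assumes i: "1 \<le> i" "i < n" "n < N" and v: "v \<rhd> eshift (Suc n) n = 0"
  shows "heis_fold n n (v \<rhd> e i n) = 0"
proof -
  have "heis_fold n i v \<rhd> e (Suc n) n = heis_fold n i (v \<rhd> e (Suc n) n)"
    by (rule heis_fold_e_commute[symmetric]) (use i in auto)
  moreover have "v \<rhd> e (Suc n) n = v" using v by (simp add: eshift_def ac_diff ac_one)
  ultimately have "heis_fold n i v \<rhd> eshift (Suc n) n = 0"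
    by (simp add: eshift_def ac_diff ac_one)
  then have "heis_op n i (heis_fold n i v \<rhd> e i n) = 0"
    by (intro heis_op_kill) (use i in auto)
  moreover have "heis_fold n i (v \<rhd> e i n) = heis_fold n i v \<rhd> e i n"
    by (rule heis_fold_e_commute) (use i in auto)
  ultimately have start: "heis_fold n (Suc i) (v \<rhd> e i n) = 0"
    using i by (simp add: heis_fold_Suc)
  have "heis_fold n l (v \<rhd> e i n) = 0" if "Suc i \<le> l" "l \<le> n" for l
    using that
    by (induction l rule: dec_induct) (use start i in \<open>auto simp: heis_fold_Suc heis_op_0\<close>)
  then show ?thesis using i by simp
qed

text \<open>Stage \<open>Suc n\<close> removes column \<open>n\<close>: the size-one factor handles
  \<open>e n n\<close> shifted by \<open>u n\<close>, and the Heisenberg factors handle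
  \<open>e i n\<close> for \<open>i < n\<close>. Both commute with the generators of earlier
  columns, which are left to the smaller stages.\<close>

fun borel_proj :: "(nat \<Rightarrow> 'k) \<Rightarrow> nat \<Rightarrow> 'w \<Rightarrow> 'w" where
  "borel_proj u 0 v = v"
| "borel_proj u (Suc n) v =
    (if n = 0 then v else borel_proj u n (heis_fold n n (proj_op n n (u n) v)))"

lemma borel_proj_add:
  "n \<le> N \<Longrightarrow> borel_proj u n (v + w) = borel_proj u n v + borel_proj u n w"
  by (induction n arbitrary: v w) (auto simp: proj_op_add heis_fold_add)

lemma borel_proj_0: "n \<le> N \<Longrightarrow> borel_proj u n 0 = 0"
  using borel_proj_add[of n u 0 0] by simp

lemma borel_proj_fixed: "n \<le> N \<Longrightarrow> whit 1 n v \<Longrightarrow> borel_proj u n v = v"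
proof (induction n)
  case (Suc n)
  show ?case
  proof (cases "n = 0")
    case False
    then have "v \<rhd> eshift (Suc n) n = 0" using Suc.prems by (auto simp: whit_def)
    then have "proj_op n n (u n) v = v" by (rule proj_op_fixed[OF order.refl])
    moreover have "heis_fold n n v = v"
    proof (rule heis_fold_fixed)
      fix i assume "1 \<le> i" "i < n"
      then show "v \<rhd> e (Suc n) i = 0"
        using whit_e[OF Suc.prems(2), of i "Suc n"] by simp
    qed (use False Suc.prems in auto)
    moreover have "borel_proj u n v = v"
      using Suc whit_mono[of 1 "Suc n" v 1 n] by simp
    ultimately show ?thesis using False by simp
  qed simp
qed simp

lemma borel_proj_kill:
  assumes "n \<le> N" "1 \<le> a" "a \<le> b" "b < n"
  shows "borel_proj u n (y \<rhd> ell a b (u b)) = 0"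
  using assms(1,4)
proof (induction n arbitrary: y)
  case (Suc n)
  have n: "1 \<le> n" "n < N" "b \<le> n" using Suc.prems assms by auto
  consider "b = n" "a = n" | "b = n" "a < n" | "b < n" using n assms by linarith
  then have "borel_proj u n (heis_fold n n (proj_op n n (u n) (y \<rhd> ell a b (u b)))) = 0"
  proof cases
    case 1
    then show ?thesis
      using proj_op_ell[OF n(1,2)] heis_fold_0[OF n(1) order.refl n(2)] borel_proj_0[of n] n by simp
  next
    case 2
    then have "proj_op n n (u n) (y \<rhd> ell a b (u b)) = proj_op n n (u n + 1) y \<rhd> e a n"
      using proj_op_diag_shift[of a n "u n" y] assms n by (simp add: ell_def)
    \<comment> \<open>Also with the raised parameter the projector lands in the kernel of
      \<open>eshift (Suc n) n\<close>, as \<open>heis_fold_kill\<close> requires.\<close>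
    moreover have "heis_fold n n (proj_op n n (u n + 1) y \<rhd> e a n) = 0"
      by (rule heis_fold_kill) (use 2 assms n proj_op_A[of n n] wspace_empty in auto)
    ultimately show ?thesis using borel_proj_0[of n] n by simp
  next
    case 3
    have "e a b * e (Suc n) n = e (Suc n) n * e a b"
      by (rule e_e_commute) (use 3 n assms in auto)
    moreover have "e a b * e n n = e n n * e a b"
      by (rule e_e_commute) (use 3 n assms in auto)
    ultimately have "proj_op n n (u n) (y \<rhd> e a b) = proj_op n n (u n) y \<rhd> e a b"
      using n by (intro proj_op_commute)
        (auto simp: eshift_def pminor_def pos_sign_singleton ell_def algebra_simps sc_commute[of "e a b"])
    moreover have "proj_op n n (u n) (y \<rhd> sc c) = proj_op n n (u n) y \<rhd> sc c" for c
      by (rule proj_op_sc) (use n in auto)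
    ultimately have P: "proj_op n n (u n) (y \<rhd> ell a b (u b)) = proj_op n n (u n) y \<rhd> ell a b (u b)"
      using n by (simp add: ell_def ac_add proj_op_add proj_op_0 ac_zero)
    have K: "heis_fold n n (x \<rhd> e a b) = heis_fold n n x \<rhd> e a b" for x
      using heis_fold_upper[of a b n n x] heis_fold_diag[of n n a x] 3 n assms
      by (cases "a = b") auto
    have "heis_fold n l (x \<rhd> sc c) = heis_fold n l x \<rhd> sc c" if "1 \<le> l" "l \<le> n" for l x c
      using that
    proof (induction l rule: dec_induct)
      case (step l)
      have "heis_op n l (heis_fold n l x \<rhd> sc c) = heis_op n l (heis_fold n l x) \<rhd> sc c"
        by (rule heis_op_commute') (use step n in \<open>auto simp: sc_commute\<close>)
      then show ?case using step by (simp add: heis_fold_Suc)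
    qed (simp add: heis_fold_def)
    then have "heis_fold n n (x \<rhd> ell a b (u b)) = heis_fold n n x \<rhd> ell a b (u b)" for x
      using n K by (simp add: ell_def ac_add heis_fold_add heis_fold_0 ac_zero)
    then show ?thesis
      unfolding P using Suc.IH[OF _ 3] n by simp
  qed
  then show ?case using n by simp
qed simp

text \<open>\<open>borel_proj\<close> of \<open>kproj 1 u v\<close> is computed in two ways:
  composing with the projector leaves \<open>borel_proj\<close> unchanged, and
  \<open>borel_proj\<close> fixes Whittaker vectors.\<close>

lemma kproj_eq_borel_proj:
  assumes "1 \<le> N" shows "kproj 1 u v = borel_proj u N v"
proof -
  have "borel_proj u N (kproj 1 u v) = borel_proj u N v"
    by (rule kproj_functional) (use assms in \<open>auto simp: borel_proj_add borel_proj_kill\<close>)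
  moreover have "borel_proj u N (kproj 1 u v) = kproj 1 u v"
    by (rule borel_proj_fixed[OF order.refl], rule kproj_whit) (use assms in auto)
  ultimately show ?thesis by simp
qed

lemma kproj_kill:
  assumes "1 \<le> a" "a \<le> b" "b < N" shows "kproj 1 u (y \<rhd> ell a b (u b)) = 0"
  by (subst kproj_eq_borel_proj) (use assms in \<open>auto intro!: borel_proj_kill\<close>)

end

section \<open>The enveloping algebra\<close>

lemma mirabolic_ideal_zero: "0 \<in> mirabolic_ideal N"
  using additive_subgroup.zero_closed[OF ideal.axioms(1)[OF ideal_mirabolic_ideal]]
  by (simp add: ring_of_type_algebra_def)

lemma mirabolic_ideal_add: "a \<in> mirabolic_ideal N \<Longrightarrow> b \<in> mirabolic_ideal N \<Longrightarrow> a + b \<in> mirabolic_ideal N"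
  using additive_subgroup.a_closed[OF ideal.axioms(1)[OF ideal_mirabolic_ideal], of a N b]
  by (simp add: ring_of_type_algebra_def)

lemma mirabolic_ideal_mult_left: "a \<in> mirabolic_ideal N \<Longrightarrow> b * a \<in> mirabolic_ideal N"
  using ideal.I_l_closed[OF ideal_mirabolic_ideal, of a N b]
  by (simp add: ring_of_type_algebra_def)

lemma mirabolic_ideal_mult_right: "a \<in> mirabolic_ideal N \<Longrightarrow> a * b \<in> mirabolic_ideal N"
  using ideal.I_r_closed[OF ideal_mirabolic_ideal, of a N b]
  by (simp add: ring_of_type_algebra_def)

lemma mirabolic_ideal_minus: "a \<in> mirabolic_ideal N \<Longrightarrow> - a \<in> mirabolic_ideal N"
  using mirabolic_ideal_mult_left[of a N "- 1"] by simp

lemma mirabolic_ideal_relation: "a \<in> mirabolic_relations N \<Longrightarrow> a \<in> mirabolic_ideal N"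
  unfolding mirabolic_ideal_def
  using ring.genideal_self[OF ring_ring_of_type_algebra, of "mirabolic_relations N"]
  by (auto simp: ring_of_type_algebra_def)

lemma cls_ring_hom: "cls N \<in> Ring.ring_hom ring_of_type_algebra (U_mirabolic N)"
  unfolding U_mirabolic_def cls_def[abs_def]
  by (rule ideal.rcos_ring_hom[OF ideal_mirabolic_ideal])

lemma cls_closed: "cls N a \<in> carrier (U_mirabolic N)"
  using ring_hom_closed[OF cls_ring_hom, of a N] by (simp add: ring_of_type_algebra_def)

lemma cls_add: "cls N (a + b) = cls N a \<oplus>\<^bsub>U_mirabolic N\<^esub> cls N b"
  using ring_hom_add[OF cls_ring_hom, of a b N] by (simp add: ring_of_type_algebra_def)

lemma cls_mult: "cls N (a * b) = cls N a \<otimes>\<^bsub>U_mirabolic N\<^esub> cls N b"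
  using ring_hom_mult[OF cls_ring_hom, of a b N] by (simp add: ring_of_type_algebra_def)

lemma cls_one: "cls N 1 = \<one>\<^bsub>U_mirabolic N\<^esub>"
  using ring_hom_one[OF cls_ring_hom, of N] by (simp add: ring_of_type_algebra_def)

lemma cls_ideal:
  assumes "a \<in> mirabolic_ideal N" shows "cls N a = cls N 0"
proof -
  have "cls N b = mirabolic_ideal N" if "b \<in> mirabolic_ideal N" for b :: "'a free_alg"
  proof -
    have "abelian_subgroup (mirabolic_ideal N) (ring_of_type_algebra :: 'a free_alg ring)"
      by (rule abelian_subgroupI3)
        (use ideal_mirabolic_ideal[of N, where ?'a = 'a] in \<open>auto simp: ideal_def ring_def\<close>)
    then show ?thesis
      unfolding cls_def using that by (rule abelian_subgroup.a_rcos_const)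
  qed
  then show ?thesis using assms mirabolic_ideal_zero by blast
qed

text \<open>
  To compute in a type of class \<open>ring_1\<close>, all enveloping algebras are put into one quotient:
  slot \<open>Suc n\<close> of a family is taken modulo \<open>mirabolic_ideal n\<close>. Slot 0 is left free, which makes
  \<open>0 \<noteq> 1\<close> immediate.
\<close>

definition family_eq :: "(nat \<Rightarrow> 'k::field free_alg) \<Rightarrow> (nat \<Rightarrow> 'k free_alg) \<Rightarrow> bool" where
  "family_eq f g \<longleftrightarrow> f 0 = g 0 \<and> (\<forall>n. f (Suc n) - g (Suc n) \<in> mirabolic_ideal n)"

quotient_type (overloaded) 'k family_alg = "nat \<Rightarrow> 'k::field free_alg" / family_eq
proof (rule equivpI)
  show "reflp (family_eq :: (nat \<Rightarrow> 'k free_alg) \<Rightarrow> _)"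
    by (auto simp: reflp_def family_eq_def mirabolic_ideal_zero)
  show "symp (family_eq :: (nat \<Rightarrow> 'k free_alg) \<Rightarrow> _)"
  proof (rule sympI)
    fix f g :: "nat \<Rightarrow> 'k free_alg" assume "family_eq f g"
    then show "family_eq g f"
      using mirabolic_ideal_minus[of "f (Suc n) - g (Suc n)" n for n] by (simp add: family_eq_def)
  qed
  show "transp (family_eq :: (nat \<Rightarrow> 'k free_alg) \<Rightarrow> _)"
  proof (rule transpI)
    fix f g h :: "nat \<Rightarrow> 'k free_alg" assume "family_eq f g" "family_eq g h"
    then show "family_eq f h"
      using mirabolic_ideal_add[of "f (Suc n) - g (Suc n)" n "g (Suc n) - h (Suc n)" for n]
      by (simp add: family_eq_def)
  qed
qed

instantiation family_alg :: (field) ring_1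
begin

lift_definition zero_family_alg :: "'a family_alg" is "\<lambda>_. 0" .
lift_definition one_family_alg :: "'a family_alg" is "\<lambda>_. 1" .
lift_definition plus_family_alg :: "'a family_alg \<Rightarrow> 'a family_alg \<Rightarrow> 'a family_alg"
  is "\<lambda>f g n. f n + g n"
  unfolding family_eq_def
proof (intro conjI allI)
  fix f f' g g' :: "nat \<Rightarrow> 'a free_alg" and n
  assume "f 0 = f' 0 \<and> (\<forall>n. f (Suc n) - f' (Suc n) \<in> mirabolic_ideal n)"
    "g 0 = g' 0 \<and> (\<forall>n. g (Suc n) - g' (Suc n) \<in> mirabolic_ideal n)"
  then show "f 0 + g 0 = f' 0 + g' 0"
    "f (Suc n) + g (Suc n) - (f' (Suc n) + g' (Suc n)) \<in> mirabolic_ideal n"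
    using mirabolic_ideal_add[of "f (Suc n) - f' (Suc n)" n "g (Suc n) - g' (Suc n)"]
    by (simp_all add: algebra_simps)
qed
lift_definition uminus_family_alg :: "'a family_alg \<Rightarrow> 'a family_alg" is "\<lambda>f n. - f n"
  unfolding family_eq_def
proof (intro conjI allI)
  fix f f' :: "nat \<Rightarrow> 'a free_alg" and n
  assume "f 0 = f' 0 \<and> (\<forall>n. f (Suc n) - f' (Suc n) \<in> mirabolic_ideal n)"
  then show "- f 0 = - f' 0" "- f (Suc n) - - f' (Suc n) \<in> mirabolic_ideal n"
    using mirabolic_ideal_minus[of "f (Suc n) - f' (Suc n)" n] by simp_all
qed
definition minus_family_alg :: "'a family_alg \<Rightarrow> 'a family_alg \<Rightarrow> 'a family_alg" where
  "minus_family_alg x y = x + - y"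
lift_definition times_family_alg :: "'a family_alg \<Rightarrow> 'a family_alg \<Rightarrow> 'a family_alg"
  is "\<lambda>f g n. f n * g n"
  unfolding family_eq_def
proof (intro conjI allI)
  fix f f' g g' :: "nat \<Rightarrow> 'a free_alg" and n
  assume *: "f 0 = f' 0 \<and> (\<forall>n. f (Suc n) - f' (Suc n) \<in> mirabolic_ideal n)"
    "g 0 = g' 0 \<and> (\<forall>n. g (Suc n) - g' (Suc n) \<in> mirabolic_ideal n)"
  then show "f 0 * g 0 = f' 0 * g' 0" by simp
  have "f (Suc n) * (g (Suc n) - g' (Suc n)) + (f (Suc n) - f' (Suc n)) * g' (Suc n) \<in> mirabolic_ideal n"
    using * by (intro mirabolic_ideal_add mirabolic_ideal_mult_left mirabolic_ideal_mult_right) auto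
  then show "f (Suc n) * g (Suc n) - f' (Suc n) * g' (Suc n) \<in> mirabolic_ideal n"
    by (simp add: algebra_simps)
qed

instance
proof
  fix a b c :: "'a family_alg"
  have refl: "family_eq f g" if "f = g" for f g :: "nat \<Rightarrow> 'a free_alg"
    using that by (simp add: family_eq_def mirabolic_ideal_zero)
  show "a + b + c = a + (b + c)" "a + b = b + a" "0 + a = a" "a * b * c = a * (b * c)"
    "1 * a = a" "a * 1 = a" "(a + b) * c = a * c + b * c" "a * (b + c) = a * b + a * c"
    "- a + a = 0"
    by (transfer; rule refl; simp add: algebra_simps fun_eq_iff)+
  show "a - b = a + - b" by (rule minus_family_alg_def)
  show "(0 :: 'a family_alg) \<noteq> 1" by transfer (simp add: family_eq_def)
qed

end

definition family_single :: "nat \<Rightarrow> 'k::field free_alg \<Rightarrow> 'k family_alg" where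
  "family_single N a = abs_family_alg (\<lambda>n. if n = Suc N then a else 0)"

text \<open>A scalar fills all slots, since \<open>sc 1\<close> has to be the unit of the whole
  ring. A letter sits in the slot of \<open>N\<close> alone, so its relations are trivial in the
  other slots.\<close>

definition family_scalar :: "'k::field \<Rightarrow> 'k family_alg" where
  "family_scalar c = abs_family_alg (\<lambda>_. scalar c)"

lemmas abs_family_alg_ring = zero_family_alg_def one_family_alg_def plus_family_alg.abs_eq
  uminus_family_alg.abs_eq times_family_alg.abs_eq

lemma scalar_commute: "x * scalar c = scalar c * (x :: 'k::field free_alg)"
proof (induction x rule: update_induct)
  case (update f k v)
  have "Poly_Mapping.update k v f = f + Poly_Mapping.single k v"
    by (rule poly_mapping_eqI)
      (use update.hyps in \<open>auto simp: Poly_Mapping.lookup_update lookup_add lookup_single in_keys_iff when_def\<close>)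
  moreover have "Poly_Mapping.single k v * scalar c = scalar c * Poly_Mapping.single k v"
    by (simp add: scalar_def mult_single mult.commute)
  ultimately show ?case using update.IH by (simp add: algebra_simps)
qed simp

lemma scalar_add: "scalar (c + d) = scalar c + scalar d"
  by (simp add: scalar_def single_add)

lemma scalar_zero: "scalar 0 = 0"
  by (simp add: scalar_def)

lemma scalar_mult: "scalar (c * d) = scalar c * (scalar d :: 'k::field free_alg)"
  by (simp add: scalar_def mult_single)

lemma family_alg_obtain_abs: obtains f where "x = abs_family_alg f"
  using Quotient3_abs_rep[OF Quotient3_family_alg, of x] by metis

lemma family_alg_eqI:
  "f = g \<Longrightarrow> family_eq f g"
  by (simp add: family_eq_def mirabolic_ideal_zero)

lemma family_gl_relations:
  "gl_relations (family_scalar :: 'k::field_char_0 \<Rightarrow> _) (\<lambda>i j. family_single N (E i j)) N"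
proof
  fix c d :: 'k and x :: "'k family_alg"
  show "family_scalar (c + d) = family_scalar c + family_scalar d"
    by (simp add: family_scalar_def abs_family_alg_ring scalar_add)
  show "family_scalar (c * d) = family_scalar c * family_scalar d"
    by (simp add: family_scalar_def abs_family_alg_ring scalar_mult)
  show "family_scalar (1 :: 'k) = 1"
    by (simp add: family_scalar_def abs_family_alg_ring scalar_def)
  show "x * family_scalar c = family_scalar c * x"
    by (rule family_alg_obtain_abs[of x]) (simp add: family_scalar_def abs_family_alg_ring scalar_commute)
next
  fix i j k l assume idx: "i \<in> {1..N}" "j \<in> {1..<N}" "k \<in> {1..N}" "l \<in> {1..<N}"
  let ?a = "\<lambda>i j. E i j :: 'k free_alg"
  have "?a i j * ?a k l - ?a k l * ?a i j - ((if j = k then ?a i l else 0) - (if l = i then ?a k j else 0))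
      \<in> mirabolic_relations N"
  proof -
    have "(i, j) \<in> mirabolic_index N" "(k, l) \<in> mirabolic_index N"
      using idx by (auto simp: mirabolic_index_def)
    then show ?thesis unfolding mirabolic_relations_def by blast
  qed
  then have rel: "?a i j * ?a k l - (?a k l * ?a i j + (if j = k then ?a i l else 0) + - (if l = i then ?a k j else 0))
      \<in> mirabolic_ideal N"
    by (intro mirabolic_ideal_relation) (simp add: algebra_simps)
  have zero: "(if b then family_single N a else 0) = family_single N (if b then a else 0)" for b and a :: "'k free_alg"
    by (simp add: family_single_def zero_family_alg_def)
  show "family_single N (?a i j) * family_single N (?a k l) =
      family_single N (?a k l) * family_single N (?a i j) +
      (if j = k then family_single N (?a i l) else 0) - (if l = i then family_single N (?a k j) else 0)"
    unfolding zero minus_family_alg_def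
    unfolding family_single_def abs_family_alg_ring family_alg.abs_eq_iff family_eq_def
    using rel by (auto simp: mirabolic_ideal_zero)
qed

section \<open>The Whittaker module over the class-based ring\<close>

locale char0_whittaker_module = whittaker_module N scale act
  for N :: nat and scale :: "'k::field_char_0 \<Rightarrow> 'w::ab_group_add \<Rightarrow> 'w"
    and act :: "'w \<Rightarrow> 'k free_alg set \<Rightarrow> 'w"
begin

lemma act_cls_add_left: "act (v + w) (cls N a) = act v (cls N a) + act w (cls N a)"
  by (rule act_add_left[OF cls_closed])

lemma act_cls_add: "act w (cls N (a + b)) = act w (cls N a) + act w (cls N b)"
  unfolding cls_add by (rule act_add_right[OF cls_closed cls_closed])

lemma act_cls_mult: "act w (cls N (a * b)) = act (act w (cls N a)) (cls N b)"
  unfolding cls_mult by (rule act_mult[OF cls_closed cls_closed])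

lemma act_cls_one: "act w (cls N 1) = w"
  unfolding cls_one by (rule act_one)

lemma act_cls_zero: "act w (cls N 0) = 0"
  using act_cls_add[of w 0 0] by simp

lemma act_cls_cong:
  assumes "a - b \<in> mirabolic_ideal N" shows "act w (cls N a) = act w (cls N b)"
  using act_cls_add[of w "a - b" b] cls_ideal[OF assms] by (simp add: act_cls_zero)

text \<open>Reads the slot of \<open>N\<close> in a representative; by \<open>act_cls_cong\<close>
  its choice does not affect the action.\<close>

definition app :: "'w \<Rightarrow> 'k family_alg \<Rightarrow> 'w" (infixl "\<rhd>" 75) where
  "w \<rhd> x = act w (cls N (rep_family_alg x (Suc N)))"

lemma app_abs: "w \<rhd> abs_family_alg f = act w (cls N (f (Suc N)))"
proof -
  have "family_eq (rep_family_alg (abs_family_alg f)) f"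
    by (rule Quotient3_rep_abs[OF Quotient3_family_alg]) (simp add: family_alg_eqI)
  then show ?thesis
    unfolding app_def by (intro act_cls_cong) (simp add: family_eq_def)
qed

lemma app_gl_module: "gl_module family_scalar (\<lambda>i j. family_single N (E i j)) N app"
proof (intro gl_module.intro gl_module_axioms.intro family_gl_relations)
  fix v w :: 'w and x y :: "'k family_alg"
  obtain f g where fg: "x = abs_family_alg f" "y = abs_family_alg g"
    using family_alg_obtain_abs by metis
  show "(v + w) \<rhd> x = v \<rhd> x + w \<rhd> x"
    unfolding app_def by (rule act_cls_add_left)
  show "v \<rhd> (x + y) = v \<rhd> x + v \<rhd> y" "v \<rhd> (x * y) = v \<rhd> x \<rhd> y"
    by (simp_all add: fg plus_family_alg.abs_eq times_family_alg.abs_eq app_abs act_cls_add act_cls_mult)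
  show "v \<rhd> 1 = v"
    by (simp add: one_family_alg_def app_abs act_cls_one)
qed

lemma app_single: "w \<rhd> family_single N a = act w (cls N a)"
  by (simp add: family_single_def app_abs)

lemma app_scalar: "w \<rhd> family_scalar c = scale c w"
  by (simp add: family_scalar_def app_abs act_scalar)

lemma act_E_shifted:
  "act w (cls N (E_shifted a b)) = w \<rhd> family_single N (E a b) - (if a = Suc b then w else 0)"
proof -
  have "act w (cls N (E_shifted a b)) + act w (cls N (scalar (if a = Suc b then 1 else 0)))
    = act w (cls N (E a b))"
    unfolding act_cls_add[symmetric] by (simp add: E_shifted_def)
  moreover have "act w (cls N (scalar (if a = Suc b then 1 else 0))) = (if a = Suc b then w else 0)"
    by (auto simp: act_scalar)
  ultimately show ?thesis by (simp add: app_single algebra_simps split: if_splits)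
qed

text \<open>Local nilpotency is given for matrices of the nilpotent subalgebra; the indicator
  matrices turn it into a statement on shifted matrix units.\<close>

lemma app_whit_module: "whit_module family_scalar (\<lambda>i j. family_single N (E i j)) N app"
proof (intro whit_module.intro whit_module_axioms.intro app_gl_module)
  interpret W: gl_module family_scalar "\<lambda>i j. family_single N (E i j)" N app
    by (rule app_gl_module)
  fix a b and v :: 'w
  assume ab: "1 \<le> b" "b < a" "a \<le> N"
  have eq: "v \<rhd> W.eshift a b = act v (cls N (E_shifted a b))" for v
    by (simp add: act_E_shifted W.eshift_def W.ac_diff W.ac_one W.ac_zero)
  let ?x = "\<lambda>i j. if i = a \<and> j = b then 1 else (0 :: 'k)"
  have "?x \<in> n_minus N" using ab by (auto simp: n_minus_def)
  from locally_nilpotent[OF this, of v] obtain n where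
    "((\<lambda>v. act v (cls N (E_shifted a b))) ^^ n) v = 0"
    unfolding shifted_matrix_unit[OF ab] by blast
  moreover have "((\<lambda>v. act v (cls N (E_shifted a b))) ^^ n) v = v \<rhd> W.eshift a b ^ n" for n
    by (induction n) (simp_all add: W.ac_one eq[symmetric] W.ac_mult[symmetric] power_Suc2 del: power_Suc)
  ultimately show "\<exists>n. v \<rhd> W.eshift a b ^ n = 0" by metis
qed

end

sublocale char0_whittaker_module \<subseteq>
  W: whit_module family_scalar "\<lambda>i j. family_single N (E i j)" N app
  by (rule app_whit_module)

context char0_whittaker_module
begin

text \<open>Elements of the two rings are compared by their action alone. Sums, products and powers
  preserve the relation, so \<open>P_term\<close> can be translated along its syntax.\<close>

definition represents :: "'k free_alg \<Rightarrow> 'k family_alg \<Rightarrow> bool" where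
  "represents a x \<longleftrightarrow> (\<forall>w. act w (cls N a) = w \<rhd> x)"

lemma represents_0: "represents 0 0"
  by (simp add: represents_def act_cls_zero W.ac_zero)

lemma represents_1: "represents 1 1"
  by (simp add: represents_def act_cls_one W.ac_one)

lemma represents_add: "represents a x \<Longrightarrow> represents b y \<Longrightarrow> represents (a + b) (x + y)"
  by (simp add: represents_def act_cls_add W.ac_add)

lemma represents_mult: "represents a x \<Longrightarrow> represents b y \<Longrightarrow> represents (a * b) (x * y)"
  by (simp add: represents_def act_cls_mult W.ac_mult)

lemma represents_minus: "represents a x \<Longrightarrow> represents (- a) (- x)"
proof -
  assume a: "represents a x"
  have "act w (cls N (- a)) + act w (cls N a) = 0" for w
    unfolding act_cls_add[symmetric] by (simp add: act_cls_zero)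
  then show ?thesis using a by (simp add: represents_def W.ac_minus eq_neg_iff_add_eq_0)
qed

lemma represents_sum: "(\<And>i. i \<in> S \<Longrightarrow> represents (f i) (g i)) \<Longrightarrow> represents (sum f S) (sum g S)"
  by (induction S rule: infinite_finite_induct) (auto intro: represents_0 represents_add)

lemma represents_power: "represents a x \<Longrightarrow> represents (a ^ k) (x ^ k)"
  by (induction k) (auto intro: represents_1 represents_mult)

lemma represents_prod_list:
  "(\<And>i. i \<in> set is \<Longrightarrow> represents (f i) (g i)) \<Longrightarrow>
    represents (prod_list (map f is)) (prod_list (map g is))"
  by (induction "is") (auto intro: represents_1 represents_mult)

lemma represents_scalar: "represents (scalar c) (family_scalar c)"
  by (simp add: represents_def app_scalar act_scalar)

lemma represents_L: "represents (L i j u) (W.ell i j u)"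
  unfolding L_def W.ell_def
  by (intro represents_add) (auto simp: represents_def app_single app_scalar act_scalar act_cls_zero W.ac_zero)

lemma represents_E_shifted: "represents (E_shifted a b) (W.eshift a b)"
  by (simp add: represents_def act_E_shifted W.eshift_def W.ac_diff W.ac_one W.ac_zero)

lemma represents_sign: "represents (of_int (sign \<sigma>)) (of_int (sign \<sigma>))"
  by (simp add: sign_def represents_1 represents_minus)

lemma represents_qminor: "represents (qminor [p..<Suc m] [p..<Suc m] u) (W.pminor p m u)"
proof -
  have "W.pminor p m u = (\<Sum>\<sigma>\<in>{\<sigma>. \<sigma> permutes {..<length [p..<Suc m]}}. of_int (sign \<sigma>) *
      prod_list (map (\<lambda>r. W.ell ([p..<Suc m] ! \<sigma> r) ([p..<Suc m] ! r) (u - of_nat r)) [0..<length [p..<Suc m]]))"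
    unfolding W.pminor_def
    by (subst W.minor_permutation_sum)
      (simp_all add: atLeastLessThanSuc_atLeastAtMost del: upt_Suc)
  then show ?thesis
    unfolding qminor_def
    by (simp only:) (intro represents_sum represents_mult represents_sign represents_prod_list represents_L)
qed

lemma act_P_term: "act w (cls N (P_term (Suc m) p u k)) = w \<rhd> W.proj_term p m u k"
proof -
  have "represents (P_term (Suc m) p u k) (W.proj_term p m u k)"
    unfolding P_term_def W.proj_term_def W.pfall_def
    by (intro represents_mult represents_scalar represents_power represents_minus
        represents_E_shifted represents_prod_list represents_qminor)
  then show ?thesis by (simp add: represents_def)
qed

lemma finite_P_term:
  assumes "1 \<le> j" "j < i" "i \<le> N"
  shows "finite {k. act w (cls N (P_term i j u k)) \<noteq> 0}"
proof -
  obtain m where i: "i = Suc m" using assms by (cases i) auto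
  have m: "j \<le> m" "m < N" using assms i by auto
  obtain n where n: "w \<rhd> W.eshift (Suc m) j ^ n = 0"
    using W.eshift_nilpotent[of j "Suc m" w] assms i by auto
  have "{k. act w (cls N (P_term i j u k)) \<noteq> 0} \<subseteq> {..<n}"
  proof
    fix k assume "k \<in> {k. act w (cls N (P_term i j u k)) \<noteq> 0}"
    then have "w \<rhd> W.eshift (Suc m) j ^ k \<noteq> 0"
      using m by (auto simp: i act_P_term W.ac_proj_term W.ac_zero)
    then show "k \<in> {..<n}" using W.ac_power_zero[OF n, of k] by (cases "n \<le> k") auto
  qed
  then show ?thesis by (rule finite_subset) simp
qed

lemma P_op_eq: "P_op N act (Suc m) p s w = W.proj_op p m s w"
  by (simp add: P_op_def W.proj_op_def act_P_term)

text \<open>The list of pairs is cut into its columns. A row index \<open>i\<close> of the list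
  corresponds to the block that ends at \<open>i - 1\<close>, hence the shift by
  \<open>Suc\<close>.\<close>

lemma kirillov_projector_eq: "kirillov_projector N act u = W.kproj 1 u"
proof -
  have concat: "fold f (concat xss) = fold (fold f) xss" for f :: "'x \<Rightarrow> 'y \<Rightarrow> 'y" and xss
    by (induction xss) (simp_all add: fun_eq_iff)
  have col: "fold (\<lambda>(i, j). P_op N act i j (u j)) (map (\<lambda>i. (i, j)) [Suc j..<Suc N]) = W.col_proj j N (u j)" for j
    unfolding W.col_proj_def map_Suc_upt[symmetric] fold_map
    by (rule ext, rule fold_cong[OF refl refl]) (simp add: fun_eq_iff P_op_eq)
  show ?thesis
    unfolding kirillov_projector_def concat fold_map[of "fold _"] W.kproj_def
    by (intro ext fold_cong[OF refl refl]) (simp only: o_apply col)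
qed

text \<open>\<open>shifted N x\<close> is linear in \<open>x\<close>, character included, so the
  shifted matrix units determine its action. The guard \<open>j < i\<close> cuts out places where
  \<open>x\<close> vanishes.\<close>

lemma act_shifted:
  assumes "x \<in> n_minus N"
  shows "act w (cls N (shifted N x)) =
    (\<Sum>(i, j)\<in>mirabolic_index N. scale (x i j) (if j < i then act w (cls N (E_shifted i j)) else 0))"
proof -
  have fin: "finite (mirabolic_index N)" by (simp add: mirabolic_index_def)
  have act_sum: "act w (cls N (sum f S)) = (\<Sum>i\<in>S. act w (cls N (f i)))" for f :: "'z \<Rightarrow> 'k free_alg" and S
    by (induction S rule: infinite_finite_induct) (simp_all add: act_cls_zero act_cls_add)
  have psi: "psi N x = (\<Sum>(i, j)\<in>mirabolic_index N. if i = Suc j then x i j else 0)"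
  proof -
    have "(\<Sum>(i, j)\<in>mirabolic_index N. if i = Suc j then x i j else 0)
      = (\<Sum>j\<in>{1..<N}. \<Sum>i\<in>{1..N}. if i = Suc j then x i j else 0)"
      unfolding mirabolic_index_def by (subst sum.cartesian_product[symmetric]) (rule sum.swap)
    then show ?thesis by (simp add: psi_def)
  qed
  have "shifted N x = (\<Sum>(i, j)\<in>mirabolic_index N. scalar (x i j) * E_shifted i j)"
  proof -
    have sc: "scalar (sum f S) = (\<Sum>i\<in>S. scalar (f i) :: 'k free_alg)" for f :: "nat \<times> nat \<Rightarrow> 'k" and S
      by (induction S rule: infinite_finite_induct) (simp_all add: scalar_add scalar_zero)
    show ?thesis
      unfolding shifted_def psi sc sum_subtractf[symmetric]
      by (intro sum.cong refl) (auto simp: E_shifted_def right_diff_distrib scalar_def mult_single)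
  qed
  then have "act w (cls N (shifted N x)) =
      (\<Sum>(i, j)\<in>mirabolic_index N. act w (cls N (scalar (x i j) * E_shifted i j)))"
    by (simp add: act_sum case_prod_unfold)
  also have "\<dots> = (\<Sum>(i, j)\<in>mirabolic_index N. scale (x i j) (if j < i then act w (cls N (E_shifted i j)) else 0))"
  proof (rule sum.cong[OF refl], clarify)
    fix i j
    have "scalar (x i j) * E_shifted i j = E_shifted i j * scalar (x i j)"
      by (rule scalar_commute[symmetric])
    then have "act w (cls N (scalar (x i j) * E_shifted i j)) = scale (x i j) (act w (cls N (E_shifted i j)))"
      by (simp add: act_cls_mult act_scalar)
    moreover have "x i j = 0" if "\<not> j < i" using assms that by (auto simp: n_minus_def)
    ultimately show "act w (cls N (scalar (x i j) * E_shifted i j)) =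
        scale (x i j) (if j < i then act w (cls N (E_shifted i j)) else 0)"
      by (cases "j < i") simp_all
  qed
  finally show ?thesis .
qed

lemma whittaker_vectors_iff: "w \<in> whittaker_vectors N act \<longleftrightarrow> W.whit 1 N w"
proof
  assume w: "w \<in> whittaker_vectors N act"
  show "W.whit 1 N w"
    unfolding W.whit_def
  proof (intro allI impI)
    fix a b assume ab: "1 \<le> b \<and> b < a \<and> a \<le> N"
    then have "(\<lambda>i j. if i = a \<and> j = b then 1 else 0) \<in> n_minus N" by (auto simp: n_minus_def)
    then have "act w (cls N (E_shifted a b)) = 0"
      using w ab by (auto simp: whittaker_vectors_def shifted_matrix_unit[symmetric])
    then show "w \<rhd> W.eshift a b = 0"
      using represents_E_shifted by (simp add: represents_def)
  qed
next
  assume w: "W.whit 1 N w"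
  show "w \<in> whittaker_vectors N act"
    unfolding whittaker_vectors_def
  proof (intro CollectI ballI)
    fix x :: "nat \<Rightarrow> nat \<Rightarrow> 'k" assume x: "x \<in> n_minus N"
    have "act w (cls N (E_shifted i j)) = 0" if "(i, j) \<in> mirabolic_index N" "j < i" for i j
      using w that represents_E_shifted by (auto simp: represents_def W.whit_def mirabolic_index_def)
    then show "act w (cls N (shifted N x)) = 0"
      unfolding act_shifted[OF x] by (intro sum.neutral) auto
  qed
qed

text \<open>One equivalence gives existence and uniqueness together. For uniqueness,
  \<open>P\<close> itself serves as the additive map in \<open>kproj_functional\<close>; the
  projected vector is Whittaker, so \<open>P\<close> fixes it.\<close>

lemma kirillov_conditions_iff:
  assumes "N \<ge> 2"
  shows "kirillov_conditions N scale act u P \<longleftrightarrow> P = W.kproj 1 u"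
proof
  have borel: "act w (cls N (E a b + scalar (if a = b then u b else 0))) = w \<rhd> W.ell a b (u b)" for w a b
  proof -
    have "represents (scalar (if a = b then u b else 0) + E a b) (W.ell a b (u b))"
      unfolding W.ell_def by (intro represents_add)
        (auto simp: represents_def app_single app_scalar act_scalar W.ac_zero)
    then show ?thesis by (simp add: represents_def add.commute)
  qed
  have lower: "act w (cls N (E i j - scalar (if i = j + 1 then 1 else 0))) = w \<rhd> W.eshift i j" for w i j
    using represents_E_shifted[of i j] by (simp add: represents_def E_shifted_def)
  have N: "1 \<le> N" using assms by simp
  have whit: "W.whit 1 N (W.kproj 1 u w)" for w
    by (rule W.kproj_whit) (use N in auto)
  {
    assume P: "kirillov_conditions N scale act u P"
    then have lin: "Vector_Spaces.linear scale scale P" and fixed: "\<And>w. W.whit 1 N w \<Longrightarrow> P w = w"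
      and kill: "\<And>a b w. 1 \<le> a \<Longrightarrow> a \<le> b \<Longrightarrow> b \<le> N - 1 \<Longrightarrow> P (w \<rhd> W.ell a b (u b)) = 0"
      by (auto simp: kirillov_conditions_def whittaker_vectors_iff borel)
    have "P (W.kproj 1 u w) = P w" for w
    proof (rule W.kproj_functional)
      show "P (v + w) = P v + P w" for v w
        using lin by (simp add: Vector_Spaces.linear_iff)
      show "P (y \<rhd> W.ell a b (u b)) = 0" if "1 \<le> a" "a \<le> b" "b < N" for a b y
        by (rule kill) (use that in auto)
    qed (use N in auto)
    then show "P = W.kproj 1 u" using fixed[OF whit] by auto
  next
    assume P: "P = W.kproj 1 u"
    show "kirillov_conditions N scale act u P"
      unfolding kirillov_conditions_def P borel lower whittaker_vectors_iff
    proof (intro conjI allI impI ballI)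
      have "W.kproj 1 u (scale c w) = scale c (W.kproj 1 u w)" for c w
        using W.kproj_sc[of 1 u w c] N by (simp add: app_scalar)
      then show "Vector_Spaces.linear scale scale (W.kproj 1 u)"
        using vector_space_axioms W.kproj_add[of 1 u] N by (simp add: Vector_Spaces.linear_iff)
      show "W.kproj 1 u (W.kproj 1 u w) = W.kproj 1 u w" for w
        by (rule W.kproj_fixed[OF N whit])
      show "W.kproj 1 u w \<rhd> W.eshift i j = 0" if "1 \<le> j \<and> j < i \<and> i \<le> N" for i j w
        using whit[of w] that by (auto simp: W.whit_def)
      show "W.kproj 1 u (w \<rhd> W.ell i j (u j)) = 0" if "1 \<le> i \<and> i \<le> j \<and> j \<le> N - 1" for i j w
        by (rule W.kproj_kill) (use that N in auto)
      show "W.kproj 1 u w = w" if "w \<in> whittaker_vectors N act" for w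
        using W.kproj_fixed[OF N] that by (simp add: whittaker_vectors_iff)
    qed
  }
qed

end

theorem theorem1:
  fixes N :: nat
    and u :: "nat \<Rightarrow> 'k::{alg_closed_field, field_char_0}"
    and scale :: "'k \<Rightarrow> 'w::ab_group_add \<Rightarrow> 'w"
    and act :: "'w \<Rightarrow> 'k free_alg set \<Rightarrow> 'w"
  assumes "N \<ge> 2"
    and "whittaker_module N scale act"
  shows "(\<forall>i j w. 1 \<le> j \<and> j < i \<and> i \<le> N \<longrightarrow>
            finite {k. act w (cls N (P_term i j (u j) k)) \<noteq> 0}) \<and>
         kirillov_conditions N scale act u (kirillov_projector N act u) \<and>
         (\<forall>Q. kirillov_conditions N scale act u Q \<longrightarrow> Q = kirillov_projector N act u)"
proof -
  interpret char0_whittaker_module N scale act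
    by (rule char0_whittaker_module.intro) (rule assms(2))
  show ?thesis
    using finite_P_term kirillov_conditions_iff[OF assms(1)] kirillov_projector_eq by auto
qed

end
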